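(* Let $\iota: R\to A$ be a split, centrally projective Frobenius extension, and let $T$ be a left $R$-module. Then $T$ is Wakamatsu tilting over $R$ if and only if $A\otimes_R T$ is Wakamatsu tilting over $A$.
   Context: All rings are associative with unit; modules are left modules unless otherwise specified. A ring extension $\iota:R\to A$ is a unital ring homomorphism. It is a Frobenius extension if $A$ is finitely generated projective as a left $R$-module and $A\cong\operatorname{Hom}_R(A,R)$ as $A$-$R$-bimodules, where $(af)(x)=f(xa)$ and $(fr)(x)=f(x)r$. The extension is split if $\iota$ admits an $R$-$R$-bimodule retraction. A Frobenius extension is centrally projective if ${}_RA_R$ is isomorphic, as an $R$-$R$-bimodule, to a direct summand of $R^n$ for some $n\geq 1$. For an $R$-module $M$, $\operatorname{add}_R(M)$ is the class of direct summands of finite direct sums of copies of $M$. An $R$-module $T$ is Wakamatsu tilting if: (1) $T$ has a projective resolution by finitely generated projective $R$-modules; (2) $\operatorname{Ext}_R^i(T,T)=0$ for all $i>0$; (3) there is an exact sequence $0\to R\to T_0\to T_1\to T_2\to\cdots$ with each $T_j\in\operatorname{add}_R(T)$ which remains exact after applying $\operatorname{Hom}_R(-,T)$. *)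

theory Defs
  imports "HOL-Algebra.Algebra"
begin

section \<open>Left modules and bimodules over noncommutative rings\<close>

text \<open>
  The locale \<^locale>\<open>module\<close> of HOL-Algebra requires a commutative base ring, so the module
  axioms are restated over an arbitrary unital \<^locale>\<open>ring\<close>. The records of HOL-Algebra are kept;
  as usual there, the fields \<^const>\<open>monoid.mult\<close> and \<^const>\<open>one\<close> of a module record carry
  no meaning.
\<close>

locale left_module = R?: ring R + M?: abelian_group M
  for R :: "('a, 'c) ring_scheme" (structure) and M :: "('a, 'b, 'd) module_scheme" (structure) +
  assumes smult_closed:
      "\<lbrakk>a \<in> carrier R; x \<in> carrier M\<rbrakk> \<Longrightarrow> a \<odot>\<^bsub>M\<^esub> x \<in> carrier M"
    and smult_l_distr:
      "\<lbrakk>a \<in> carrier R; b \<in> carrier R; x \<in> carrier M\<rbrakk> \<Longrightarrow>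
        (a \<oplus>\<^bsub>R\<^esub> b) \<odot>\<^bsub>M\<^esub> x = a \<odot>\<^bsub>M\<^esub> x \<oplus>\<^bsub>M\<^esub> b \<odot>\<^bsub>M\<^esub> x"
    and smult_r_distr:
      "\<lbrakk>a \<in> carrier R; x \<in> carrier M; y \<in> carrier M\<rbrakk> \<Longrightarrow>
        a \<odot>\<^bsub>M\<^esub> (x \<oplus>\<^bsub>M\<^esub> y) = a \<odot>\<^bsub>M\<^esub> x \<oplus>\<^bsub>M\<^esub> a \<odot>\<^bsub>M\<^esub> y"
    and smult_assoc:
      "\<lbrakk>a \<in> carrier R; b \<in> carrier R; x \<in> carrier M\<rbrakk> \<Longrightarrow>
        (a \<otimes>\<^bsub>R\<^esub> b) \<odot>\<^bsub>M\<^esub> x = a \<odot>\<^bsub>M\<^esub> (b \<odot>\<^bsub>M\<^esub> x)"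
    and smult_one:
      "x \<in> carrier M \<Longrightarrow> \<one>\<^bsub>R\<^esub> \<odot>\<^bsub>M\<^esub> x = x"

record ('l, 'm, 'r) bimodule = "('l, 'm) module" +
  rsmult :: "'m \<Rightarrow> 'r \<Rightarrow> 'm"

text \<open>
  A ring \<open>A\<close> as an \<open>L\<close>-\<open>S\<close>-bimodule along ring homomorphisms \<open>f : L \<rightarrow> A\<close> and \<open>g : S \<rightarrow> A\<close>.
  A bimodule record is also a (left) module record, so this provides the left module
  structures as well; the regular left module of \<open>A\<close> is \<open>ring_bimodule A id id\<close>.
\<close>

definition ring_bimodule ::
    "('a, 'z) ring_scheme \<Rightarrow> ('l \<Rightarrow> 'a) \<Rightarrow> ('s \<Rightarrow> 'a) \<Rightarrow> ('l, 'a, 's) bimodule" where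
  "ring_bimodule A f g =
    \<lparr>carrier = carrier A, monoid.mult = monoid.mult A, one = \<one>\<^bsub>A\<^esub>,
     ring.zero = \<zero>\<^bsub>A\<^esub>, add = add A,
     smult = (\<lambda>l x. f l \<otimes>\<^bsub>A\<^esub> x), rsmult = (\<lambda>x s. x \<otimes>\<^bsub>A\<^esub> g s)\<rparr>"

abbreviation regular_module :: "('a, 'z) ring_scheme \<Rightarrow> ('a, 'a, 'a) bimodule" where
  "regular_module A \<equiv> ring_bimodule A id id"

definition module_homs ::
    "('r, 'a) ring_scheme \<Rightarrow> ('r, 'm, 'b) module_scheme \<Rightarrow> ('r, 'n, 'c) module_scheme
      \<Rightarrow> ('m \<Rightarrow> 'n) set" where
  "module_homs R M N =
    {f \<in> hom (add_monoid M) (add_monoid N).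
       \<forall>r \<in> carrier R. \<forall>x \<in> carrier M. f (r \<odot>\<^bsub>M\<^esub> x) = r \<odot>\<^bsub>N\<^esub> f x}"

definition module_isos ::
    "('r, 'a) ring_scheme \<Rightarrow> ('r, 'm, 'b) module_scheme \<Rightarrow> ('r, 'n, 'c) module_scheme
      \<Rightarrow> ('m \<Rightarrow> 'n) set" where
  "module_isos R M N = {f \<in> module_homs R M N. bij_betw f (carrier M) (carrier N)}"

definition bimodule_homs ::
    "('l, 'a) ring_scheme \<Rightarrow> ('s, 'd) ring_scheme \<Rightarrow> ('l, 'm, 's, 'b) bimodule_scheme
      \<Rightarrow> ('l, 'n, 's, 'c) bimodule_scheme \<Rightarrow> ('m \<Rightarrow> 'n) set" where
  "bimodule_homs L S M N =
    {f \<in> module_homs L M N.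
       \<forall>s \<in> carrier S. \<forall>x \<in> carrier M. f (rsmult M x s) = rsmult N (f x) s}"

definition bimodule_isos ::
    "('l, 'a) ring_scheme \<Rightarrow> ('s, 'd) ring_scheme \<Rightarrow> ('l, 'm, 's, 'b) bimodule_scheme
      \<Rightarrow> ('l, 'n, 's, 'c) bimodule_scheme \<Rightarrow> ('m \<Rightarrow> 'n) set" where
  "bimodule_isos L S M N = {f \<in> bimodule_homs L S M N. bij_betw f (carrier M) (carrier N)}"


section \<open>Direct sums and direct summands\<close>

text \<open>
  The direct sum of copies of \<open>M\<close> indexed by \<open>I\<close>. For \<open>I = {..<n}\<close> this is \<open>M\<^sup>n\<close>; for
  \<open>M\<close> the regular module it is the free module with basis \<open>I\<close>.
\<close>

definition copies :: "'i set \<Rightarrow> ('r, 'm, 'b) module_scheme \<Rightarrow> ('r, 'i \<Rightarrow> 'm) module" where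
  "copies I M =
    \<lparr>carrier = {f \<in> I \<rightarrow>\<^sub>E carrier M. finite {i \<in> I. f i \<noteq> \<zero>\<^bsub>M\<^esub>}},
     monoid.mult = undefined, one = undefined,
     ring.zero = (\<lambda>i\<in>I. \<zero>\<^bsub>M\<^esub>), add = (\<lambda>f g. \<lambda>i\<in>I. f i \<oplus>\<^bsub>M\<^esub> g i),
     smult = (\<lambda>r f. \<lambda>i\<in>I. r \<odot>\<^bsub>M\<^esub> f i)\<rparr>"

definition bimodule_copies ::
    "'i set \<Rightarrow> ('l, 'm, 's, 'b) bimodule_scheme \<Rightarrow> ('l, 'i \<Rightarrow> 'm, 's) bimodule" where
  "bimodule_copies I M =
    \<lparr>carrier = carrier (copies I M), monoid.mult = undefined, one = undefined,
     ring.zero = \<zero>\<^bsub>copies I M\<^esub>, add = add (copies I M), smult = smult (copies I M),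
     rsmult = (\<lambda>f s. \<lambda>i\<in>I. rsmult M (f i) s)\<rparr>"

definition direct_summand ::
    "('r, 'a) ring_scheme \<Rightarrow> 'm set \<Rightarrow> ('r, 'm, 'b) module_scheme \<Rightarrow> bool" where
  "direct_summand R N M \<longleftrightarrow>
    submodule N R M \<and>
    (\<exists>N'. submodule N' R M \<and> N \<inter> N' = {\<zero>\<^bsub>M\<^esub>} \<and> set_add M N N' = carrier M)"

definition iso_direct_summand ::
    "('r, 'a) ring_scheme \<Rightarrow> ('r, 'm, 'b) module_scheme \<Rightarrow> ('r, 'n, 'c) module_scheme
      \<Rightarrow> bool" where
  "iso_direct_summand R Q M \<longleftrightarrow>
    (\<exists>N. direct_summand R N M \<and> module_isos R Q (M\<lparr>carrier := N\<rparr>) \<noteq> {})"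

definition subbimodule ::
    "('l, 'a) ring_scheme \<Rightarrow> ('s, 'd) ring_scheme \<Rightarrow> 'm set
      \<Rightarrow> ('l, 'm, 's, 'b) bimodule_scheme \<Rightarrow> bool" where
  "subbimodule L S N M \<longleftrightarrow>
    submodule N L M \<and> (\<forall>s \<in> carrier S. \<forall>x \<in> N. rsmult M x s \<in> N)"

definition bimodule_direct_summand ::
    "('l, 'a) ring_scheme \<Rightarrow> ('s, 'd) ring_scheme \<Rightarrow> 'm set
      \<Rightarrow> ('l, 'm, 's, 'b) bimodule_scheme \<Rightarrow> bool" where
  "bimodule_direct_summand L S N M \<longleftrightarrow>
    subbimodule L S N M \<and>
    (\<exists>N'. subbimodule L S N' M \<and> N \<inter> N' = {\<zero>\<^bsub>M\<^esub>} \<and> set_add M N N' = carrier M)"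

definition iso_bimodule_direct_summand ::
    "('l, 'a) ring_scheme \<Rightarrow> ('s, 'd) ring_scheme \<Rightarrow> ('l, 'm, 's, 'b) bimodule_scheme
      \<Rightarrow> ('l, 'n, 's, 'c) bimodule_scheme \<Rightarrow> bool" where
  "iso_bimodule_direct_summand L S Q M \<longleftrightarrow>
    (\<exists>N. bimodule_direct_summand L S N M \<and> bimodule_isos L S Q (M\<lparr>carrier := N\<rparr>) \<noteq> {})"

definition in_add ::
    "('r, 'a) ring_scheme \<Rightarrow> ('r, 'm, 'b) module_scheme \<Rightarrow> ('r, 'n, 'c) module_scheme
      \<Rightarrow> bool" where
  "in_add R M Q \<longleftrightarrow>
    left_module R Q \<and> (\<exists>n::nat. iso_direct_summand R Q (copies {..<n} M))"

definition finitely_generated_module ::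
    "('r, 'a) ring_scheme \<Rightarrow> ('r, 'm, 'b) module_scheme \<Rightarrow> bool" where
  "finitely_generated_module R M \<longleftrightarrow>
    (\<exists>G \<subseteq> carrier M. finite G \<and> (\<forall>N. submodule N R M \<and> G \<subseteq> N \<longrightarrow> N = carrier M))"

text \<open>
  Projective: isomorphic to a direct summand of a free module. Bases taken from the element
  type of \<open>M\<close> suffice, since \<open>M\<close> is a quotient of the free module with basis its own carrier.
\<close>

definition projective_module ::
    "('r, 'a) ring_scheme \<Rightarrow> ('r, 'm, 'b) module_scheme \<Rightarrow> bool" where
  "projective_module R M \<longleftrightarrow>
    left_module R M \<and>
    (\<exists>B :: 'm set. iso_direct_summand R M (copies B (regular_module R)))"

definition fg_projective_module ::
    "('r, 'a) ring_scheme \<Rightarrow> ('r, 'm, 'b) module_scheme \<Rightarrow> bool" where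
  "fg_projective_module R M \<longleftrightarrow> finitely_generated_module R M \<and> projective_module R M"


section \<open>Hom, projective resolutions and Ext\<close>

text \<open>
  The abelian group \<open>Hom\<^sub>R(M, N)\<close>, under the additive fields of the record. Homomorphisms are
  made \<^const>\<open>extensional\<close>, so that each one is represented by a single HOL function; the map
  \<open>Hom\<^sub>R(M', N) \<rightarrow> Hom\<^sub>R(M, N)\<close> induced by \<open>d : M \<rightarrow> M'\<close> is then \<open>pullback M d\<close>.
\<close>

definition Hom ::
    "('r, 'a) ring_scheme \<Rightarrow> ('r, 'm, 'b) module_scheme \<Rightarrow> ('r, 'n, 'c) module_scheme
      \<Rightarrow> ('m \<Rightarrow> 'n) ring" where
  "Hom R M N =
    \<lparr>carrier = module_homs R M N \<inter> extensional (carrier M),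
     monoid.mult = undefined, one = undefined,
     ring.zero = (\<lambda>x\<in>carrier M. \<zero>\<^bsub>N\<^esub>), add = (\<lambda>f g. \<lambda>x\<in>carrier M. f x \<oplus>\<^bsub>N\<^esub> g x)\<rparr>"

definition pullback ::
    "('r, 'm, 'b) module_scheme \<Rightarrow> ('m \<Rightarrow> 'k) \<Rightarrow> ('k \<Rightarrow> 'n) \<Rightarrow> 'm \<Rightarrow> 'n" where
  "pullback M d f = compose (carrier M) f d"

text \<open>Exactness of \<open>\<dots> \<rightarrow> P 2 \<rightarrow> P 1 \<rightarrow> P 0 \<rightarrow> M \<rightarrow> 0\<close>, with \<open>d i : P (i + 1) \<rightarrow> P i\<close>.\<close>

definition projective_resolution ::
    "('r, 'a) ring_scheme \<Rightarrow> ('r, 'm, 'b) module_scheme \<Rightarrow> (nat \<Rightarrow> ('r, 'p) module)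
      \<Rightarrow> (nat \<Rightarrow> 'p \<Rightarrow> 'p) \<Rightarrow> ('p \<Rightarrow> 'm) \<Rightarrow> bool" where
  "projective_resolution R M P d e \<longleftrightarrow>
    (\<forall>i. projective_module R (P i)) \<and>
    (\<forall>i. d i \<in> module_homs R (P (Suc i)) (P i)) \<and>
    e \<in> module_homs R (P 0) M \<and>
    e ` carrier (P 0) = carrier M \<and>
    d 0 ` carrier (P 1) = a_kernel (P 0) M e \<and>
    (\<forall>i. d (Suc i) ` carrier (P (Suc (Suc i))) = a_kernel (P (Suc i)) (P i) (d i))"

text \<open>
  A chosen projective resolution of \<open>M\<close>. The type of the elements of its terms is large enough
  for one to exist for every module \<open>M\<close>: let \<open>Q\<close> be the infinite type of lists over \<open>'m \<times> 'r\<close>.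
  A free module whose basis is a subset of \<open>Q\<close> consists of finitely supported functions, so it
  has at most \<open>|Q|\<close> elements, as have its submodules; hence \<open>M\<close>, and inductively every syzygy,
  is a quotient of a free module of this kind.
\<close>

definition chosen_resolution ::
    "('r, 'a) ring_scheme \<Rightarrow> ('r, 'm, 'b) module_scheme
      \<Rightarrow> (nat \<Rightarrow> ('r, ('m \<times> 'r) list \<Rightarrow> 'r) module)
        \<times> (nat \<Rightarrow> (('m \<times> 'r) list \<Rightarrow> 'r) \<Rightarrow> (('m \<times> 'r) list \<Rightarrow> 'r))
        \<times> ((('m \<times> 'r) list \<Rightarrow> 'r) \<Rightarrow> 'm)" where
  "chosen_resolution R M = (SOME (P, d, e). projective_resolution R M P d e)"

definition cocycles ::
    "('r, 'a) ring_scheme \<Rightarrow> (nat \<Rightarrow> ('r, 'p) module) \<Rightarrow> (nat \<Rightarrow> 'p \<Rightarrow> 'p)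
      \<Rightarrow> ('r, 'n, 'c) module_scheme \<Rightarrow> nat \<Rightarrow> ('p \<Rightarrow> 'n) set" where
  "cocycles R P d N i =
    a_kernel (Hom R (P i) N) (Hom R (P (Suc i)) N) (pullback (P (Suc i)) (d i))"

definition coboundaries ::
    "('r, 'a) ring_scheme \<Rightarrow> (nat \<Rightarrow> ('r, 'p) module) \<Rightarrow> (nat \<Rightarrow> 'p \<Rightarrow> 'p)
      \<Rightarrow> ('r, 'n, 'c) module_scheme \<Rightarrow> nat \<Rightarrow> ('p \<Rightarrow> 'n) set" where
  "coboundaries R P d N i =
    (case i of
       0 \<Rightarrow> {\<zero>\<^bsub>Hom R (P 0) N\<^esub>}
     | Suc j \<Rightarrow> pullback (P (Suc j)) (d j) ` carrier (Hom R (P j) N))"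

text \<open>\<open>Ext\<^sub>R\<^sup>i(M, N) = H\<^sup>i(Hom\<^sub>R(P, N))\<close>, as a multiplicatively written group.\<close>

definition Ext ::
    "('r, 'a) ring_scheme \<Rightarrow> nat \<Rightarrow> ('r, 'm, 'b) module_scheme \<Rightarrow> ('r, 'n, 'c) module_scheme
      \<Rightarrow> ((('m \<times> 'r) list \<Rightarrow> 'r) \<Rightarrow> 'n) set monoid" where
  "Ext R i M N =
    (let (P, d, e) = chosen_resolution R M in
      (add_monoid (Hom R (P i) N))\<lparr>carrier := cocycles R P d N i\<rparr> Mod coboundaries R P d N i)"


section \<open>Wakamatsu tilting modules\<close>

text \<open>
  Every finitely generated projective \<open>R\<close>-module is isomorphic to a submodule of some \<open>R\<^sup>n\<close>, and
  every module in \<open>add\<^sub>R(T)\<close> to a submodule of some \<open>T\<^sup>n\<close>. Both have a carrier of functions on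
  \<^typ>\<open>nat\<close>, so fixing the element types below loses no generality.
\<close>

definition has_fg_projective_resolution ::
    "('r, 'a) ring_scheme \<Rightarrow> ('r, 'm, 'b) module_scheme \<Rightarrow> bool" where
  "has_fg_projective_resolution R M \<longleftrightarrow>
    (\<exists>(P :: nat \<Rightarrow> ('r, nat \<Rightarrow> 'r) module) d e.
      projective_resolution R M P d e \<and> (\<forall>i. fg_projective_module R (P i)))"

text \<open>Exactness of \<open>0 \<rightarrow> R \<rightarrow> C 0 \<rightarrow> C 1 \<rightarrow> C 2 \<rightarrow> \<dots>\<close>, with \<open>d j : C j \<rightarrow> C (j + 1)\<close>.\<close>

definition exact_coresolution ::
    "('r, 'a) ring_scheme \<Rightarrow> (nat \<Rightarrow> ('r, 'p) module) \<Rightarrow> ('r \<Rightarrow> 'p)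
      \<Rightarrow> (nat \<Rightarrow> 'p \<Rightarrow> 'p) \<Rightarrow> bool" where
  "exact_coresolution R C e d \<longleftrightarrow>
    e \<in> module_homs R (regular_module R) (C 0) \<and>
    (\<forall>j. d j \<in> module_homs R (C j) (C (Suc j))) \<and>
    inj_on e (carrier R) \<and>
    e ` carrier R = a_kernel (C 0) (C 1) (d 0) \<and>
    (\<forall>j. d j ` carrier (C j) = a_kernel (C (Suc j)) (C (Suc (Suc j))) (d (Suc j)))"

text \<open>
  Exactness of
  \<open>\<dots> \<rightarrow> Hom\<^sub>R(C 1, T) \<rightarrow> Hom\<^sub>R(C 0, T) \<rightarrow> Hom\<^sub>R(R, T) \<rightarrow> 0\<close>.
\<close>

definition Hom_exact_coresolution ::
    "('r, 'a) ring_scheme \<Rightarrow> (nat \<Rightarrow> ('r, 'p) module) \<Rightarrow> ('r \<Rightarrow> 'p)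
      \<Rightarrow> (nat \<Rightarrow> 'p \<Rightarrow> 'p) \<Rightarrow> ('r, 't, 'c) module_scheme \<Rightarrow> bool" where
  "Hom_exact_coresolution R C e d T \<longleftrightarrow>
    pullback (regular_module R) e ` carrier (Hom R (C 0) T)
      = carrier (Hom R (regular_module R) T) \<and>
    pullback (C 0) (d 0) ` carrier (Hom R (C 1) T)
      = a_kernel (Hom R (C 0) T) (Hom R (regular_module R) T) (pullback (regular_module R) e) \<and>
    (\<forall>j. pullback (C (Suc j)) (d (Suc j)) ` carrier (Hom R (C (Suc (Suc j))) T)
      = a_kernel (Hom R (C (Suc j)) T) (Hom R (C j) T) (pullback (C j) (d j)))"

definition wakamatsu_tilting ::
    "('r, 'a) ring_scheme \<Rightarrow> ('r, 't, 'b) module_scheme \<Rightarrow> bool" where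
  "wakamatsu_tilting R T \<longleftrightarrow>
    left_module R T \<and>
    has_fg_projective_resolution R T \<and>
    (\<forall>i>0. trivial_group (Ext R i T T)) \<and>
    (\<exists>(C :: nat \<Rightarrow> ('r, nat \<Rightarrow> 't) module) e d.
      (\<forall>j. in_add R T (C j)) \<and>
      exact_coresolution R C e d \<and> Hom_exact_coresolution R C e d T)"


section \<open>Tensor products\<close>

definition tensor_relations ::
    "('s, 'a) ring_scheme \<Rightarrow> ('l, 'x, 's, 'b) bimodule_scheme \<Rightarrow> ('s, 'm, 'c) module_scheme
      \<Rightarrow> (('x \<times> 'm) \<Rightarrow>\<^sub>0 int) set" where
  "tensor_relations S Q M =
    {frag_of (x \<oplus>\<^bsub>Q\<^esub> y, m) - frag_of (x, m) - frag_of (y, m) | x y m.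
       x \<in> carrier Q \<and> y \<in> carrier Q \<and> m \<in> carrier M} \<union>
    {frag_of (x, m \<oplus>\<^bsub>M\<^esub> n) - frag_of (x, m) - frag_of (x, n) | x m n.
       x \<in> carrier Q \<and> m \<in> carrier M \<and> n \<in> carrier M} \<union>
    {frag_of (rsmult Q x s, m) - frag_of (x, s \<odot>\<^bsub>M\<^esub> m) | x s m.
       x \<in> carrier Q \<and> s \<in> carrier S \<and> m \<in> carrier M}"

text \<open>
  The left \<open>L\<close>-module \<open>Q \<otimes>\<^sub>S M\<close> for an \<open>L\<close>-\<open>S\<close>-bimodule \<open>Q\<close> and a left \<open>S\<close>-module \<open>M\<close>: the free
  abelian group on the pairs \<open>(x, m)\<close> modulo the subgroup \<open>K\<close> generated by the relations above.
  With \<open>h\<close> the endomorphism \<open>(x, m) \<mapsto> (a x, m)\<close> of the free abelian group, the action of \<open>a\<close> sends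
  the coset \<open>K + c\<close> to \<open>K + h (K + c)\<close>, which is \<open>K + h c\<close> because \<open>h\<close> maps \<open>K\<close> into itself.
\<close>

definition tensor_product ::
    "('s, 'a) ring_scheme \<Rightarrow> ('l, 'x, 's, 'b) bimodule_scheme \<Rightarrow> ('s, 'm, 'c) module_scheme
      \<Rightarrow> ('l, (('x \<times> 'm) \<Rightarrow>\<^sub>0 int) set) module" where
  "tensor_product S Q M =
    (let F = free_Abelian_group (carrier Q \<times> carrier M);
         K = generate F (tensor_relations S Q M)
     in \<lparr>carrier = carrier (F Mod K), monoid.mult = undefined, one = undefined,
         ring.zero = \<one>\<^bsub>F Mod K\<^esub>, add = monoid.mult (F Mod K),
         smult = (\<lambda>a C. K <#>\<^bsub>F\<^esub>
           (frag_extend (\<lambda>(x, m). frag_of (a \<odot>\<^bsub>Q\<^esub> x, m)) ` C))\<rparr>)"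

definition extend_scalars ::
    "('r, 'a) ring_scheme \<Rightarrow> ('s, 'b) ring_scheme \<Rightarrow> ('r \<Rightarrow> 's) \<Rightarrow> ('r, 't, 'c) module_scheme
      \<Rightarrow> ('s, (('s \<times> 't) \<Rightarrow>\<^sub>0 int) set) module" where
  "extend_scalars R A \<iota> T = tensor_product R (ring_bimodule A id \<iota>) T"


section \<open>Frobenius extensions\<close>

text \<open>
  \<open>Hom\<^sub>R(A, R)\<close> as an \<open>A\<close>-\<open>R\<close>-bimodule: \<open>(a f)(x) = f (x a)\<close> and \<open>(f r)(x) = f x r\<close>.
\<close>

definition dual_bimodule ::
    "('r, 'a) ring_scheme \<Rightarrow> ('s, 'b) ring_scheme \<Rightarrow> ('r \<Rightarrow> 's) \<Rightarrow> ('s, 's \<Rightarrow> 'r, 'r) bimodule"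
  where
  "dual_bimodule R A \<iota> =
    (let H = Hom R (ring_bimodule A \<iota> \<iota>) (regular_module R)
     in \<lparr>carrier = carrier H, monoid.mult = undefined, one = undefined,
         ring.zero = \<zero>\<^bsub>H\<^esub>, add = add H,
         smult = (\<lambda>a f. \<lambda>x\<in>carrier A. f (x \<otimes>\<^bsub>A\<^esub> a)),
         rsmult = (\<lambda>f r. \<lambda>x\<in>carrier A. f x \<otimes>\<^bsub>R\<^esub> r)\<rparr>)"

definition frobenius_extension ::
    "('r, 'a) ring_scheme \<Rightarrow> ('s, 'b) ring_scheme \<Rightarrow> ('r \<Rightarrow> 's) \<Rightarrow> bool" where
  "frobenius_extension R A \<iota> \<longleftrightarrow>
    ring_hom_ring R A \<iota> \<and>
    fg_projective_module R (ring_bimodule A \<iota> \<iota>) \<and>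
    bimodule_isos A R (ring_bimodule A id \<iota>) (dual_bimodule R A \<iota>) \<noteq> {}"

definition split_extension ::
    "('r, 'a) ring_scheme \<Rightarrow> ('s, 'b) ring_scheme \<Rightarrow> ('r \<Rightarrow> 's) \<Rightarrow> bool" where
  "split_extension R A \<iota> \<longleftrightarrow>
    ring_hom_ring R A \<iota> \<and>
    (\<exists>p \<in> bimodule_homs R R (ring_bimodule A \<iota> \<iota>) (regular_module R).
      \<forall>r \<in> carrier R. p (\<iota> r) = r)"

definition centrally_projective_extension ::
    "('r, 'a) ring_scheme \<Rightarrow> ('s, 'b) ring_scheme \<Rightarrow> ('r \<Rightarrow> 's) \<Rightarrow> bool" where
  "centrally_projective_extension R A \<iota> \<longleftrightarrow>
    ring_hom_ring R A \<iota> \<and>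
    (\<exists>n::nat. n \<ge> 1 \<and>
      iso_bimodule_direct_summand R R (ring_bimodule A \<iota> \<iota>)
        (bimodule_copies {..<n} (regular_module R)))"

end

theory Submission
  imports Defs
begin

text \<open>
  Central projectivity yields elements \<open>c i\<close> of \<open>A\<close> centralizing \<open>R\<close> and bimodule functionals
  \<open>p i : A \<rightarrow> R\<close> with \<open>a = \<Sum>i. p i a \<cdot> c i\<close>. Hence \<open>A \<otimes> M\<close> is controlled by the \<open>R\<close>-linear
  coordinates \<open>a \<otimes> m \<mapsto> p i a \<cdot> m\<close>: extension of scalars is exact, preserves \<open>add\<close>, and
  \<open>Hom\<^sub>A(A \<otimes> M, A \<otimes> T) = Hom\<^sub>R(M, A \<otimes> T)\<close> is a summand of a power of \<open>Hom\<^sub>R(M, T)\<close>. This carries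
  the resolution and the coresolution of \<open>T\<close> over to \<open>A \<otimes> T\<close>.

  Conversely, let \<open>A \<otimes> T\<close> be Wakamatsu tilting. Restricted to \<open>R\<close>, its resolution is one of a
  module of which \<open>T\<close> is a retract (\<open>A\<close> is split), and its coresolution of \<open>A\<close> is one by modules in
  \<open>add T\<close> of a module of which \<open>R\<close> is a retract; it stays \<open>Hom(-, T)\<close>-exact because
  \<open>Hom\<^sub>R(N, T) = Hom\<^sub>A(N, A \<otimes> T)\<close> for a Frobenius extension. A (co)resolution of a module passes to
  a retract: if a syzygy \<open>K\<close> of the retract is itself a retract of \<open>L \<oplus> D\<close> with \<open>L\<close> a syzygy of the
  large module and \<open>D\<close> a sum of earlier terms, then so is the next one, and the resulting
  \<open>n\<close>-th term is the sum of the first \<open>n + 1\<close> terms of the given (co)resolution.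
\<close>

section \<open>Homomorphisms of left modules\<close>

text \<open>In the converse, the idempotent of \<open>A \<otimes> T\<close> with image
  \<open>T\<close> lifts to its resolution only as a chain map that is idempotent up to homotopy, so
  the terms cannot simply be cut down to summands; this forces the cumulative sums. The vanishing of
  Ext over \<open>R\<close> is obtained by a detour: the new resolution of \<open>T\<close> is
  extended to \<open>A\<close>, where it is a second resolution of \<open>A \<otimes> T\<close>;
  independence of the resolution carries the vanishing to it, and the retraction
  \<open>A \<rightarrow> R\<close> brings it down. The Frobenius isomorphism identifies the
  coinduced module \<open>Hom_R(A, T)\<close> with \<open>A \<otimes> T\<close>, which makes
  induction a right adjoint of restriction as well as a left one. A second constraint is typing:
  tilting fixes the element types of all terms, while products, tensor products and changes of ring
  alter them. Modules are therefore described by maps and identities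
  (\<open>add_decomposition\<close>, \<open>biproduct\<close>, \<open>induced\<close>), which make
  sense on any element type, and are moved to the required type by isomorphism.\<close>

lemma module_homsI:
  assumes "\<And>x. x \<in> carrier M \<Longrightarrow> f x \<in> carrier N"
    and "\<And>x y. x \<in> carrier M \<Longrightarrow> y \<in> carrier M \<Longrightarrow> f (x \<oplus>\<^bsub>M\<^esub> y) = f x \<oplus>\<^bsub>N\<^esub> f y"
    and "\<And>r x. r \<in> carrier R \<Longrightarrow> x \<in> carrier M \<Longrightarrow> f (r \<odot>\<^bsub>M\<^esub> x) = r \<odot>\<^bsub>N\<^esub> f x"
  shows "f \<in> module_homs R M N"
  using assms unfolding module_homs_def hom_def by auto

lemma module_homsD:
  assumes "f \<in> module_homs R M N"
  shows "\<And>x. x \<in> carrier M \<Longrightarrow> f x \<in> carrier N"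
    and "\<And>x y. x \<in> carrier M \<Longrightarrow> y \<in> carrier M \<Longrightarrow> f (x \<oplus>\<^bsub>M\<^esub> y) = f x \<oplus>\<^bsub>N\<^esub> f y"
    and "\<And>r x. r \<in> carrier R \<Longrightarrow> x \<in> carrier M \<Longrightarrow> f (r \<odot>\<^bsub>M\<^esub> x) = r \<odot>\<^bsub>N\<^esub> f x"
  using assms unfolding module_homs_def hom_def by auto

lemma module_homs_comp:
  assumes "f \<in> module_homs R M N" "g \<in> module_homs R N K"
  shows "(\<lambda>x. g (f x)) \<in> module_homs R M K"
  by (rule module_homsI) (simp_all add: module_homsD[OF assms(1)] module_homsD[OF assms(2)])

lemma module_homs_cong:
  assumes "f \<in> module_homs R M N" "\<And>x. x \<in> carrier M \<Longrightarrow> g x = f x" "left_module R M"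
  shows "g \<in> module_homs R M N"
proof -
  interpret M: left_module R M by fact
  show ?thesis
    by (rule module_homsI) (simp_all add: module_homsD[OF assms(1)] assms(2) M.smult_closed)
qed

lemma module_homs_id: "(\<lambda>x. x) \<in> module_homs R M M"
  by (rule module_homsI) auto

lemma abelian_group_left_module: "left_module R M \<Longrightarrow> abelian_group M"
  by (simp add: left_module_def)

lemma ring_left_module: "left_module R M \<Longrightarrow> ring R"
  by (simp add: left_module_def)

text \<open>Stated for bare additive maps because they are applied across rings: to
  \<open>\<lambda>r. r \<odot> x\<close> from a ring to a module, and later to functionals from
  \<open>A\<close> to \<open>R\<close>.\<close>

lemma additive_zero:
  assumes "abelian_group M" "abelian_group N"
    "\<And>x. x \<in> carrier M \<Longrightarrow> f x \<in> carrier N"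
    "\<And>x y. x \<in> carrier M \<Longrightarrow> y \<in> carrier M \<Longrightarrow> f (x \<oplus>\<^bsub>M\<^esub> y) = f x \<oplus>\<^bsub>N\<^esub> f y"
  shows "f \<zero>\<^bsub>M\<^esub> = \<zero>\<^bsub>N\<^esub>"
proof -
  interpret M: abelian_group M by fact
  interpret N: abelian_group N by fact
  have "f \<zero>\<^bsub>M\<^esub> = f \<zero>\<^bsub>M\<^esub> \<oplus>\<^bsub>N\<^esub> f \<zero>\<^bsub>M\<^esub>"
    using assms(4)[of "\<zero>\<^bsub>M\<^esub>" "\<zero>\<^bsub>M\<^esub>"] by simp
  then show ?thesis using assms(3)[of "\<zero>\<^bsub>M\<^esub>"] by (simp add: N.add.l_cancel_one')
qed

lemma additive_uminus:
  assumes "abelian_group M" "abelian_group N"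
    "\<And>x. x \<in> carrier M \<Longrightarrow> f x \<in> carrier N"
    "\<And>x y. x \<in> carrier M \<Longrightarrow> y \<in> carrier M \<Longrightarrow> f (x \<oplus>\<^bsub>M\<^esub> y) = f x \<oplus>\<^bsub>N\<^esub> f y"
    "x \<in> carrier M"
  shows "f (\<ominus>\<^bsub>M\<^esub> x) = \<ominus>\<^bsub>N\<^esub> f x"
proof -
  interpret M: abelian_group M by fact
  interpret N: abelian_group N by fact
  have "f (\<ominus>\<^bsub>M\<^esub> x) \<oplus>\<^bsub>N\<^esub> f x = \<zero>\<^bsub>N\<^esub>"
    using assms(4)[of "\<ominus>\<^bsub>M\<^esub> x" x] additive_zero[OF assms(1-4)] assms(5)
    by (simp add: M.l_neg)
  then show ?thesis using assms(3,5) N.minus_equality by simp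
qed

lemma additive_finsum:
  assumes "abelian_group M" "abelian_group N"
    "\<And>x. x \<in> carrier M \<Longrightarrow> f x \<in> carrier N"
    "\<And>x y. x \<in> carrier M \<Longrightarrow> y \<in> carrier M \<Longrightarrow> f (x \<oplus>\<^bsub>M\<^esub> y) = f x \<oplus>\<^bsub>N\<^esub> f y"
    "\<And>i. i \<in> I \<Longrightarrow> h i \<in> carrier M"
  shows "f (finsum M h I) = finsum N (\<lambda>i. f (h i)) I"
proof -
  interpret M: abelian_group M by fact
  interpret N: abelian_group N by fact
  have [simp]: "f \<zero>\<^bsub>M\<^esub> = \<zero>\<^bsub>N\<^esub>" by (rule additive_zero[OF assms(1-4)])
  show ?thesis using assms(5)
  proof (induction I rule: infinite_finite_induct)
    case (insert i I)
    then have "h \<in> I \<rightarrow> carrier M" "(\<lambda>i. f (h i)) \<in> I \<rightarrow> carrier N" using assms(3) by auto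
    with insert show ?case using assms(3,4) by (simp add: M.finsum_insert N.finsum_insert)
  qed simp_all
qed

context
  fixes R :: "('r, 'x) ring_scheme" and M :: "('r, 'm, 'y) module_scheme"
    and N :: "('r, 'n, 'z) module_scheme" and f
  assumes f: "f \<in> module_homs R M N" and M: "left_module R M" and N: "left_module R N"
begin

lemmas hom_additive =
  abelian_group_left_module[OF M] abelian_group_left_module[OF N] module_homsD(1,2)[OF f]

lemma module_homs_zero: "f \<zero>\<^bsub>M\<^esub> = \<zero>\<^bsub>N\<^esub>"
  by (rule additive_zero[OF hom_additive])

lemma module_homs_uminus: "x \<in> carrier M \<Longrightarrow> f (\<ominus>\<^bsub>M\<^esub> x) = \<ominus>\<^bsub>N\<^esub> f x"
  by (rule additive_uminus[OF hom_additive])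

lemma module_homs_minus:
  "x \<in> carrier M \<Longrightarrow> y \<in> carrier M \<Longrightarrow> f (x \<ominus>\<^bsub>M\<^esub> y) = f x \<ominus>\<^bsub>N\<^esub> f y"
  using abelian_group.a_inv_closed[OF hom_additive(1)]
  by (simp add: a_minus_def module_homs_uminus module_homsD[OF f])

lemma module_homs_finsum:
  "(\<And>i. i \<in> I \<Longrightarrow> h i \<in> carrier M) \<Longrightarrow> f (finsum M h I) = finsum N (\<lambda>i. f (h i)) I"
  by (rule additive_finsum[OF hom_additive])

end

lemma left_module_smult_zero:
  assumes "left_module R M"
  shows "r \<in> carrier R \<Longrightarrow> r \<odot>\<^bsub>M\<^esub> \<zero>\<^bsub>M\<^esub> = \<zero>\<^bsub>M\<^esub>"
    and "x \<in> carrier M \<Longrightarrow> \<zero>\<^bsub>R\<^esub> \<odot>\<^bsub>M\<^esub> x = \<zero>\<^bsub>M\<^esub>"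
    and "r \<in> carrier R \<Longrightarrow> x \<in> carrier M \<Longrightarrow> r \<odot>\<^bsub>M\<^esub> (\<ominus>\<^bsub>M\<^esub> x) = \<ominus>\<^bsub>M\<^esub> (r \<odot>\<^bsub>M\<^esub> x)"
proof -
  interpret M: left_module R M by fact
  note ag = M.M.abelian_group_axioms M.R.abelian_group_axioms
  show "r \<in> carrier R \<Longrightarrow> r \<odot>\<^bsub>M\<^esub> \<zero>\<^bsub>M\<^esub> = \<zero>\<^bsub>M\<^esub>"
    by (rule additive_zero[OF ag(1) ag(1)]) (simp_all add: M.smult_closed M.smult_r_distr)
  show "x \<in> carrier M \<Longrightarrow> \<zero>\<^bsub>R\<^esub> \<odot>\<^bsub>M\<^esub> x = \<zero>\<^bsub>M\<^esub>"
    by (rule additive_zero[OF ag(2) ag(1)]) (simp_all add: M.smult_closed M.smult_l_distr)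
  show "r \<in> carrier R \<Longrightarrow> x \<in> carrier M \<Longrightarrow> r \<odot>\<^bsub>M\<^esub> (\<ominus>\<^bsub>M\<^esub> x) = \<ominus>\<^bsub>M\<^esub> (r \<odot>\<^bsub>M\<^esub> x)"
    by (rule additive_uminus[OF ag(1) ag(1)]) (simp_all add: M.smult_closed M.smult_r_distr)
qed

lemma smult_finsum:
  assumes "left_module R M" "r \<in> carrier R" "\<And>i. i \<in> I \<Longrightarrow> h i \<in> carrier M"
  shows "r \<odot>\<^bsub>M\<^esub> finsum M h I = finsum M (\<lambda>i. r \<odot>\<^bsub>M\<^esub> h i) I"
proof -
  interpret M: left_module R M by fact
  show ?thesis
    by (rule additive_finsum[OF M.M.abelian_group_axioms M.M.abelian_group_axioms])
       (use assms in \<open>simp_all add: M.smult_closed M.smult_r_distr\<close>)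
qed

lemma finsum_smult:
  assumes "left_module R M" "x \<in> carrier M" "\<And>i. i \<in> I \<Longrightarrow> h i \<in> carrier R"
  shows "finsum R h I \<odot>\<^bsub>M\<^esub> x = finsum M (\<lambda>i. h i \<odot>\<^bsub>M\<^esub> x) I"
proof -
  interpret M: left_module R M by fact
  show ?thesis
    by (rule additive_finsum[where f="\<lambda>r. r \<odot>\<^bsub>M\<^esub> x",
          OF M.R.abelian_group_axioms M.M.abelian_group_axioms])
       (use assms in \<open>simp_all add: M.smult_closed M.smult_l_distr\<close>)
qed

lemma module_homs_sum:
  assumes "left_module R M" "left_module R N" "\<And>i. i \<in> I \<Longrightarrow> h i \<in> module_homs R M N"
  shows "(\<lambda>x. finsum N (\<lambda>i. h i x) I) \<in> module_homs R M N"
proof -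
  interpret M: left_module R M by fact
  interpret N: left_module R N by fact
  note hD = module_homsD[OF assms(3)]
  show ?thesis
  proof (rule module_homsI)
    fix x assume x: "x \<in> carrier M"
    then show "finsum N (\<lambda>i. h i x) I \<in> carrier N" by (simp add: hD(1) Pi_def)
    fix y assume y: "y \<in> carrier M"
    have "finsum N (\<lambda>i. h i (x \<oplus>\<^bsub>M\<^esub> y)) I = finsum N (\<lambda>i. h i x \<oplus>\<^bsub>N\<^esub> h i y) I"
      by (rule N.M.finsum_cong') (simp_all add: hD x y Pi_def)
    then show "finsum N (\<lambda>i. h i (x \<oplus>\<^bsub>M\<^esub> y)) I = finsum N (\<lambda>i. h i x) I \<oplus>\<^bsub>N\<^esub> finsum N (\<lambda>i. h i y) I"
      using x y by (simp add: N.M.finsum_addf hD(1) Pi_def)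
  next
    fix r x assume r: "r \<in> carrier R" and x: "x \<in> carrier M"
    have "finsum N (\<lambda>i. h i (r \<odot>\<^bsub>M\<^esub> x)) I = finsum N (\<lambda>i. r \<odot>\<^bsub>N\<^esub> h i x) I"
      by (rule N.M.finsum_cong') (simp_all add: hD r x Pi_def N.smult_closed)
    then show "finsum N (\<lambda>i. h i (r \<odot>\<^bsub>M\<^esub> x)) I = r \<odot>\<^bsub>N\<^esub> finsum N (\<lambda>i. h i x) I"
      using r x by (simp add: smult_finsum[OF assms(2)] hD(1))
  qed
qed

lemma module_homs_add:
  assumes "f \<in> module_homs R M N" "g \<in> module_homs R M N" "left_module R M" "left_module R N"
  shows "(\<lambda>x. f x \<oplus>\<^bsub>N\<^esub> g x) \<in> module_homs R M N"
proof -
  interpret M: left_module R M by fact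
  interpret N: left_module R N by fact
  show ?thesis
    by (rule module_homsI)
       (simp_all add: module_homsD[OF assms(1)] module_homsD[OF assms(2)] N.smult_r_distr N.M.a_ac)
qed

lemma module_homs_diff:
  assumes "f \<in> module_homs R M N" "g \<in> module_homs R M N" "left_module R M" "left_module R N"
  shows "(\<lambda>x. f x \<ominus>\<^bsub>N\<^esub> g x) \<in> module_homs R M N"
proof -
  interpret M: left_module R M by fact
  interpret N: left_module R N by fact
  show ?thesis unfolding a_minus_def
    by (rule module_homsI)
       (simp_all add: module_homsD[OF assms(1)] module_homsD[OF assms(2)] N.smult_r_distr
          N.M.a_ac N.M.minus_add left_module_smult_zero[OF assms(4)])
qed

lemma module_homs_const_zero:
  assumes "left_module R N" shows "(\<lambda>_. \<zero>\<^bsub>N\<^esub>) \<in> module_homs R M N"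
proof -
  interpret N: left_module R N by fact
  show ?thesis by (rule module_homsI) (simp_all add: left_module_smult_zero[OF assms])
qed

section \<open>Submodules, images and kernels\<close>

lemma left_module_submodule:
  assumes "left_module R M" "submodule N R M"
  shows "left_module R (M\<lparr>carrier := N\<rparr>)"
proof -
  interpret M: left_module R M by fact
  interpret N: submodule N R M by fact
  have sub: "N \<subseteq> carrier M" using N.subset by simp
  have inv: "\<ominus>\<^bsub>M\<^esub> x \<in> N" if "x \<in> N" for x
    using N.m_inv_closed[OF that] by (simp add: a_inv_def)
  have "abelian_group (M\<lparr>carrier := N\<rparr>)"
  proof (rule abelian_groupI)
    show "\<exists>y\<in>carrier (M\<lparr>carrier := N\<rparr>). y \<oplus>\<^bsub>M\<lparr>carrier := N\<rparr>\<^esub> x = \<zero>\<^bsub>M\<lparr>carrier := N\<rparr>\<^esub>"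
      if "x \<in> carrier (M\<lparr>carrier := N\<rparr>)" for x
      using that subsetD[OF sub] by (intro bexI[of _ "\<ominus>\<^bsub>M\<^esub> x"]) (simp_all add: M.M.l_neg inv)
  qed (use subsetD[OF sub] N.m_closed N.one_closed in \<open>simp_all add: M.M.a_ac\<close>)
  moreover have "left_module_axioms R (M\<lparr>carrier := N\<rparr>)"
    using sub by unfold_locales
      (auto simp: M.smult_l_distr M.smult_r_distr M.smult_assoc M.smult_one subset_iff)
  ultimately show ?thesis
    using M.R.ring_axioms by (simp add: left_module_def)
qed

text \<open>Closure under negation follows from closure under the scalar -1.\<close>

lemma submoduleI:
  assumes "left_module R M" "N \<subseteq> carrier M" "\<zero>\<^bsub>M\<^esub> \<in> N"
    and "\<And>x y. x \<in> N \<Longrightarrow> y \<in> N \<Longrightarrow> x \<oplus>\<^bsub>M\<^esub> y \<in> N"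
    and "\<And>r x. r \<in> carrier R \<Longrightarrow> x \<in> N \<Longrightarrow> r \<odot>\<^bsub>M\<^esub> x \<in> N"
  shows "submodule N R M"
proof -
  interpret M: left_module R M by fact
  have "\<ominus>\<^bsub>M\<^esub> x \<in> N" if x: "x \<in> N" for x
  proof -
    have "(\<ominus>\<^bsub>R\<^esub> \<one>\<^bsub>R\<^esub>) \<odot>\<^bsub>M\<^esub> x \<oplus>\<^bsub>M\<^esub> x = (\<ominus>\<^bsub>R\<^esub> \<one>\<^bsub>R\<^esub> \<oplus>\<^bsub>R\<^esub> \<one>\<^bsub>R\<^esub>) \<odot>\<^bsub>M\<^esub> x"
      using x assms(2) by (subst M.smult_l_distr) (auto simp: M.smult_one)
    also have "\<dots> = \<zero>\<^bsub>M\<^esub>"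
      using x assms(2) by (simp add: M.R.l_neg left_module_smult_zero[OF assms(1)] subset_iff)
    finally have "\<ominus>\<^bsub>M\<^esub> x = (\<ominus>\<^bsub>R\<^esub> \<one>\<^bsub>R\<^esub>) \<odot>\<^bsub>M\<^esub> x"
      using x assms(2) by (intro M.M.minus_equality) (auto simp: M.smult_closed)
    then show ?thesis using assms(5) x by simp
  qed
  then have "subgroup N (add_monoid M)"
    using assms by (intro M.M.add.subgroupI) (auto simp: a_inv_def)
  then show ?thesis using assms(5) by (simp add: submodule_def submodule_axioms_def)
qed

lemma submodule_image:
  assumes "left_module R M" "left_module R N" "f \<in> module_homs R M N"
  shows "submodule (f ` carrier M) R N"
proof -
  interpret M: left_module R M by fact
  interpret N: left_module R N by fact
  show ?thesis
  proof (rule submoduleI[OF assms(2)])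
    show "\<zero>\<^bsub>N\<^esub> \<in> f ` carrier M"
      using module_homs_zero[OF assms(3,1,2)] by (metis M.M.zero_closed image_eqI)
  qed (auto simp: module_homsD(1)[OF assms(3)] simp flip: module_homsD(2,3)[OF assms(3)]
        intro!: imageI M.smult_closed)
qed

lemma submodule_kernel:
  assumes "left_module R M" "left_module R N" "f \<in> module_homs R M N"
  shows "submodule (a_kernel M N f) R M"
proof -
  interpret M: left_module R M by fact
  interpret N: left_module R N by fact
  show ?thesis
    by (rule submoduleI[OF assms(1)])
       (auto simp: a_kernel_def' module_homsD[OF assms(3)] module_homs_zero[OF assms(3,1,2)]
         left_module_smult_zero[OF assms(2)] M.smult_closed)
qed

section \<open>Rings as modules\<close>

lemma ring_bimodule_simps [simp]:
  "carrier (ring_bimodule A f g) = carrier A"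
  "ring.zero (ring_bimodule A f g) = \<zero>\<^bsub>A\<^esub>"
  "add (ring_bimodule A f g) = add A"
  "smult (ring_bimodule A f g) = (\<lambda>l x. f l \<otimes>\<^bsub>A\<^esub> x)"
  "rsmult (ring_bimodule A f g) = (\<lambda>x s. x \<otimes>\<^bsub>A\<^esub> g s)"
  by (simp_all add: ring_bimodule_def)

text \<open>Lets records that change only the scalar action, such as \<open>ring_bimodule\<close>
  and \<open>restrict_scalars\<close>, inherit the additive group.\<close>

lemma abelian_group_cong:
  assumes "abelian_group A" "carrier M = carrier A" "ring.zero M = ring.zero A" "add M = add A"
  shows "abelian_group M"
proof -
  interpret A: abelian_group A by fact
  show ?thesis
  proof (rule abelian_groupI)
    show "\<exists>y\<in>carrier M. y \<oplus>\<^bsub>M\<^esub> x = \<zero>\<^bsub>M\<^esub>" if "x \<in> carrier M" for x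
      using that by (intro bexI[of _ "\<ominus>\<^bsub>A\<^esub> x"]) (simp_all add: assms(2-4) A.l_neg)
  qed (simp_all add: assms(2-4) A.a_ac)
qed

lemma left_module_ring_bimodule:
  assumes "ring_hom_ring R A f"
  shows "left_module R (ring_bimodule A f g)"
proof -
  interpret h: ring_hom_ring R A f by fact
  have "abelian_group (ring_bimodule A f g)"
    by (rule abelian_group_cong[OF h.S.abelian_group_axioms]) simp_all
  moreover have "left_module_axioms R (ring_bimodule A f g)"
    by unfold_locales
       (auto simp: h.S.l_distr h.S.r_distr h.S.m_assoc)
  ultimately show ?thesis
    using h.R.ring_axioms by (simp add: left_module_def)
qed

lemma left_module_regular:
  assumes "ring R" shows "left_module R (regular_module R)"
proof -
  interpret ring R by fact
  show ?thesis
    by (rule left_module_ring_bimodule) (unfold_locales, auto simp: ring_hom_def)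
qed

lemma module_homs_smult_regular:
  assumes "left_module R M" "m \<in> carrier M"
  shows "(\<lambda>r. r \<odot>\<^bsub>M\<^esub> m) \<in> module_homs R (regular_module R) M"
proof -
  interpret M: left_module R M by fact
  show ?thesis
    by (rule module_homsI)
       (use assms in \<open>simp_all add: M.smult_closed M.smult_l_distr M.smult_assoc\<close>)
qed

lemma module_homs_regular_eq:
  assumes "left_module R M" "u \<in> module_homs R (regular_module R) M" "r \<in> carrier R"
  shows "u r = r \<odot>\<^bsub>M\<^esub> u \<one>\<^bsub>R\<^esub>"
proof -
  interpret M: left_module R M by fact
  show ?thesis using module_homsD(3)[OF assms(2,3), of "\<one>\<^bsub>R\<^esub>"] assms(3) by simp
qed

section \<open>Direct summands\<close>

text \<open>If a + b = a' + b', then a - a' = b' - b lies in both summands and vanishes. So the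
  component chosen by \<open>SOME\<close> is forced, and linearity follows by decomposing both
  sides. The last two conclusions are exported because the bimodule case derives right linearity
  from them.\<close>

lemma direct_sum_projection:
  assumes M: "left_module R M" and N: "submodule N R M" and N': "submodule N' R M"
    and int: "N \<inter> N' = {\<zero>\<^bsub>M\<^esub>}" and sum: "set_add M N N' = carrier M"
  obtains p where "p \<in> module_homs R M (M\<lparr>carrier := N\<rparr>)"
    "\<And>x. x \<in> carrier M \<Longrightarrow> \<exists>y\<in>N'. x = p x \<oplus>\<^bsub>M\<^esub> y"
    "\<And>a b. a \<in> N \<Longrightarrow> b \<in> N' \<Longrightarrow> p (a \<oplus>\<^bsub>M\<^esub> b) = a"
proof -
  interpret M: left_module R M by fact
  interpret N: submodule N R M by fact
  interpret N': submodule N' R M by fact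
  have sub: "a \<in> carrier M" if "a \<in> N \<or> a \<in> N'" for a
    using that N.subset N'.subset by auto
  have uniq: "a = a'"
    if ab: "a \<in> N" "b \<in> N'" "a' \<in> N" "b' \<in> N'" "a \<oplus>\<^bsub>M\<^esub> b = a' \<oplus>\<^bsub>M\<^esub> b'" for a b a' b'
  proof -
    note c = sub[of a] sub[of b] sub[of a'] sub[of b']
    have "a \<ominus>\<^bsub>M\<^esub> a' \<in> N" using ab N.m_closed N.m_inv_closed by (simp add: a_minus_def a_inv_def)
    moreover have "b' \<ominus>\<^bsub>M\<^esub> b \<in> N'" using ab N'.m_closed N'.m_inv_closed by (simp add: a_minus_def a_inv_def)
    moreover have "a \<ominus>\<^bsub>M\<^esub> a' = b' \<ominus>\<^bsub>M\<^esub> b"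
    proof -
      have "(a \<ominus>\<^bsub>M\<^esub> a') \<oplus>\<^bsub>M\<^esub> b = (a \<oplus>\<^bsub>M\<^esub> b) \<ominus>\<^bsub>M\<^esub> a'"
        using ab(1-4) c by (simp add: a_minus_def M.M.a_ac)
      also have "\<dots> = b' \<oplus>\<^bsub>M\<^esub> (a' \<ominus>\<^bsub>M\<^esub> a')"
        using ab(1-4) c by (simp add: ab(5) a_minus_def M.M.a_ac)
      also have "\<dots> = b'" using ab(1-4) c by (simp add: a_minus_def M.M.r_neg)
      finally show ?thesis
        using ab(1-4) c by (simp add: a_minus_def M.M.add.inv_solve_right)
    qed
    ultimately have "a \<ominus>\<^bsub>M\<^esub> a' \<in> N \<inter> N'" by simp
    then have "a \<ominus>\<^bsub>M\<^esub> a' = \<zero>\<^bsub>M\<^esub>" using int by blast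
    then show "a = a'" 
      using c ab M.M.add.inv_solve_right[of "\<zero>\<^bsub>M\<^esub>" a a'] by (simp add: a_minus_def)
  qed
  have ex: "\<exists>a\<in>N. \<exists>b\<in>N'. x = a \<oplus>\<^bsub>M\<^esub> b" if "x \<in> carrier M" for x
    using that sum[symmetric] by (auto simp: set_add_def')
  define p where "p x = (SOME a. a \<in> N \<and> (\<exists>b\<in>N'. x = a \<oplus>\<^bsub>M\<^esub> b))" for x
  have p: "p x \<in> N \<and> (\<exists>b\<in>N'. x = p x \<oplus>\<^bsub>M\<^esub> b)" if "x \<in> carrier M" for x
    unfolding p_def by (rule someI_ex) (use ex[OF that] in blast)
  have p1: "p x \<in> N" and p2: "\<exists>b\<in>N'. x = p x \<oplus>\<^bsub>M\<^esub> b" if "x \<in> carrier M" for x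
    using p[OF that] by auto
  have pu: "p (a \<oplus>\<^bsub>M\<^esub> b) = a" if ab: "a \<in> N" "b \<in> N'" for a b
  proof -
    have "a \<oplus>\<^bsub>M\<^esub> b \<in> carrier M" using ab sub by simp
    then obtain b' where "b' \<in> N'" "a \<oplus>\<^bsub>M\<^esub> b = p (a \<oplus>\<^bsub>M\<^esub> b) \<oplus>\<^bsub>M\<^esub> b'" using p by blast
    then show ?thesis using uniq[of a b "p (a \<oplus>\<^bsub>M\<^esub> b)" b'] ab p[OF \<open>a \<oplus>\<^bsub>M\<^esub> b \<in> carrier M\<close>] by simp
  qed
  have phom: "p \<in> module_homs R M (M\<lparr>carrier := N\<rparr>)"
  proof (rule module_homsI)
    fix x y assume xy: "x \<in> carrier M" "y \<in> carrier M"
    obtain x' y' where x': "x' \<in> N'" "x = p x \<oplus>\<^bsub>M\<^esub> x'" and y': "y' \<in> N'" "y = p y \<oplus>\<^bsub>M\<^esub> y'"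
      using p2 xy by meson
    have "x \<oplus>\<^bsub>M\<^esub> y = (p x \<oplus>\<^bsub>M\<^esub> x') \<oplus>\<^bsub>M\<^esub> (p y \<oplus>\<^bsub>M\<^esub> y')" using x' y' by simp
    also have "\<dots> = (p x \<oplus>\<^bsub>M\<^esub> p y) \<oplus>\<^bsub>M\<^esub> (x' \<oplus>\<^bsub>M\<^esub> y')"
      using x'(1) y'(1) p1 xy sub by (simp add: M.M.a_ac)
    finally show "p (x \<oplus>\<^bsub>M\<^esub> y) = p x \<oplus>\<^bsub>M\<lparr>carrier := N\<rparr>\<^esub> p y"
      using pu[of "p x \<oplus>\<^bsub>M\<^esub> p y" "x' \<oplus>\<^bsub>M\<^esub> y'"] x'(1) y'(1) p1 xy N.m_closed N'.m_closed by simp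
  next
    fix r x assume r: "r \<in> carrier R" and x: "x \<in> carrier M"
    obtain x' where x': "x' \<in> N'" "x = p x \<oplus>\<^bsub>M\<^esub> x'"
      using p2 x by meson
    have "r \<odot>\<^bsub>M\<^esub> x = r \<odot>\<^bsub>M\<^esub> (p x \<oplus>\<^bsub>M\<^esub> x')" using x' by simp
    also have "\<dots> = r \<odot>\<^bsub>M\<^esub> p x \<oplus>\<^bsub>M\<^esub> r \<odot>\<^bsub>M\<^esub> x'"
      using x'(1) p1 x r sub by (simp add: M.smult_r_distr)
    finally show "p (r \<odot>\<^bsub>M\<^esub> x) = r \<odot>\<^bsub>M\<lparr>carrier := N\<rparr>\<^esub> p x"
      using pu[of "r \<odot>\<^bsub>M\<^esub> p x" "r \<odot>\<^bsub>M\<^esub> x'"] x'(1) p1 x r by simp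
  qed (use p1 in simp)
  show thesis by (rule that[OF phom p2 pu])
qed

lemma module_iso_inverse:
  assumes "left_module R M" "f \<in> module_isos R M N"
  obtains g where "g \<in> module_homs R N M" "\<And>x. x \<in> carrier M \<Longrightarrow> g (f x) = x"
    "\<And>y. y \<in> carrier N \<Longrightarrow> f (g y) = y"
proof -
  interpret M: left_module R M by fact
  have f: "f \<in> module_homs R M N" and bij: "bij_betw f (carrier M) (carrier N)"
    using assms(2) by (auto simp: module_isos_def)
  let ?g = "inv_into (carrier M) f"
  have gf: "?g (f x) = x" if "x \<in> carrier M" for x
    using bij that by (simp add: bij_betw_inv_into_left)
  have fg: "f (?g y) = y" "?g y \<in> carrier M" if "y \<in> carrier N" for y
    using bij that by (auto simp: bij_betw_inv_into_right bij_betw_def inv_into_into)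
  have "?g \<in> module_homs R N M"
  proof (rule module_homsI)
    show "?g (x \<oplus>\<^bsub>N\<^esub> y) = ?g x \<oplus>\<^bsub>M\<^esub> ?g y" if "x \<in> carrier N" "y \<in> carrier N" for x y
      using gf[of "?g x \<oplus>\<^bsub>M\<^esub> ?g y"] fg that module_homsD(2)[OF f, of "?g x" "?g y"] by simp
    show "?g (r \<odot>\<^bsub>N\<^esub> x) = r \<odot>\<^bsub>M\<^esub> ?g x" if "r \<in> carrier R" "x \<in> carrier N" for r x
      using gf[of "r \<odot>\<^bsub>M\<^esub> ?g x"] fg that module_homsD(3)[OF f, of r "?g x"]
      by (simp add: M.smult_closed)
  qed (use fg in auto)
  then show thesis using that gf fg by blast
qed

lemma module_homs_restrict_codomain:
  "f \<in> module_homs R M (N\<lparr>carrier := S\<rparr>) \<Longrightarrow> S \<subseteq> carrier N \<Longrightarrow> f \<in> module_homs R M N"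
  unfolding module_homs_def hom_def by auto

text \<open>Replaces submodules and complements by maps. In the backward direction the complement of
  the image of \<open>s\<close> is the kernel of \<open>p\<close>, by the decomposition x = s (p x)
  + (x - s (p x)).\<close>

lemma iso_direct_summand_iff_retract:
  assumes Q: "left_module R Q" and M: "left_module R M"
  shows "iso_direct_summand R Q M \<longleftrightarrow>
    (\<exists>s\<in>module_homs R Q M. \<exists>p\<in>module_homs R M Q. \<forall>x\<in>carrier Q. p (s x) = x)"
proof
  interpret Q: left_module R Q by fact
  interpret M: left_module R M by fact
  assume "iso_direct_summand R Q M"
  then obtain N N' f where N: "submodule N R M" and N': "submodule N' R M"
    and int: "N \<inter> N' = {\<zero>\<^bsub>M\<^esub>}" and sum: "set_add M N N' = carrier M"
    and f: "f \<in> module_isos R Q (M\<lparr>carrier := N\<rparr>)"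
    by (auto simp: iso_direct_summand_def direct_summand_def)
  interpret N: submodule N R M by fact
  interpret N': submodule N' R M by fact
  have sub: "a \<in> carrier M" if "a \<in> N \<or> a \<in> N'" for a
    using that N.subset N'.subset by auto
  obtain p where phom: "p \<in> module_homs R M (M\<lparr>carrier := N\<rparr>)" and p: "\<And>x. x \<in> carrier M \<Longrightarrow> \<exists>y\<in>N'. x = p x \<oplus>\<^bsub>M\<^esub> y"
    "\<And>a b. a \<in> N \<Longrightarrow> b \<in> N' \<Longrightarrow> p (a \<oplus>\<^bsub>M\<^esub> b) = a"
    by (rule direct_sum_projection[OF M N N' int sum], rule that)
  have pN: "p a = a" if "a \<in> N" for a
    using p(2)[OF that, of "\<zero>\<^bsub>M\<^esub>"] that sub[of a] N'.one_closed by simp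
  obtain g where g: "g \<in> module_homs R (M\<lparr>carrier := N\<rparr>) Q" "\<And>x. x \<in> carrier Q \<Longrightarrow> g (f x) = x"
    by (rule module_iso_inverse[OF Q f], rule that)
  have f': "f \<in> module_homs R Q (M\<lparr>carrier := N\<rparr>)" using f by (simp add: module_isos_def)
  have fN: "f x \<in> N" if "x \<in> carrier Q" for x using module_homsD(1)[OF f' that] by simp
  have s: "f \<in> module_homs R Q M"
    by (rule module_homs_restrict_codomain[OF f']) (use sub in auto)
  show "\<exists>s\<in>module_homs R Q M. \<exists>p\<in>module_homs R M Q. \<forall>x\<in>carrier Q. p (s x) = x"
    by (rule bexI[OF _ s], rule bexI[OF _ module_homs_comp[OF phom g(1)]])
       (simp add: pN fN g(2))
next
  interpret Q: left_module R Q by fact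
  interpret M: left_module R M by fact
  assume "\<exists>s\<in>module_homs R Q M. \<exists>p\<in>module_homs R M Q. \<forall>x\<in>carrier Q. p (s x) = x"
  then obtain s p where s: "s \<in> module_homs R Q M" and p: "p \<in> module_homs R M Q"
    and ps: "\<And>x. x \<in> carrier Q \<Longrightarrow> p (s x) = x" by blast
  note sD = module_homsD[OF s] and pD = module_homsD[OF p]
  let ?N = "s ` carrier Q" and ?N' = "a_kernel M Q p"
  have "set_add M ?N ?N' = carrier M"
  proof
    show "set_add M ?N ?N' \<subseteq> carrier M" by (auto simp: set_add_def' a_kernel_def' sD)
    show "carrier M \<subseteq> set_add M ?N ?N'"
    proof
      fix x assume x: "x \<in> carrier M"
      have "x \<ominus>\<^bsub>M\<^esub> s (p x) \<in> ?N'"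
        using x module_homs_minus[OF p M Q, of x "s (p x)"]
        by (simp add: a_kernel_def' sD pD ps) (simp add: a_minus_def Q.M.r_neg pD)
      moreover have "x = s (p x) \<oplus>\<^bsub>M\<^esub> (x \<ominus>\<^bsub>M\<^esub> s (p x))"
        using x by (simp add: a_minus_def sD pD M.M.a_lcomm[of "s (p x)"] M.M.r_neg)
      ultimately show "x \<in> set_add M ?N ?N'"
        using x pD(1) by (auto simp: set_add_def')
    qed
  qed
  moreover have "?N \<inter> ?N' = {\<zero>\<^bsub>M\<^esub>}"
    using module_homs_zero[OF s Q M] module_homs_zero[OF p M Q]
    by (auto simp: a_kernel_def' ps sD intro: rev_image_eqI[of "\<zero>\<^bsub>Q\<^esub>"])
  ultimately have "direct_summand R ?N M"
    unfolding direct_summand_def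
    using submodule_image[OF Q M s] submodule_kernel[OF M Q p] by blast
  moreover have "s \<in> module_isos R Q (M\<lparr>carrier := ?N\<rparr>)"
    unfolding module_isos_def
  proof (intro CollectI conjI)
    show "s \<in> module_homs R Q (M\<lparr>carrier := ?N\<rparr>)"
      by (rule module_homsI) (simp_all add: sD)
    show "bij_betw s (carrier Q) (carrier (M\<lparr>carrier := ?N\<rparr>))"
      by (simp add: bij_betw_def inj_on_inverseI[where g=p] ps)
  qed
  ultimately show "iso_direct_summand R Q M" unfolding iso_direct_summand_def by blast
qed

section \<open>Direct sums of copies\<close>

lemma copies_simps [simp]:
  "carrier (copies I M) = {f \<in> I \<rightarrow>\<^sub>E carrier M. finite {i \<in> I. f i \<noteq> \<zero>\<^bsub>M\<^esub>}}"
  "ring.zero (copies I M) = (\<lambda>i\<in>I. \<zero>\<^bsub>M\<^esub>)"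
  "add (copies I M) = (\<lambda>f g. \<lambda>i\<in>I. f i \<oplus>\<^bsub>M\<^esub> g i)"
  "smult (copies I M) = (\<lambda>r f. \<lambda>i\<in>I. r \<odot>\<^bsub>M\<^esub> f i)"
  by (simp_all add: copies_def)

lemma restrict_eqI:
  "f \<in> extensional I \<Longrightarrow> (\<And>i. i \<in> I \<Longrightarrow> g i = f i) \<Longrightarrow> (\<lambda>i\<in>I. g i) = f"
  by (auto simp: fun_eq_iff restrict_def extensional_def)

lemma left_module_copies:
  assumes "left_module R M" shows "left_module R (copies I M)"
proof -
  interpret M: left_module R M by fact
  note ext = restrict_eqI
  have fin_add: "finite {i \<in> I. f i \<oplus>\<^bsub>M\<^esub> g i \<noteq> \<zero>\<^bsub>M\<^esub>}"
    if "finite {i \<in> I. f i \<noteq> \<zero>\<^bsub>M\<^esub>}" "finite {i \<in> I. g i \<noteq> \<zero>\<^bsub>M\<^esub>}" for f g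
    by (rule finite_subset[OF _ finite_UnI[OF that]]) auto
  have fin_smult: "finite {i \<in> I. r \<odot>\<^bsub>M\<^esub> f i \<noteq> \<zero>\<^bsub>M\<^esub>}"
    if "finite {i \<in> I. f i \<noteq> \<zero>\<^bsub>M\<^esub>}" "r \<in> carrier R" for f r
    by (rule finite_subset[OF _ that(1)]) (auto simp: left_module_smult_zero[OF assms] that)
  have fin_inv: "finite {i \<in> I. \<ominus>\<^bsub>M\<^esub> f i \<noteq> \<zero>\<^bsub>M\<^esub>}"
    if "finite {i \<in> I. f i \<noteq> \<zero>\<^bsub>M\<^esub>}" for f
    by (rule finite_subset[OF _ that(1)]) auto
  have "abelian_group (copies I M)"
  proof (rule abelian_groupI)
    fix x y z assume "x \<in> carrier (copies I M)" "y \<in> carrier (copies I M)" "z \<in> carrier (copies I M)"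
    then show "x \<oplus>\<^bsub>copies I M\<^esub> y \<oplus>\<^bsub>copies I M\<^esub> z = x \<oplus>\<^bsub>copies I M\<^esub> (y \<oplus>\<^bsub>copies I M\<^esub> z)"
      by (auto intro!: restrict_ext M.M.a_assoc)
  next
    fix x assume x: "x \<in> carrier (copies I M)"
    show "\<exists>y\<in>carrier (copies I M). y \<oplus>\<^bsub>copies I M\<^esub> x = \<zero>\<^bsub>copies I M\<^esub>"
      using x fin_inv
      by (intro bexI[of _ "\<lambda>i\<in>I. \<ominus>\<^bsub>M\<^esub> x i"])
         (auto simp: PiE_mem cong: conj_cong intro!: restrict_ext M.M.l_neg)
  qed (auto simp: PiE_iff fin_add cong: conj_cong intro!: restrict_ext M.M.a_comm M.M.l_zero ext)
  moreover have "left_module_axioms R (copies I M)"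
    by unfold_locales
       (auto simp: PiE_iff fin_smult M.smult_closed M.smult_l_distr M.smult_r_distr M.smult_assoc M.smult_one cong: conj_cong
         intro!: restrict_ext ext)
  ultimately show ?thesis using M.R.ring_axioms by (simp add: left_module_def)
qed

lemma copies_component_homs:
  "i \<in> I \<Longrightarrow> (\<lambda>f. f i) \<in> module_homs R (copies I M) M"
  by (rule module_homsI) auto

lemma copies_inclusion_homs:
  assumes "left_module R M" "i \<in> I"
  shows "(\<lambda>x. \<lambda>j\<in>I. if j = i then x else \<zero>\<^bsub>M\<^esub>) \<in> module_homs R M (copies I M)"
proof -
  interpret M: left_module R M by fact
  show ?thesis
    by (rule module_homsI)
       (auto simp: left_module_smult_zero[OF assms(1)] intro!: restrict_ext intro: finite_subset[of _ "{i}"])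
qed

text \<open>The sum runs over any finite set containing the support rather than over the support
  itself, so that different elements can be expanded over one common index set.\<close>

lemma copies_eq_finsum:
  assumes M: "left_module R M" and f: "f \<in> carrier (copies I M)"
    and S: "finite S" "S \<subseteq> I" "\<And>i. i \<in> I \<Longrightarrow> i \<notin> S \<Longrightarrow> f i = \<zero>\<^bsub>M\<^esub>"
  shows "finsum (copies I M) (\<lambda>i. \<lambda>j\<in>I. if j = i then f i else \<zero>\<^bsub>M\<^esub>) S = f"
proof -
  interpret M: left_module R M by fact
  interpret C: left_module R "copies I M" by (rule left_module_copies[OF M])
  let ?h = "\<lambda>i. \<lambda>j\<in>I. if j = i then f i else \<zero>\<^bsub>M\<^esub>"
  have h: "?h i \<in> carrier (copies I M)" if "i \<in> S" for i
    using module_homsD(1)[OF copies_inclusion_homs[OF M, of i I], of "f i"] that S f by auto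
  then have cl: "finsum (copies I M) ?h S \<in> carrier (copies I M)"
    by (intro C.M.finsum_closed) blast
  have "finsum (copies I M) ?h S j = f j" if j: "j \<in> I" for j
  proof -
    have "finsum (copies I M) ?h S j = finsum M (\<lambda>i. ?h i j) S"
      by (rule module_homs_finsum[OF copies_component_homs[OF j] C.left_module_axioms M h])
    also have "\<dots> = finsum M (\<lambda>i. if j = i then f i else \<zero>\<^bsub>M\<^esub>) S"
      using j f S by (intro M.M.finsum_cong') (auto simp: PiE_mem)
    also have "\<dots> = f j"
    proof (cases "j \<in> S")
      case True
      then show ?thesis using S f by (intro M.M.finsum_singleton) (auto simp: PiE_mem)
    next
      case False
      have "finsum M (\<lambda>i. if j = i then f i else \<zero>\<^bsub>M\<^esub>) S = finsum M (\<lambda>i. \<zero>\<^bsub>M\<^esub>) S"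
        by (rule M.M.finsum_cong') (use False in auto)
      then show ?thesis using S(3)[OF j False] by simp
    qed
    finally show ?thesis .
  qed
  then show ?thesis using cl f by (auto simp: PiE_def intro!: extensionalityI[of _ I])
qed

section \<open>Modules in add\<close>

text \<open>A dual basis of \<open>Q\<close> relative to \<open>T\<close>: the identity of
  \<open>Q\<close> written as a finite sum of maps that factor through \<open>T\<close>. Any
  additive functor preserves such an identity, which is why it is preferred to a summand of a power
  of \<open>T\<close>.\<close>

definition add_decomposition ::
    "('r, 'a) ring_scheme \<Rightarrow> ('r, 't, 'b) module_scheme \<Rightarrow> ('r, 'q, 'c) module_scheme
      \<Rightarrow> 'i set \<Rightarrow> ('i \<Rightarrow> 't \<Rightarrow> 'q) \<Rightarrow> ('i \<Rightarrow> 'q \<Rightarrow> 't) \<Rightarrow> bool" where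
  "add_decomposition R T Q I u g \<longleftrightarrow> finite I \<and>
    (\<forall>i\<in>I. u i \<in> module_homs R T Q \<and> g i \<in> module_homs R Q T) \<and>
    (\<forall>x\<in>carrier Q. finsum Q (\<lambda>i. u i (g i x)) I = x)"

lemma add_decompositionD:
  assumes "add_decomposition R T Q I u g"
  shows "finite I" "\<And>i. i \<in> I \<Longrightarrow> u i \<in> module_homs R T Q" "\<And>i. i \<in> I \<Longrightarrow> g i \<in> module_homs R Q T"
    "\<And>x. x \<in> carrier Q \<Longrightarrow> finsum Q (\<lambda>i. u i (g i x)) I = x"
  using assms by (auto simp: add_decomposition_def)

text \<open>The index set may be infinite, so the identity of \<open>Q\<close> is a sum only
  elementwise, over finite sets containing the support of the coordinates. The maps are the
  retraction on the coordinate axes and the coordinates of the section.\<close>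

lemma direct_summand_copies_decomposition:
  fixes M :: "('r, 'm, 'z) module_scheme" and B :: "'i set"
  assumes Q: "left_module R Q" and M: "left_module R M"
    and sum: "iso_direct_summand R Q (copies B M)"
  obtains u g where "\<And>b. b \<in> B \<Longrightarrow> u b \<in> module_homs R M Q"
    "\<And>b. b \<in> B \<Longrightarrow> g b \<in> module_homs R Q M"
    "\<And>x. x \<in> carrier Q \<Longrightarrow> finite {b \<in> B. g b x \<noteq> \<zero>\<^bsub>M\<^esub>}"
    "\<And>x S. x \<in> carrier Q \<Longrightarrow> finite S \<Longrightarrow> S \<subseteq> B \<Longrightarrow> {b \<in> B. g b x \<noteq> \<zero>\<^bsub>M\<^esub>} \<subseteq> S \<Longrightarrow>
      finsum Q (\<lambda>b. u b (g b x)) S = x"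
proof -
  interpret Q: left_module R Q by fact
  interpret M: left_module R M by fact
  interpret C: left_module R "copies B M" by (rule left_module_copies[OF M])
  obtain s p where s: "s \<in> module_homs R Q (copies B M)" and p: "p \<in> module_homs R (copies B M) Q"
    and ps: "\<And>x. x \<in> carrier Q \<Longrightarrow> p (s x) = x"
    using sum[unfolded iso_direct_summand_iff_retract[OF Q left_module_copies[OF M]]] by blast
  note inc = copies_inclusion_homs[OF M]
  let ?i = "\<lambda>b x. \<lambda>j\<in>B. if j = b then x else \<zero>\<^bsub>M\<^esub>"
  show thesis
  proof (rule that[of "\<lambda>b x. p (?i b x)" "\<lambda>b x. s x b"])
    fix x S assume x: "x \<in> carrier Q" and S: "finite S" "S \<subseteq> B" and supp: "{b \<in> B. s x b \<noteq> \<zero>\<^bsub>M\<^esub>} \<subseteq> S"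
    have sx: "s x \<in> carrier (copies B M)" by (rule module_homsD(1)[OF s x])
    have h: "?i b (s x b) \<in> carrier (copies B M)" if "b \<in> S" for b
      by (rule module_homsD(1)[OF inc]) (use that S sx in \<open>auto simp: PiE_mem\<close>)
    have "finsum Q (\<lambda>b. p (?i b (s x b))) S = p (finsum (copies B M) (\<lambda>b. ?i b (s x b)) S)"
      by (rule module_homs_finsum[OF p C.left_module_axioms Q h, symmetric])
    also have "finsum (copies B M) (\<lambda>b. ?i b (s x b)) S = s x"
      by (rule copies_eq_finsum[OF M sx S]) (use supp in auto)
    also have "p (s x) = x" by (rule ps[OF x])
    finally show "finsum Q (\<lambda>b. p (?i b (s x b))) S = x" .
  next
    fix x assume "x \<in> carrier Q"
    then show "finite {b \<in> B. s x b \<noteq> \<zero>\<^bsub>M\<^esub>}" using module_homsD(1)[OF s] by simp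
  next
    fix b assume b: "b \<in> B"
    show "(\<lambda>x. p (?i b x)) \<in> module_homs R M Q" by (rule module_homs_comp[OF inc[OF b] p])
    show "(\<lambda>x. s x b) \<in> module_homs R Q M" by (rule module_homs_comp[OF s copies_component_homs[OF b]])
  qed
qed

lemma add_decomposition_imp_direct_summand:
  assumes Q: "left_module R Q" and M: "left_module R M"
    and dec: "add_decomposition R M Q I u g"
  shows "iso_direct_summand R Q (copies I M)"
proof -
  interpret Q: left_module R Q by fact
  interpret M: left_module R M by fact
  note d = add_decompositionD[OF dec]
  note uD = module_homsD[OF d(2)] and gD = module_homsD[OF d(3)]
  have s: "(\<lambda>x. \<lambda>i\<in>I. g i x) \<in> module_homs R Q (copies I M)"
    by (rule module_homsI) (use d(1) in \<open>auto simp: gD intro!: restrict_ext\<close>)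
  have p: "(\<lambda>f. finsum Q (\<lambda>i. u i (f i)) I) \<in> module_homs R (copies I M) Q"
    by (rule module_homs_sum[OF left_module_copies[OF M] Q])
       (rule module_homs_comp[OF copies_component_homs d(2)])
  have "finsum Q (\<lambda>i. u i ((\<lambda>i\<in>I. g i x) i)) I = x" if x: "x \<in> carrier Q" for x
  proof -
    have "finsum Q (\<lambda>i. u i ((\<lambda>i\<in>I. g i x) i)) I = finsum Q (\<lambda>i. u i (g i x)) I"
      by (rule Q.M.finsum_cong') (use x in \<open>auto simp: uD gD\<close>)
    then show ?thesis using d(4)[OF x] by simp
  qed
  then show ?thesis
    unfolding iso_direct_summand_iff_retract[OF Q left_module_copies[OF M]]
    by (intro bexI[OF _ s] bexI[OF _ p] ballI)
qed

lemma in_add_iff_decomposition: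
  assumes M: "left_module R M"
  shows "in_add R M Q \<longleftrightarrow> left_module R Q \<and> (\<exists>n u g. add_decomposition R M Q {..<n::nat} u g)"
proof (intro iffI conjI)
  assume "in_add R M Q"
  then obtain n :: nat where Q: "left_module R Q" and s: "iso_direct_summand R Q (copies {..<n} M)"
    by (auto simp: in_add_def)
  show "left_module R Q" by fact
  obtain u g where "\<And>b. b \<in> {..<n} \<Longrightarrow> u b \<in> module_homs R M Q"
    "\<And>b. b \<in> {..<n} \<Longrightarrow> g b \<in> module_homs R Q M"
    "\<And>x. x \<in> carrier Q \<Longrightarrow> finite {b \<in> {..<n}. g b x \<noteq> \<zero>\<^bsub>M\<^esub>}"
    "\<And>x S. x \<in> carrier Q \<Longrightarrow> finite S \<Longrightarrow> S \<subseteq> {..<n} \<Longrightarrow> {b \<in> {..<n}. g b x \<noteq> \<zero>\<^bsub>M\<^esub>} \<subseteq> S \<Longrightarrow>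
      finsum Q (\<lambda>b. u b (g b x)) S = x"
    by (rule direct_summand_copies_decomposition[OF Q M s], rule that)
  then have "add_decomposition R M Q {..<n} u g"
    by (auto simp: add_decomposition_def)
  then show "\<exists>n u g. add_decomposition R M Q {..<n::nat} u g" by blast
next
  assume "left_module R Q \<and> (\<exists>n u g. add_decomposition R M Q {..<n::nat} u g)"
  then show "in_add R M Q"
    unfolding in_add_def using add_decomposition_imp_direct_summand[OF _ M] by blast
qed

lemma add_decomposition_reindex:
  assumes Q: "left_module R Q" and M: "left_module R M"
    and dec: "add_decomposition R M Q I u g" and b: "bij_betw b J I"
  shows "add_decomposition R M Q J (\<lambda>j. u (b j)) (\<lambda>j. g (b j))"
proof -
  interpret Q: left_module R Q by fact
  note d = add_decompositionD[OF dec]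
  have I: "I = b ` J" "inj_on b J" using b by (auto simp: bij_betw_def)
  have "finsum Q (\<lambda>j. u (b j) (g (b j) x)) J = x" if "x \<in> carrier Q" for x
    using Q.M.finsum_reindex[of "\<lambda>i. u i (g i x)" b J] that d(4)[OF that] I
      module_homsD(1)[OF d(2)] module_homsD(1)[OF d(3)] by (auto simp: Pi_def)
  then show ?thesis
    using d I bij_betw_finite[OF b] by (auto simp: add_decomposition_def)
qed

text \<open>Arbitrary finite index sets are accepted, so that product and disjoint sum index sets
  need no renumbering.\<close>

lemma in_addI:
  assumes Q: "left_module R Q" and M: "left_module R M"
    and dec: "add_decomposition R M Q I u g"
  shows "in_add R M Q"
proof -
  obtain b where "bij_betw b {..<card I} I"
    using ex_bij_betw_nat_finite[OF add_decompositionD(1)[OF dec]] by (auto simp: lessThan_atLeast0)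
  from add_decomposition_reindex[OF Q M dec this] show ?thesis
    using in_add_iff_decomposition[OF M] Q by blast
qed

lemma in_addE:
  assumes "in_add R M Q" "left_module R M"
  obtains n u g where "left_module R Q" "add_decomposition R M Q {..<n::nat} u g"
  using assms in_add_iff_decomposition[OF assms(2)] by blast

section \<open>Isomorphic copies, and transitivity of add\<close>

definition inverse_homs ::
    "('r, 'a) ring_scheme \<Rightarrow> ('r, 'm, 'b) module_scheme \<Rightarrow> ('r, 'n, 'c) module_scheme
      \<Rightarrow> ('m \<Rightarrow> 'n) \<Rightarrow> ('n \<Rightarrow> 'm) \<Rightarrow> bool" where
  "inverse_homs R M N f g \<longleftrightarrow> f \<in> module_homs R M N \<and> g \<in> module_homs R N M \<and>
    (\<forall>x\<in>carrier M. g (f x) = x) \<and> (\<forall>y\<in>carrier N. f (g y) = y)"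

lemma inverse_homsD:
  assumes "inverse_homs R M N f g"
  shows "f \<in> module_homs R M N" "g \<in> module_homs R N M"
    "\<And>x. x \<in> carrier M \<Longrightarrow> g (f x) = x" "\<And>y. y \<in> carrier N \<Longrightarrow> f (g y) = y"
  using assms by (auto simp: inverse_homs_def)

text \<open>The indices of a finite decomposition can be placed inside any infinite type
  \<open>'i\<close>, and then \<open>Q\<close> is isomorphic to a submodule of copies of
  \<open>T\<close> indexed there. This supplies the element types
  \<open>nat \<Rightarrow> 't\<close> demanded by tilting and the functions on lists demanded by
  \<open>chosen_resolution\<close>.\<close>

lemma in_add_transport:
  fixes T :: "('r, 't, 'z) module_scheme"
  assumes T: "left_module R T" and Q: "in_add R T Q" and inf: "infinite (UNIV :: 'i set)"
  obtains Q' :: "('r, 'i \<Rightarrow> 't) module" and f g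
  where "left_module R Q'" "inverse_homs R Q Q' f g"
proof -
  obtain n :: nat and u h where Qm: "left_module R Q" and dec: "add_decomposition R T Q {..<n} u h"
    by (rule in_addE[OF Q T])
  obtain e :: "nat \<Rightarrow> 'i" where e: "inj e"
    using infinite_countable_subset[OF inf] by blast
  then have b: "bij_betw (inv_into {..<n} e) (e ` {..<n}) {..<n}"
    by (intro bij_betw_inv_into inj_on_imp_bij_betw) (auto simp: inj_on_def)
  have "iso_direct_summand R Q (copies (e ` {..<n}) T)"
    by (rule add_decomposition_imp_direct_summand[OF Qm T add_decomposition_reindex[OF Qm T dec b]])
  then obtain N f where N: "submodule N R (copies (e ` {..<n}) T)"
    and f: "f \<in> module_isos R Q ((copies (e ` {..<n}) T)\<lparr>carrier := N\<rparr>)"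
    by (auto simp: iso_direct_summand_def direct_summand_def)
  obtain g where "g \<in> module_homs R ((copies (e ` {..<n}) T)\<lparr>carrier := N\<rparr>) Q"
    "\<And>x. x \<in> carrier Q \<Longrightarrow> g (f x) = x"
    "\<And>y. y \<in> carrier ((copies (e ` {..<n}) T)\<lparr>carrier := N\<rparr>) \<Longrightarrow> f (g y) = y"
    by (rule module_iso_inverse[OF Qm f], rule that)
  with f show thesis
    by (intro that[OF left_module_submodule[OF left_module_copies[OF T] N], of f g])
       (auto simp: inverse_homs_def module_isos_def)
qed

lemma add_decomposition_iso:
  assumes T: "left_module R T" and Q: "left_module R Q" and Q': "left_module R Q'"
    and dec: "add_decomposition R T Q I u g" and fh: "inverse_homs R Q Q' f h"
  shows "add_decomposition R T Q' I (\<lambda>i x. f (u i x)) (\<lambda>i y. g i (h y))"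
proof -
  note d = add_decompositionD[OF dec] and i = inverse_homsD[OF fh]
  have "finsum Q' (\<lambda>i. f (u i (g i (h y)))) I = y" if y: "y \<in> carrier Q'" for y
    using module_homs_finsum[OF i(1) Q Q', of I "\<lambda>i. u i (g i (h y))"]
      d(4)[OF module_homsD(1)[OF i(2) y]] i(4)[OF y]
      module_homsD(1)[OF d(2)] module_homsD(1)[OF d(3)] module_homsD(1)[OF i(2) y] by simp
  then show ?thesis
    using d i by (auto simp: add_decomposition_def intro: module_homs_comp)
qed

lemma in_add_iso:
  assumes T: "left_module R T" and Q: "in_add R T Q" and Q': "left_module R Q'"
    and fh: "inverse_homs R Q Q' f h"
  shows "in_add R T Q'"
proof -
  obtain n :: nat and u g where "left_module R Q" "add_decomposition R T Q {..<n} u g"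
    by (rule in_addE[OF Q T])
  from in_addI[OF Q' T add_decomposition_iso[OF T this(1) Q' this(2) fh]] show ?thesis .
qed

text \<open>Substitutes the decomposition of the identity of \<open>U\<close> into the middle of
  each summand of the identity of \<open>Q\<close>.\<close>

lemma add_decomposition_trans:
  assumes T: "left_module R T" and U: "left_module R U" and Q: "left_module R Q"
    and dec: "add_decomposition R T U I u g" and dec': "add_decomposition R U Q J u' g'"
  shows "add_decomposition R T Q (J \<times> I) (\<lambda>(j,i) x. u' j (u i x)) (\<lambda>(j,i) y. g i (g' j y))"
proof -
  interpret Q: left_module R Q by fact
  interpret U: left_module R U by fact
  note d = add_decompositionD[OF dec] and d' = add_decompositionD[OF dec']
  note D = module_homsD(1)[OF d(2)] module_homsD(1)[OF d(3)]
    module_homsD(1)[OF d'(2)] module_homsD(1)[OF d'(3)]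
  have "finsum Q (\<lambda>(j,i). u' j (u i (g i (g' j y)))) (J \<times> I) = y" if y: "y \<in> carrier Q" for y
  proof -
    let ?F = "\<lambda>(j,i). u' j (u i (g i (g' j y)))"
    have "finsum Q ?F (\<Union>j\<in>J. {j} \<times> I) = finsum Q (\<lambda>j. finsum Q ?F ({j} \<times> I)) J"
      by (rule Q.M.add.finprod_UN_disjoint)
         (use d(1) d'(1) y in \<open>auto simp: pairwise_def disjnt_def D\<close>)
    also have "\<dots> = finsum Q (\<lambda>j. u' j (g' j y)) J"
    proof (rule Q.M.finsum_cong')
      fix j assume j: "j \<in> J"
      have "finsum Q ?F ({j} \<times> I) = finsum Q ?F (Pair j ` I)" by (rule arg_cong) auto
      also have "\<dots> = finsum Q (\<lambda>i. u' j (u i (g i (g' j y)))) I"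
        by (subst Q.M.finsum_reindex) (use j y in \<open>auto simp: D inj_on_def\<close>)
      also have "\<dots> = u' j (finsum U (\<lambda>i. u i (g i (g' j y))) I)"
        by (rule module_homs_finsum[OF d'(2)[OF j] U Q, symmetric]) (use j y in \<open>auto simp: D\<close>)
      also have "\<dots> = u' j (g' j y)" using d(4) j y by (simp add: D)
      finally show "finsum Q ?F ({j} \<times> I) = u' j (g' j y)" .
    qed (use y in \<open>auto simp: D\<close>)
    also have "\<dots> = y" using d'(4) y by simp
    also have "(\<Union>j\<in>J. {j} \<times> I) = J \<times> I" by auto
    finally show ?thesis .
  qed
  then show ?thesis
    using d(1) d'(1) module_homs_comp[OF d(2) d'(2)] module_homs_comp[OF d'(3) d(3)]
    by (auto simp: add_decomposition_def case_prod_unfold)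
qed

lemma in_add_trans:
  assumes T: "left_module R T" and U: "in_add R T U" and Q: "in_add R U Q"
  shows "in_add R T Q"
proof -
  obtain n :: nat and u g where 1: "left_module R U" "add_decomposition R T U {..<n} u g"
    by (rule in_addE[OF U T])
  obtain m :: nat and u' g' where 2: "left_module R Q" "add_decomposition R U Q {..<m} u' g'"
    by (rule in_addE[OF Q 1(1)])
  from in_addI[OF 2(1) T add_decomposition_trans[OF T 1(1) 2(1) 1(2) 2(2)]] show ?thesis .
qed

lemma in_add_left_module: "in_add R T Q \<Longrightarrow> left_module R Q"
  by (simp add: in_add_def)

section \<open>Projective modules\<close>

text \<open>The dual basis lemma. A homomorphism from the regular module is determined by its value
  at 1, so the maps into \<open>M\<close> given by the summand become the elements
  \<open>u b\<close>.\<close>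

lemma projective_module_basis:
  fixes M :: "('r, 'm, 'z) module_scheme"
  assumes "projective_module R M"
  obtains B :: "'m set" and u g where "\<And>b. b \<in> B \<Longrightarrow> u b \<in> carrier M"
    "\<And>b. b \<in> B \<Longrightarrow> g b \<in> module_homs R M (regular_module R)"
    "\<And>x. x \<in> carrier M \<Longrightarrow> finite {b \<in> B. g b x \<noteq> \<zero>\<^bsub>R\<^esub>}"
    "\<And>x S. x \<in> carrier M \<Longrightarrow> finite S \<Longrightarrow> S \<subseteq> B \<Longrightarrow> {b \<in> B. g b x \<noteq> \<zero>\<^bsub>R\<^esub>} \<subseteq> S \<Longrightarrow>
      finsum M (\<lambda>b. g b x \<odot>\<^bsub>M\<^esub> u b) S = x"
proof -
  obtain B :: "'m set" where M: "left_module R M"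
    and s: "iso_direct_summand R M (copies B (regular_module R))"
    using assms by (auto simp: projective_module_def)
  interpret M: left_module R M by fact
  have R: "left_module R (regular_module R)" by (rule left_module_regular[OF M.R.ring_axioms])
  obtain u g where u: "\<And>b. b \<in> B \<Longrightarrow> u b \<in> module_homs R (regular_module R) M"
    and g: "\<And>b. b \<in> B \<Longrightarrow> g b \<in> module_homs R M (regular_module R)"
    and fin: "\<And>x. x \<in> carrier M \<Longrightarrow> finite {b \<in> B. g b x \<noteq> \<zero>\<^bsub>regular_module R\<^esub>}"
    and sum: "\<And>x S. x \<in> carrier M \<Longrightarrow> finite S \<Longrightarrow> S \<subseteq> B \<Longrightarrow>
      {b \<in> B. g b x \<noteq> \<zero>\<^bsub>regular_module R\<^esub>} \<subseteq> S \<Longrightarrow> finsum M (\<lambda>b. u b (g b x)) S = x"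
    by (rule direct_summand_copies_decomposition[OF M R s], rule that)
  have gc: "g b x \<in> carrier R" if "b \<in> B" "x \<in> carrier M" for b x
    using module_homsD(1)[OF g] that by simp
  have uc: "u b \<one>\<^bsub>R\<^esub> \<in> carrier M" if "b \<in> B" for b
    using module_homsD(1)[OF u[OF that]] by simp
  show thesis
  proof (rule that[of B "\<lambda>b. u b \<one>\<^bsub>R\<^esub>" g])
    fix x S assume x: "x \<in> carrier M" and S: "finite S" "S \<subseteq> B" "{b \<in> B. g b x \<noteq> \<zero>\<^bsub>R\<^esub>} \<subseteq> S"
    have "finsum M (\<lambda>b. g b x \<odot>\<^bsub>M\<^esub> u b \<one>\<^bsub>R\<^esub>) S = finsum M (\<lambda>b. u b (g b x)) S"
    proof (rule M.M.finsum_cong')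
      show "(\<lambda>b. u b (g b x)) \<in> S \<rightarrow> carrier M"
        using module_homsD(1)[OF u] gc S x by auto
      show "g b x \<odot>\<^bsub>M\<^esub> u b \<one>\<^bsub>R\<^esub> = u b (g b x)" if "b \<in> S" for b
        using module_homs_regular_eq[OF M u gc, of b b x] that S x by auto
    qed simp
    then show "finsum M (\<lambda>b. g b x \<odot>\<^bsub>M\<^esub> u b \<one>\<^bsub>R\<^esub>) S = x"
      using sum[OF x S(1,2)] S(3) by simp
  qed (use uc g fin in auto)
qed

text \<open>The lift is prescribed on the dual basis: h x = sum of g b x times y b, with y b a
  preimage of f (u b). The condition on images, in place of surjectivity of \<open>q\<close>, allows
  lifting into kernels without making them modules of their own.\<close>

lemma projective_lift:
  fixes M :: "('r, 'm, 'z) module_scheme"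
  assumes proj: "projective_module R M" and Z: "left_module R Z" and N: "left_module R N"
    and q: "q \<in> module_homs R Z N" and f: "f \<in> module_homs R M N"
    and im: "\<And>x. x \<in> carrier M \<Longrightarrow> f x \<in> q ` carrier Z"
  obtains h where "h \<in> module_homs R M Z" "\<And>x. x \<in> carrier M \<Longrightarrow> q (h x) = f x"
proof -
  have M: "left_module R M" using proj by (simp add: projective_module_def)
  interpret M: left_module R M by fact
  interpret Z: left_module R Z by fact
  interpret N: left_module R N by fact
  obtain B :: "'m set" and u g where u: "\<And>b. b \<in> B \<Longrightarrow> u b \<in> carrier M"
    and g: "\<And>b. b \<in> B \<Longrightarrow> g b \<in> module_homs R M (regular_module R)"
    and fin: "\<And>x. x \<in> carrier M \<Longrightarrow> finite {b \<in> B. g b x \<noteq> \<zero>\<^bsub>R\<^esub>}"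
    and sum: "\<And>x S. x \<in> carrier M \<Longrightarrow> finite S \<Longrightarrow> S \<subseteq> B \<Longrightarrow> {b \<in> B. g b x \<noteq> \<zero>\<^bsub>R\<^esub>} \<subseteq> S \<Longrightarrow>
      finsum M (\<lambda>b. g b x \<odot>\<^bsub>M\<^esub> u b) S = x"
    by (rule projective_module_basis[OF proj], rule that)
  have gD: "g b x \<in> carrier R" "y \<in> carrier M \<Longrightarrow> g b (x \<oplus>\<^bsub>M\<^esub> y) = g b x \<oplus>\<^bsub>R\<^esub> g b y"
    "r \<in> carrier R \<Longrightarrow> g b (r \<odot>\<^bsub>M\<^esub> x) = r \<otimes>\<^bsub>R\<^esub> g b x"
    if "b \<in> B" "x \<in> carrier M" for b x y r
    using module_homsD[OF g[OF that(1)]] that by simp_all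
  define y where "y b = (SOME z. z \<in> carrier Z \<and> q z = f (u b))" for b
  have y: "y b \<in> carrier Z \<and> q (y b) = f (u b)" if "b \<in> B" for b
    unfolding y_def by (rule someI_ex) (use im[OF u[OF that]] in auto)
  define supp where "supp x = {b \<in> B. g b x \<noteq> \<zero>\<^bsub>R\<^esub>}" for x
  \<comment> \<open>The support of \<open>x\<close> varies with \<open>x\<close>;
    \<open>h_eq\<close> allows any larger finite index set, so that additivity can be checked over a
    common one.\<close>
  define h where "h x = finsum Z (\<lambda>b. g b x \<odot>\<^bsub>Z\<^esub> y b) (supp x)" for x
  have suppB: "supp x \<subseteq> B" for x by (auto simp: supp_def)
  have cl: "g b x \<odot>\<^bsub>Z\<^esub> y b \<in> carrier Z" if "b \<in> B" "x \<in> carrier M" for b x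
    using gD y that by (simp add: Z.smult_closed)
  have h_eq: "h x = finsum Z (\<lambda>b. g b x \<odot>\<^bsub>Z\<^esub> y b) S"
    if "x \<in> carrier M" "finite S" "S \<subseteq> B" "supp x \<subseteq> S" for x S
    unfolding h_def
    by (rule Z.M.add.finprod_mono_neutral_cong_left)
       (use that cl y in \<open>auto simp: supp_def left_module_smult_zero[OF Z]\<close>)
  have hc: "h x \<in> carrier Z" if "x \<in> carrier M" for x
    unfolding h_def using suppB that by (intro Z.M.finsum_closed) (auto intro!: cl)
  have "h \<in> module_homs R M Z"
  proof (rule module_homsI)
    fix a b assume a: "a \<in> carrier M" and b: "b \<in> carrier M"
    let ?S = "supp a \<union> supp b \<union> supp (a \<oplus>\<^bsub>M\<^esub> b)"
    have S: "finite ?S" "?S \<subseteq> B" using fin a b suppB by (auto simp: supp_def)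
    have "h (a \<oplus>\<^bsub>M\<^esub> b) = finsum Z (\<lambda>c. g c (a \<oplus>\<^bsub>M\<^esub> b) \<odot>\<^bsub>Z\<^esub> y c) ?S"
      using a b by (intro h_eq S) auto
    also have "\<dots> = finsum Z (\<lambda>c. g c a \<odot>\<^bsub>Z\<^esub> y c \<oplus>\<^bsub>Z\<^esub> g c b \<odot>\<^bsub>Z\<^esub> y c) ?S"
      using S(2) a b cl y gD by (intro Z.M.finsum_cong') (auto simp: Z.smult_l_distr subset_iff)
    also have "\<dots> = finsum Z (\<lambda>c. g c a \<odot>\<^bsub>Z\<^esub> y c) ?S \<oplus>\<^bsub>Z\<^esub> finsum Z (\<lambda>c. g c b \<odot>\<^bsub>Z\<^esub> y c) ?S"
      by (rule Z.M.finsum_addf) (use S(2) a b cl in auto)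
    also have "\<dots> = h a \<oplus>\<^bsub>Z\<^esub> h b"
      using h_eq[OF a S le_supI1[OF Un_upper1]] h_eq[OF b S le_supI1[OF Un_upper2]] by simp
    finally show "h (a \<oplus>\<^bsub>M\<^esub> b) = h a \<oplus>\<^bsub>Z\<^esub> h b" .
  next
    fix r a assume r: "r \<in> carrier R" and a: "a \<in> carrier M"
    let ?S = "supp a"
    have S: "finite ?S" "?S \<subseteq> B" using fin a suppB by (auto simp: supp_def)
    have "supp (r \<odot>\<^bsub>M\<^esub> a) \<subseteq> ?S" using r a by (auto simp: supp_def gD)
    then have "h (r \<odot>\<^bsub>M\<^esub> a) = finsum Z (\<lambda>c. g c (r \<odot>\<^bsub>M\<^esub> a) \<odot>\<^bsub>Z\<^esub> y c) ?S"
      using a r by (intro h_eq S) (auto simp: M.smult_closed)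
    also have "\<dots> = finsum Z (\<lambda>c. r \<odot>\<^bsub>Z\<^esub> (g c a \<odot>\<^bsub>Z\<^esub> y c)) ?S"
    proof (rule Z.M.finsum_cong')
      show "(\<lambda>c. r \<odot>\<^bsub>Z\<^esub> (g c a \<odot>\<^bsub>Z\<^esub> y c)) \<in> ?S \<rightarrow> carrier Z"
        using S(2) a r cl by (intro Pi_I Z.smult_closed[OF r]) blast
      show "g c (r \<odot>\<^bsub>M\<^esub> a) \<odot>\<^bsub>Z\<^esub> y c = r \<odot>\<^bsub>Z\<^esub> (g c a \<odot>\<^bsub>Z\<^esub> y c)" if "c \<in> ?S" for c
      proof -
        have "c \<in> B" using that S(2) by blast
        then show ?thesis using a r y by (simp add: gD Z.smult_assoc)
      qed
    qed simp
    also have "\<dots> = r \<odot>\<^bsub>Z\<^esub> h a"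
      unfolding h_def by (rule smult_finsum[OF Z r, symmetric]) (use S(2) a cl in auto)
    finally show "h (r \<odot>\<^bsub>M\<^esub> a) = r \<odot>\<^bsub>Z\<^esub> h a" .
  qed (rule hc)
  moreover have "q (h x) = f x" if x: "x \<in> carrier M" for x
  proof -
    have S: "finite (supp x)" using fin x by (auto simp: supp_def)
    have B: "b \<in> B" if "b \<in> supp x" for b using that by (simp add: supp_def)
    have "q (h x) = finsum N (\<lambda>b. q (g b x \<odot>\<^bsub>Z\<^esub> y b)) (supp x)"
      unfolding h_def by (rule module_homs_finsum[OF q Z N]) (use B cl x in auto)
    also have "\<dots> = finsum N (\<lambda>b. f (g b x \<odot>\<^bsub>M\<^esub> u b)) (supp x)"
      by (rule N.M.finsum_cong')
         (use B x y u gD in \<open>auto simp: module_homsD[OF q] module_homsD[OF f] intro!: N.smult_closed\<close>)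
    also have "\<dots> = f (finsum M (\<lambda>b. g b x \<odot>\<^bsub>M\<^esub> u b) (supp x))"
      by (rule module_homs_finsum[OF f M N, symmetric]) (use B x u gD in \<open>auto intro!: M.smult_closed\<close>)
    also have "\<dots> = f x" using sum[OF x S suppB] by (simp add: supp_def)
    finally show ?thesis .
  qed
  ultimately show thesis by (rule that)
qed

text \<open>The finitely many generators involve only finitely many coordinates. The elements whose
  remaining coordinates vanish form a submodule containing the generators, hence all of
  \<open>M\<close>, so the dual basis can be cut down to a finite one.\<close>

lemma fg_projective_imp_in_add:
  fixes M :: "('r, 'm, 'z) module_scheme"
  assumes "fg_projective_module R M"
  shows "in_add R (regular_module R) M"
proof -
  have proj: "projective_module R M" and fgm: "finitely_generated_module R M"
    using assms by (auto simp: fg_projective_module_def)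
  have M: "left_module R M" using proj by (simp add: projective_module_def)
  interpret M: left_module R M by fact
  have R: "left_module R (regular_module R)" by (rule left_module_regular[OF M.R.ring_axioms])
  obtain B :: "'m set" and u g where u: "\<And>b. b \<in> B \<Longrightarrow> u b \<in> carrier M"
    and g: "\<And>b. b \<in> B \<Longrightarrow> g b \<in> module_homs R M (regular_module R)"
    and fin: "\<And>x. x \<in> carrier M \<Longrightarrow> finite {b \<in> B. g b x \<noteq> \<zero>\<^bsub>R\<^esub>}"
    and sum: "\<And>x S. x \<in> carrier M \<Longrightarrow> finite S \<Longrightarrow> S \<subseteq> B \<Longrightarrow> {b \<in> B. g b x \<noteq> \<zero>\<^bsub>R\<^esub>} \<subseteq> S \<Longrightarrow>
      finsum M (\<lambda>b. g b x \<odot>\<^bsub>M\<^esub> u b) S = x"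
    by (rule projective_module_basis[OF proj], rule that)
  have gD: "g b x \<in> carrier R" "y \<in> carrier M \<Longrightarrow> g b (x \<oplus>\<^bsub>M\<^esub> y) = g b x \<oplus>\<^bsub>R\<^esub> g b y"
    "r \<in> carrier R \<Longrightarrow> g b (r \<odot>\<^bsub>M\<^esub> x) = r \<otimes>\<^bsub>R\<^esub> g b x"
    if "b \<in> B" "x \<in> carrier M" for b x y r
    using module_homsD[OF g[OF that(1)]] that by simp_all
  have g0: "g b \<zero>\<^bsub>M\<^esub> = \<zero>\<^bsub>R\<^esub>" if "b \<in> B" for b
    using module_homs_zero[OF g[OF that] M R] by simp
  obtain G where G: "G \<subseteq> carrier M" "finite G" "\<And>N. submodule N R M \<Longrightarrow> G \<subseteq> N \<Longrightarrow> N = carrier M"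
    using fgm by (auto simp: finitely_generated_module_def)
  define S where "S = (\<Union>x\<in>G. {b \<in> B. g b x \<noteq> \<zero>\<^bsub>R\<^esub>})"
  have S: "finite S" "S \<subseteq> B" using G fin by (auto simp: S_def)
  let ?N = "{x \<in> carrier M. \<forall>b\<in>B - S. g b x = \<zero>\<^bsub>R\<^esub>}"
  have "submodule ?N R M"
    by (rule submoduleI[OF M]) (auto simp: gD g0 M.smult_closed)
  then have N: "?N = carrier M" by (rule G(3)) (use G(1) in \<open>auto simp: S_def\<close>)
  have "add_decomposition R (regular_module R) M S (\<lambda>b r. r \<odot>\<^bsub>M\<^esub> u b) g"
    unfolding add_decomposition_def
  proof (intro conjI ballI)
    fix b assume "b \<in> S"
    then have "b \<in> B" using S by blast
    then show "(\<lambda>r. r \<odot>\<^bsub>M\<^esub> u b) \<in> module_homs R (regular_module R) M"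
      and "g b \<in> module_homs R M (regular_module R)"
      using g u module_homs_smult_regular[OF M] by auto
  next
    fix x assume x: "x \<in> carrier M"
    then show "finsum M (\<lambda>b. g b x \<odot>\<^bsub>M\<^esub> u b) S = x"
      by (intro sum S) (use N in blast)+
  qed (rule S)
  then show ?thesis by (rule in_addI[OF M R])
qed

text \<open>The images \<open>e i\<close> of 1 under the maps \<open>u i\<close> generate
  \<open>M\<close> and form, with the \<open>g i\<close>, a finite dual basis.\<close>

lemma in_add_imp_fg_projective:
  fixes M :: "('r, 'm, 'z) module_scheme"
  assumes R: "ring R" and add: "in_add R (regular_module R) M"
  shows "fg_projective_module R M"
proof -
  have Rm: "left_module R (regular_module R)" by (rule left_module_regular[OF R])
  obtain n :: nat and u g where M: "left_module R M"
    and dec: "add_decomposition R (regular_module R) M {..<n} u g"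
    by (rule in_addE[OF add Rm])
  interpret M: left_module R M by fact
  note d = add_decompositionD[OF dec]
  define e where "e i = u i \<one>\<^bsub>R\<^esub>" for i
  have e: "e i \<in> carrier M" if "i < n" for i
    using module_homsD(1)[OF d(2)] that by (simp add: e_def)
  have gc: "g i x \<in> carrier R" if "i < n" "x \<in> carrier M" for i x
    using module_homsD(1)[OF d(3)] that by simp
  have sum: "finsum M (\<lambda>i. g i x \<odot>\<^bsub>M\<^esub> e i) {..<n} = x" if x: "x \<in> carrier M" for x
  proof -
    have "finsum M (\<lambda>i. g i x \<odot>\<^bsub>M\<^esub> e i) {..<n} = finsum M (\<lambda>i. u i (g i x)) {..<n}"
    proof (rule M.M.finsum_cong')
      show "(\<lambda>i. u i (g i x)) \<in> {..<n} \<rightarrow> carrier M"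
        using module_homsD(1)[OF d(2)] gc x by auto
      show "g i x \<odot>\<^bsub>M\<^esub> e i = u i (g i x)" if "i \<in> {..<n}" for i
        using module_homs_regular_eq[OF M d(2) gc, of i i x] that x by (auto simp: e_def)
    qed simp
    then show ?thesis using d(4)[OF x] by simp
  qed
  have "finitely_generated_module R M"
    unfolding finitely_generated_module_def
  proof (intro exI[of _ "e ` {..<n}"] conjI allI impI)
    fix N assume N: "submodule N R M \<and> e ` {..<n} \<subseteq> N"
    then interpret N: submodule N R M by simp
    have "finsum M h I \<in> N" if "\<And>i. i \<in> I \<Longrightarrow> h i \<in> N" for h and I :: "nat set"
      using that
    proof (induction I rule: infinite_finite_induct)
      case (insert i I)
      then show ?case
        using N.subset N.m_closed by (subst M.M.finsum_insert) auto
    qed (use N.one_closed in simp_all)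
    note fin = this
    have "x \<in> N" if x: "x \<in> carrier M" for x
    proof -
      have "finsum M (\<lambda>i. g i x \<odot>\<^bsub>M\<^esub> e i) {..<n} \<in> N"
        by (rule fin) (use N gc x in \<open>auto intro!: N.smult_closed\<close>)
      then show ?thesis using sum[OF x] by simp
    qed
    then show "N = carrier M" using N.subset by auto
  qed (use e in auto)
  moreover have "projective_module R M"
  proof -
    \<comment> \<open>\<open>projective_module\<close> asks for a basis indexed by elements of
      \<open>M\<close>. The vectors \<open>e i\<close> serve as their own indices; since several
      \<open>i\<close> may give the same vector, their coordinates are added up over each
      fibre.\<close>
    let ?B = "e ` {..<n}" and ?I = "\<lambda>b. {i \<in> {..<n}. e i = b}"
    let ?g = "\<lambda>b x. finsum (regular_module R) (\<lambda>i. g i x) (?I b)"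
    have g': "?g b \<in> module_homs R M (regular_module R)" for b
      by (rule module_homs_sum[OF M Rm]) (use d(3) in auto)
    have "finsum M (\<lambda>b. ?g b x \<odot>\<^bsub>M\<^esub> b) ?B = x" if x: "x \<in> carrier M" for x
    proof -
      have "finsum M (\<lambda>b. ?g b x \<odot>\<^bsub>M\<^esub> b) ?B = finsum M (\<lambda>b. finsum M (\<lambda>i. g i x \<odot>\<^bsub>M\<^esub> e i) (?I b)) ?B"
      proof (rule M.M.finsum_cong')
        fix b assume b: "b \<in> ?B"
        have "?g b x \<odot>\<^bsub>M\<^esub> b = finsum M (\<lambda>i. g i x \<odot>\<^bsub>M\<^esub> b) (?I b)"
          by (rule module_homs_finsum[OF module_homs_smult_regular[OF M] Rm M]) (use b e gc x in auto)
        also have "\<dots> = finsum M (\<lambda>i. g i x \<odot>\<^bsub>M\<^esub> e i) (?I b)"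
          by (rule M.M.finsum_cong') (use e gc x M.smult_closed in auto)
        finally show "?g b x \<odot>\<^bsub>M\<^esub> b = finsum M (\<lambda>i. g i x \<odot>\<^bsub>M\<^esub> e i) (?I b)" .
      qed (use e gc x M.smult_closed in auto)
      also have "\<dots> = finsum M (\<lambda>i. g i x \<odot>\<^bsub>M\<^esub> e i) (\<Union>b\<in>?B. ?I b)"
        by (rule M.M.add.finprod_UN_disjoint[symmetric])
           (use e gc x M.smult_closed in \<open>auto simp: pairwise_def disjnt_def\<close>)
      also have "(\<Union>b\<in>?B. ?I b) = {..<n}" by auto
      also have "finsum M (\<lambda>i. g i x \<odot>\<^bsub>M\<^esub> e i) {..<n} = x" by (rule sum[OF x])
      finally show ?thesis .
    qed
    then have "add_decomposition R (regular_module R) M ?B (\<lambda>b r. r \<odot>\<^bsub>M\<^esub> b) ?g"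
      using e g' module_homs_smult_regular[OF M] by (auto simp: add_decomposition_def)
    from add_decomposition_imp_direct_summand[OF M Rm this] M show ?thesis
      unfolding projective_module_def by blast
  qed
  ultimately show ?thesis by (simp add: fg_projective_module_def)
qed

section \<open>Exactness under Hom, and Ext\<close>

text \<open>The direct sum is described by its inclusions and projections, not by pairs: in this
  form it can be moved to a function type, so that repeated sums stay on one element type.\<close>

definition biproduct ::
    "('r, 'a) ring_scheme \<Rightarrow> ('r, 'm, 'b) module_scheme \<Rightarrow> ('r, 'n, 'c) module_scheme
      \<Rightarrow> ('r, 'd, 'e) module_scheme \<Rightarrow> ('m \<Rightarrow> 'd) \<Rightarrow> ('n \<Rightarrow> 'd) \<Rightarrow> ('d \<Rightarrow> 'm) \<Rightarrow> ('d \<Rightarrow> 'n) \<Rightarrow> bool"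
  where
  "biproduct R M N D i1 i2 p1 p2 \<longleftrightarrow> left_module R D \<and>
    i1 \<in> module_homs R M D \<and> i2 \<in> module_homs R N D \<and>
    p1 \<in> module_homs R D M \<and> p2 \<in> module_homs R D N \<and>
    (\<forall>x\<in>carrier M. p1 (i1 x) = x \<and> p2 (i1 x) = \<zero>\<^bsub>N\<^esub>) \<and>
    (\<forall>y\<in>carrier N. p1 (i2 y) = \<zero>\<^bsub>M\<^esub> \<and> p2 (i2 y) = y) \<and>
    (\<forall>z\<in>carrier D. i1 (p1 z) \<oplus>\<^bsub>D\<^esub> i2 (p2 z) = z)"

lemma biproductD:
  assumes "biproduct R M N D i1 i2 p1 p2"
  shows "left_module R D" "i1 \<in> module_homs R M D" "i2 \<in> module_homs R N D"
    "p1 \<in> module_homs R D M" "p2 \<in> module_homs R D N"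
    "\<And>x. x \<in> carrier M \<Longrightarrow> p1 (i1 x) = x" "\<And>x. x \<in> carrier M \<Longrightarrow> p2 (i1 x) = \<zero>\<^bsub>N\<^esub>"
    "\<And>y. y \<in> carrier N \<Longrightarrow> p1 (i2 y) = \<zero>\<^bsub>M\<^esub>" "\<And>y. y \<in> carrier N \<Longrightarrow> p2 (i2 y) = y"
    "\<And>z. z \<in> carrier D \<Longrightarrow> i1 (p1 z) \<oplus>\<^bsub>D\<^esub> i2 (p2 z) = z"
  using assms by (auto simp: biproduct_def)

lemma biproduct_iso:
  assumes b: "biproduct R M N D i1 i2 p1 p2" and D': "left_module R D'" and fh: "inverse_homs R D D' f h"
  shows "biproduct R M N D' (\<lambda>x. f (i1 x)) (\<lambda>x. f (i2 x)) (\<lambda>x. p1 (h x)) (\<lambda>x. p2 (h x))"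
proof -
  note d = biproductD[OF b] and i = inverse_homsD[OF fh]
  note cl = module_homsD(1)[OF d(2)] module_homsD(1)[OF d(3)] module_homsD(1)[OF d(4)]
    module_homsD(1)[OF d(5)] module_homsD(1)[OF i(2)] module_homsD(1)[OF i(1)]
  have "f (i1 (p1 (h z))) \<oplus>\<^bsub>D'\<^esub> f (i2 (p2 (h z))) = z" if z: "z \<in> carrier D'" for z
  proof -
    have "f (i1 (p1 (h z))) \<oplus>\<^bsub>D'\<^esub> f (i2 (p2 (h z))) = f (i1 (p1 (h z)) \<oplus>\<^bsub>D\<^esub> i2 (p2 (h z)))"
      using z by (simp add: module_homsD(2)[OF i(1)] cl)
    also have "\<dots> = z" using z by (simp add: d(10) cl i(4))
    finally show ?thesis .
  qed
  then show ?thesis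
    unfolding biproduct_def
    using D' module_homs_comp[OF d(2) i(1)] module_homs_comp[OF d(3) i(1)]
      module_homs_comp[OF i(2) d(4)] module_homs_comp[OF i(2) d(5)] d(6-9) i(3) cl by simp
qed

definition prod_module ::
    "('r, 'm, 'b) module_scheme \<Rightarrow> ('r, 'n, 'c) module_scheme \<Rightarrow> ('r, 'm \<times> 'n) module" where
  "prod_module M N =
    \<lparr>carrier = carrier M \<times> carrier N, monoid.mult = undefined, one = undefined,
     ring.zero = (\<zero>\<^bsub>M\<^esub>, \<zero>\<^bsub>N\<^esub>), add = (\<lambda>(x, y) (x', y'). (x \<oplus>\<^bsub>M\<^esub> x', y \<oplus>\<^bsub>N\<^esub> y')),
     smult = (\<lambda>r (x, y). (r \<odot>\<^bsub>M\<^esub> x, r \<odot>\<^bsub>N\<^esub> y))\<rparr>"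

lemma prod_module_simps [simp]:
  "carrier (prod_module M N) = carrier M \<times> carrier N"
  "ring.zero (prod_module M N) = (\<zero>\<^bsub>M\<^esub>, \<zero>\<^bsub>N\<^esub>)"
  "(x, y) \<oplus>\<^bsub>prod_module M N\<^esub> (x', y') = (x \<oplus>\<^bsub>M\<^esub> x', y \<oplus>\<^bsub>N\<^esub> y')"
  "r \<odot>\<^bsub>prod_module M N\<^esub> (x, y) = (r \<odot>\<^bsub>M\<^esub> x, r \<odot>\<^bsub>N\<^esub> y)"
  by (simp_all add: prod_module_def)

lemma left_module_prod:
  assumes "left_module R M" "left_module R N" shows "left_module R (prod_module M N)"
proof -
  interpret M: left_module R M by fact
  interpret N: left_module R N by fact
  have "abelian_group (prod_module M N)"
  proof (rule abelian_groupI)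
    fix z assume "z \<in> carrier (prod_module M N)"
    then show "\<exists>w\<in>carrier (prod_module M N). w \<oplus>\<^bsub>prod_module M N\<^esub> z = \<zero>\<^bsub>prod_module M N\<^esub>"
      by (intro bexI[of _ "(\<ominus>\<^bsub>M\<^esub> fst z, \<ominus>\<^bsub>N\<^esub> snd z)"]) (auto simp: M.M.l_neg N.M.l_neg)
  qed (auto intro: M.M.a_assoc N.M.a_assoc M.M.a_comm N.M.a_comm)
  moreover have "left_module_axioms R (prod_module M N)"
    by unfold_locales
       (auto simp: M.smult_closed M.smult_l_distr M.smult_r_distr M.smult_assoc M.smult_one
          N.smult_closed N.smult_l_distr N.smult_r_distr N.smult_assoc N.smult_one)
  ultimately show ?thesis using M.R.ring_axioms by (simp add: left_module_def)
qed

lemma biproduct_prod_module: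
  assumes M: "left_module R M" and N: "left_module R N"
  shows "biproduct R M N (prod_module M N) (\<lambda>x. (x, \<zero>\<^bsub>N\<^esub>)) (\<lambda>y. (\<zero>\<^bsub>M\<^esub>, y)) fst snd"
proof -
  interpret M: left_module R M by fact
  interpret N: left_module R N by fact
  note z = left_module_smult_zero(1)[OF M] left_module_smult_zero(1)[OF N]
  show ?thesis
    unfolding biproduct_def
    by (intro conjI module_homsI left_module_prod[OF M N]) (auto simp: z)
qed

lemma in_add_biproduct:
  assumes T: "left_module R T" and M: "in_add R T M" and N: "in_add R T N"
    and b: "biproduct R M N D i1 i2 p1 p2"
  shows "in_add R T D"
proof -
  obtain n :: nat and u g where Mm: "left_module R M" and dM: "add_decomposition R T M {..<n} u g"
    by (rule in_addE[OF M T])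
  obtain m :: nat and v h where Nm: "left_module R N" and dN: "add_decomposition R T N {..<m} v h"
    by (rule in_addE[OF N T])
  note d = biproductD[OF b]
  interpret D: left_module R D by (rule d(1))
  note a = add_decompositionD[OF dM] and c = add_decompositionD[OF dN]
  note cl = module_homsD(1)[OF d(2)] module_homsD(1)[OF d(3)] module_homsD(1)[OF d(4)]
    module_homsD(1)[OF d(5)] module_homsD(1)[OF a(2)] module_homsD(1)[OF a(3)]
    module_homsD(1)[OF c(2)] module_homsD(1)[OF c(3)]
  let ?U = "case_sum (\<lambda>i x. i1 (u i x)) (\<lambda>j x. i2 (v j x))"
  let ?G = "case_sum (\<lambda>i x. g i (p1 x)) (\<lambda>j x. h j (p2 x))"
  have "finsum D (\<lambda>k. ?U k (?G k z)) ({..<n} <+> {..<m}) = z" if z: "z \<in> carrier D" for z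
  proof -
    have "finsum D (\<lambda>k. ?U k (?G k z)) (Inl ` {..<n} \<union> Inr ` {..<m}) =
        finsum D (\<lambda>k. ?U k (?G k z)) (Inl ` {..<n}) \<oplus>\<^bsub>D\<^esub> finsum D (\<lambda>k. ?U k (?G k z)) (Inr ` {..<m})"
      by (rule D.M.finsum_Un_disjoint) (use z cl in auto)
    also have "finsum D (\<lambda>k. ?U k (?G k z)) (Inl ` {..<n}) = finsum D (\<lambda>i. i1 (u i (g i (p1 z)))) {..<n}"
      by (subst D.M.finsum_reindex) (use z cl in auto)
    also have "\<dots> = i1 (finsum M (\<lambda>i. u i (g i (p1 z))) {..<n})"
      by (rule module_homs_finsum[OF d(2) Mm d(1), symmetric]) (use z cl in auto)
    also have "finsum D (\<lambda>k. ?U k (?G k z)) (Inr ` {..<m}) = finsum D (\<lambda>i. i2 (v i (h i (p2 z)))) {..<m}"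
      by (subst D.M.finsum_reindex) (use z cl in auto)
    also have "\<dots> = i2 (finsum N (\<lambda>i. v i (h i (p2 z))) {..<m})"
      by (rule module_homs_finsum[OF d(3) Nm d(1), symmetric]) (use z cl in auto)
    finally show ?thesis using z by (simp add: a(4) c(4) cl d(10) Plus_def)
  qed
  moreover have "?U k \<in> module_homs R T D \<and> ?G k \<in> module_homs R D T" if "k \<in> {..<n} <+> {..<m}" for k
    using that module_homs_comp[OF a(2) d(2)] module_homs_comp[OF d(4) a(3)]
      module_homs_comp[OF c(2) d(3)] module_homs_comp[OF d(5) c(3)]
    by (cases k) auto
  ultimately have "add_decomposition R T D ({..<n} <+> {..<m}) ?U ?G"
    unfolding add_decomposition_def by simp
  then show ?thesis by (rule in_addI[OF d(1) T])
qed

text \<open>Keeps the element type fixed in the recursions for retracts, where each term is the sum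
  of a new module and the preceding term.\<close>

lemma in_add_biproduct_exists:
  fixes T :: "('r, 't, 'z) module_scheme"
  assumes T: "left_module R T" and M: "in_add R T M" and N: "in_add R T N"
    and inf: "infinite (UNIV :: 'i set)"
  obtains D :: "('r, 'i \<Rightarrow> 't) module" and i1 i2 p1 p2
  where "in_add R T D" "biproduct R M N D i1 i2 p1 p2"
proof -
  note b = biproduct_prod_module[OF in_add_left_module[OF M] in_add_left_module[OF N]]
  have P: "in_add R T (prod_module M N)" by (rule in_add_biproduct[OF T M N b])
  obtain D :: "('r, 'i \<Rightarrow> 't) module" and f g
    where D: "left_module R D" "inverse_homs R (prod_module M N) D f g"
    by (rule in_add_transport[OF T P inf])
  show thesis
    by (rule that[OF in_add_iso[OF T P D] biproduct_iso[OF b D]])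
qed

text \<open>Exactness of \<open>Hom\<^sub>R(K, T) \<rightarrow> Hom\<^sub>R(N, T) \<rightarrow> Hom\<^sub>R(M, T)\<close>, apart from the vanishing of the composite.\<close>

definition hom_exact ::
    "('r, 'a) ring_scheme \<Rightarrow> ('r, 'm, 'b) module_scheme \<Rightarrow> ('m \<Rightarrow> 'n) \<Rightarrow> ('r, 'n, 'c) module_scheme
      \<Rightarrow> ('n \<Rightarrow> 'k) \<Rightarrow> ('r, 'k, 'd) module_scheme \<Rightarrow> ('r, 't, 'e) module_scheme \<Rightarrow> bool" where
  "hom_exact R M f N g K T \<longleftrightarrow>
    (\<forall>\<phi>\<in>module_homs R N T. (\<forall>x\<in>carrier M. \<phi> (f x) = \<zero>\<^bsub>T\<^esub>) \<longrightarrow>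
      (\<exists>\<psi>\<in>module_homs R K T. \<forall>y\<in>carrier N. \<phi> y = \<psi> (g y)))"

lemma hom_exactI:
  assumes "\<And>\<phi>. \<phi> \<in> module_homs R N T \<Longrightarrow> (\<And>x. x \<in> carrier M \<Longrightarrow> \<phi> (f x) = \<zero>\<^bsub>T\<^esub>) \<Longrightarrow>
    \<exists>\<psi>\<in>module_homs R K T. \<forall>y\<in>carrier N. \<phi> y = \<psi> (g y)"
  shows "hom_exact R M f N g K T"
  using assms unfolding hom_exact_def by blast

lemma hom_exactD:
  assumes "hom_exact R M f N g K T" "\<phi> \<in> module_homs R N T" "\<And>x. x \<in> carrier M \<Longrightarrow> \<phi> (f x) = \<zero>\<^bsub>T\<^esub>"
  shows "\<exists>\<psi>\<in>module_homs R K T. \<forall>y\<in>carrier N. \<phi> y = \<psi> (g y)"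
  using assms unfolding hom_exact_def by blast

section \<open>Hom groups, pullbacks and the vanishing of Ext\<close>

lemma Hom_simps [simp]:
  "carrier (Hom R M N) = module_homs R M N \<inter> extensional (carrier M)"
  "ring.zero (Hom R M N) = (\<lambda>x\<in>carrier M. \<zero>\<^bsub>N\<^esub>)"
  "add (Hom R M N) = (\<lambda>f g. \<lambda>x\<in>carrier M. f x \<oplus>\<^bsub>N\<^esub> g x)"
  by (simp_all add: Hom_def)

lemma restrict_module_homs:
  "left_module R M \<Longrightarrow> f \<in> module_homs R M N \<Longrightarrow> (\<lambda>x\<in>carrier M. f x) \<in> module_homs R M N"
  by (rule module_homs_cong) auto

lemma pullback_in_Hom:
  assumes "left_module R M" "d \<in> module_homs R M N" "f \<in> module_homs R N K"
  shows "pullback M d f \<in> carrier (Hom R M K)"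
  using restrict_module_homs[OF assms(1) module_homs_comp[OF assms(2,3)]]
  by (simp add: pullback_def compose_def)

lemma abelian_group_Hom:
  assumes M: "left_module R M" and N: "left_module R N"
  shows "abelian_group (Hom R M N)"
proof -
  interpret N: left_module R N by fact
  note r = restrict_module_homs[OF M]
  show ?thesis
  proof (rule abelian_groupI)
    fix f g h assume f: "f \<in> carrier (Hom R M N)"
    show "\<zero>\<^bsub>Hom R M N\<^esub> \<oplus>\<^bsub>Hom R M N\<^esub> f = f"
      using f module_homsD(1)[of f R M N] by (auto intro!: restrict_eqI)
    have "(\<lambda>x. \<ominus>\<^bsub>N\<^esub> f x) \<in> module_homs R M N"
      by (rule module_homs_cong[OF module_homs_diff[OF module_homs_const_zero[OF N] _ M N, of f] _ M])
         (use f module_homsD(1)[of f R M N] in \<open>auto simp: a_minus_def\<close>)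
    then show "\<exists>g\<in>carrier (Hom R M N). g \<oplus>\<^bsub>Hom R M N\<^esub> f = \<zero>\<^bsub>Hom R M N\<^esub>"
      using f module_homsD(1)[of f R M N]
      by (intro bexI[of _ "\<lambda>x\<in>carrier M. \<ominus>\<^bsub>N\<^esub> f x"]) (auto intro!: restrict_ext r simp: N.M.l_neg)
    assume g: "g \<in> carrier (Hom R M N)"
    show "f \<oplus>\<^bsub>Hom R M N\<^esub> g \<in> carrier (Hom R M N)"
      using f g r[OF module_homs_add[OF _ _ M N]] by simp
    show "f \<oplus>\<^bsub>Hom R M N\<^esub> g = g \<oplus>\<^bsub>Hom R M N\<^esub> f"
      using f g module_homsD(1)[of f R M N] module_homsD(1)[of g R M N]
      by (auto intro!: restrict_ext N.M.a_comm)
    assume h: "h \<in> carrier (Hom R M N)"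
    show "f \<oplus>\<^bsub>Hom R M N\<^esub> g \<oplus>\<^bsub>Hom R M N\<^esub> h = f \<oplus>\<^bsub>Hom R M N\<^esub> (g \<oplus>\<^bsub>Hom R M N\<^esub> h)"
      using f g h module_homsD(1)[of f R M N] module_homsD(1)[of g R M N] module_homsD(1)[of h R M N]
      by (auto intro!: restrict_ext N.M.a_assoc)
  next
    show "\<zero>\<^bsub>Hom R M N\<^esub> \<in> carrier (Hom R M N)"
      using r[OF module_homs_const_zero[OF N]] by simp
  qed
qed

lemma pullback_group_hom:
  assumes M: "left_module R M" and N: "left_module R N" and T: "left_module R T"
    and d: "d \<in> module_homs R M N"
  shows "group_hom (add_monoid (Hom R N T)) (add_monoid (Hom R M T)) (pullback M d)"
proof -
  interpret T: left_module R T by fact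
  interpret MT: abelian_group "Hom R M T" by (rule abelian_group_Hom[OF M T])
  interpret NT: abelian_group "Hom R N T" by (rule abelian_group_Hom[OF N T])
  have "pullback M d \<in> hom (add_monoid (Hom R N T)) (add_monoid (Hom R M T))"
  proof (rule homI)
    show "pullback M d f \<in> carrier (add_monoid (Hom R M T))"
      if "f \<in> carrier (add_monoid (Hom R N T))" for f
      using pullback_in_Hom[OF M d, of f T] that by simp
    show "pullback M d (f \<otimes>\<^bsub>add_monoid (Hom R N T)\<^esub> g) =
        pullback M d f \<otimes>\<^bsub>add_monoid (Hom R M T)\<^esub> pullback M d g" for f g
      by (auto simp: pullback_def compose_def module_homsD(1)[OF d] intro!: restrict_ext)
  qed
  then show ?thesis
    using MT.a_group NT.a_group by (simp add: group_hom_def group_hom_axioms_def)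
qed

text \<open>The bridge from groups of extensional functions to \<open>hom_exact\<close>, which
  speaks of plain functions up to their values on carriers. That the composite of \<open>f\<close>
  and \<open>g\<close> vanishes gives one inclusion; \<open>hom_exact\<close> is precisely the
  other.\<close>

lemma pullback_exact_iff:
  assumes M: "left_module R M" and N: "left_module R N" and K: "left_module R K" and T: "left_module R T"
    and f: "f \<in> module_homs R M N" and g: "g \<in> module_homs R N K"
    and gf: "\<And>x. x \<in> carrier M \<Longrightarrow> g (f x) = \<zero>\<^bsub>K\<^esub>"
  shows "pullback N g ` carrier (Hom R K T) \<subseteq> a_kernel (Hom R N T) (Hom R M T) (pullback M f)"
    and "pullback N g ` carrier (Hom R K T) = a_kernel (Hom R N T) (Hom R M T) (pullback M f) \<longleftrightarrow>
      hom_exact R M f N g K T"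
proof -
  show sub: "pullback N g ` carrier (Hom R K T) \<subseteq> a_kernel (Hom R N T) (Hom R M T) (pullback M f)"
  proof
    fix \<phi> assume "\<phi> \<in> pullback N g ` carrier (Hom R K T)"
    then obtain \<psi> where \<psi>: "\<psi> \<in> module_homs R K T" and \<phi>: "\<phi> = pullback N g \<psi>" by auto
    have "pullback M f \<phi> = (\<lambda>x\<in>carrier M. \<zero>\<^bsub>T\<^esub>)"
      unfolding \<phi> pullback_def compose_def
      by (rule restrict_ext) (simp add: module_homsD(1)[OF f] gf module_homs_zero[OF \<psi> K T])
    then show "\<phi> \<in> a_kernel (Hom R N T) (Hom R M T) (pullback M f)"
      using pullback_in_Hom[OF N g \<psi>] \<phi> by (simp add: a_kernel_def')
  qed
  show "pullback N g ` carrier (Hom R K T) = a_kernel (Hom R N T) (Hom R M T) (pullback M f) \<longleftrightarrow>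
      hom_exact R M f N g K T"
  proof
    assume eq: "pullback N g ` carrier (Hom R K T) = a_kernel (Hom R N T) (Hom R M T) (pullback M f)"
    show "hom_exact R M f N g K T"
    proof (rule hom_exactI)
      fix \<phi> assume \<phi>: "\<phi> \<in> module_homs R N T" and z: "\<And>x. x \<in> carrier M \<Longrightarrow> \<phi> (f x) = \<zero>\<^bsub>T\<^esub>"
      have "(\<lambda>y\<in>carrier N. \<phi> y) \<in> a_kernel (Hom R N T) (Hom R M T) (pullback M f)"
        using restrict_module_homs[OF N \<phi>] z
        by (auto simp: a_kernel_def' pullback_def compose_def module_homsD(1)[OF f] intro!: restrict_ext)
      then obtain \<psi> where "\<psi> \<in> carrier (Hom R K T)" and \<psi>: "(\<lambda>y\<in>carrier N. \<phi> y) = pullback N g \<psi>"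
        unfolding eq[symmetric] by blast
      moreover have "\<phi> y = \<psi> (g y)" if "y \<in> carrier N" for y
        using fun_cong[OF \<psi>, of y] that by (simp add: pullback_def compose_def)
      ultimately show "\<exists>\<psi>\<in>module_homs R K T. \<forall>y\<in>carrier N. \<phi> y = \<psi> (g y)" by auto
    qed
  next
    assume ex: "hom_exact R M f N g K T"
    have "a_kernel (Hom R N T) (Hom R M T) (pullback M f) \<subseteq> pullback N g ` carrier (Hom R K T)"
    proof
      fix \<phi> assume "\<phi> \<in> a_kernel (Hom R N T) (Hom R M T) (pullback M f)"
      then have \<phi>: "\<phi> \<in> module_homs R N T" "\<phi> \<in> extensional (carrier N)"
        and z: "pullback M f \<phi> = (\<lambda>x\<in>carrier M. \<zero>\<^bsub>T\<^esub>)"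
        by (auto simp: a_kernel_def')
      have "\<phi> (f x) = \<zero>\<^bsub>T\<^esub>" if "x \<in> carrier M" for x
        using fun_cong[OF z, of x] that by (simp add: pullback_def compose_def)
      from hom_exactD[OF ex \<phi>(1) this]
      obtain \<psi> where \<psi>: "\<psi> \<in> module_homs R K T" "\<And>y. y \<in> carrier N \<Longrightarrow> \<phi> y = \<psi> (g y)"
        by blast
      have "pullback N g (\<lambda>y\<in>carrier K. \<psi> y) = \<phi>"
        unfolding pullback_def compose_def
        using \<phi>(2) by (rule restrict_eqI) (simp add: \<psi>(2) module_homsD(1)[OF g])
      moreover have "(\<lambda>y\<in>carrier K. \<psi> y) \<in> carrier (Hom R K T)"
        using restrict_module_homs[OF K \<psi>(1)] by simp
      ultimately show "\<phi> \<in> pullback N g ` carrier (Hom R K T)" by blast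
    qed
    with sub show "pullback N g ` carrier (Hom R K T) = a_kernel (Hom R N T) (Hom R M T) (pullback M f)"
      by blast
  qed
qed

lemma trivial_FactGroup_iff:
  assumes "comm_group G" "subgroup H G"
  shows "trivial_group (G Mod H) \<longleftrightarrow> H = carrier G"
proof -
  interpret comm_group G by fact
  interpret H: subgroup H G by fact
  have grp: "group (G Mod H)"
    using subgroup_imp_normal[OF assms(2)] by (rule normal.factorgroup_is_group)
  have one: "\<one>\<^bsub>G Mod H\<^esub> = H" by (simp add: FactGroup_def)
  show ?thesis
  proof
    assume "trivial_group (G Mod H)"
    then have eq: "carrier (G Mod H) = {H}" by (simp add: trivial_group_def one)
    have "x \<in> H" if x: "x \<in> carrier G" for x
    proof -
      have "H #>\<^bsub>G\<^esub> x = H" using eq x by (auto simp: carrier_FactGroup)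
      then show ?thesis using x rcos_self[OF x assms(2)] by simp
    qed
    then show "H = carrier G" using H.subset by auto
  next
    assume H: "H = carrier G"
    have "H #>\<^bsub>G\<^esub> x = H" if "x \<in> carrier G" for x
      using coset_join2[OF that assms(2)] that H by simp
    then have "carrier (G Mod H) = {H}"
      using one_closed by (auto simp: carrier_FactGroup)
    then show "trivial_group (G Mod H)" using grp by (simp add: trivial_group_def one)
  qed
qed

lemma projective_resolutionD:
  assumes "projective_resolution R M P d e"
  shows "\<And>i. projective_module R (P i)" "\<And>i. d i \<in> module_homs R (P (Suc i)) (P i)"
    "e \<in> module_homs R (P 0) M" "e ` carrier (P 0) = carrier M"
    "d 0 ` carrier (P 1) = a_kernel (P 0) M e"
    "\<And>i. d (Suc i) ` carrier (P (Suc (Suc i))) = a_kernel (P (Suc i)) (P i) (d i)"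
  using assms by (auto simp: projective_resolution_def)

lemma a_kernel_iff: "x \<in> a_kernel M N f \<longleftrightarrow> x \<in> carrier M \<and> f x = \<zero>\<^bsub>N\<^esub>"
  by (simp add: a_kernel_def')

text \<open>In degree \<open>Suc j\<close> the coboundaries are the image of the pullback along
  \<open>d j\<close>, and the quotient is trivial exactly when they exhaust the cocycles.\<close>

lemma trivial_Ext_iff:
  assumes N: "left_module R N" and res: "projective_resolution R M P d e"
    and ch: "chosen_resolution R M = (P, d, e)"
  shows "trivial_group (Ext R (Suc j) M N) \<longleftrightarrow>
    hom_exact R (P (Suc (Suc j))) (d (Suc j)) (P (Suc j)) (d j) (P j) N"
proof -
  note r = projective_resolutionD[OF res]
  have P: "left_module R (P i)" for i using r(1)[of i] by (simp add: projective_module_def)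
  have dd: "d j (d (Suc j) x) = \<zero>\<^bsub>P j\<^esub>" if "x \<in> carrier (P (Suc (Suc j)))" for x
    using r(6)[of j] that a_kernel_iff[of "d (Suc j) x" "P (Suc j)" "P j" "d j"] by blast
  let ?H = "Hom R (P (Suc j)) N"
  let ?Z = "cocycles R P d N (Suc j)" and ?B = "coboundaries R P d N (Suc j)"
  interpret H: abelian_group ?H by (rule abelian_group_Hom[OF P N])
  have Z: "subgroup ?Z (add_monoid ?H)"
    unfolding cocycles_def a_kernel_def
    by (rule group_hom.subgroup_kernel[OF pullback_group_hom[OF P P N r(2)]])
  have B: "subgroup ?B (add_monoid ?H)"
    using group_hom.img_is_subgroup[OF pullback_group_hom[OF P P N r(2)[of j]]]
    by (simp add: coboundaries_def)
  have BZ: "?B \<subseteq> ?Z"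
    using pullback_exact_iff(1)[OF P[of "Suc (Suc j)"] P[of "Suc j"] P[of j] N r(2)[of "Suc j"] r(2)[of j], OF dd] by (simp add: coboundaries_def cocycles_def)
  let ?G = "(add_monoid ?H)\<lparr>carrier := ?Z\<rparr>"
  have "group ?G" by (rule subgroup.subgroup_is_group[OF Z H.a_group])
  then have "comm_group ?G"
    by (rule group.group_comm_groupI) (use subgroup.subset[OF Z] H.a_comm in \<open>auto simp del: Hom_simps\<close>)
  moreover have "subgroup ?B ?G" by (rule group.subgroup_incl[OF H.a_group B Z BZ])
  ultimately have "trivial_group (?G Mod ?B) \<longleftrightarrow> ?B = ?Z"
    using trivial_FactGroup_iff by fastforce
  also have "\<dots> \<longleftrightarrow> hom_exact R (P (Suc (Suc j))) (d (Suc j)) (P (Suc j)) (d j) (P j) N"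
    using pullback_exact_iff(2)[OF P[of "Suc (Suc j)"] P[of "Suc j"] P[of j] N r(2)[of "Suc j"] r(2)[of j], OF dd] by (simp add: coboundaries_def cocycles_def)
  finally show ?thesis by (simp add: Ext_def ch)
qed

section \<open>Independence of the projective resolution\<close>

text \<open>The lift of the identity of \<open>M\<close> to a chain map between two resolutions,
  built degree by degree by projectivity.\<close>

lemma comparison_map:
  assumes M: "left_module R M"
    and res: "projective_resolution R M P d e" and res': "projective_resolution R M P' d' e'"
  obtains f where "\<And>i. f i \<in> module_homs R (P i) (P' i)"
    "\<And>i x. x \<in> carrier (P (Suc i)) \<Longrightarrow> d' i (f (Suc i) x) = f i (d i x)"
    "\<And>x. x \<in> carrier (P 0) \<Longrightarrow> e' (f 0 x) = e x"
proof -
  note r = projective_resolutionD[OF res] and r' = projective_resolutionD[OF res']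
  have P: "left_module R (P i)" for i using r(1)[of i] by (simp add: projective_module_def)
  have P': "left_module R (P' i)" for i using r'(1)[of i] by (simp add: projective_module_def)
  note dc = module_homsD(1)[OF r(2)] module_homsD(1)[OF r(3)]
  have dd: "d i (d (Suc i) x) = \<zero>\<^bsub>P i\<^esub>" if "x \<in> carrier (P (Suc (Suc i)))" for i x
    using r(6)[of i] that a_kernel_iff[of "d (Suc i) x" "P (Suc i)" "P i" "d i"] by blast
  have ed: "e (d 0 x) = \<zero>\<^bsub>M\<^esub>" if "x \<in> carrier (P (Suc 0))" for x
    using r(5) that a_kernel_iff[of "d 0 x" "P 0" M e] by auto
  \<comment> \<open>The second clause is the invariant that makes the next lift possible: f d lands
    in the image of the next differential d'. It is passed on because d' kills f d d and the target
    is exact.\<close>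
  let ?A = "\<lambda>n f. f \<in> module_homs R (P n) (P' n) \<and>
      (\<forall>x\<in>carrier (P (Suc n)). f (d n x) \<in> d' n ` carrier (P' (Suc n))) \<and>
      (n = 0 \<longrightarrow> (\<forall>x\<in>carrier (P 0). e' (f x) = e x))"
  let ?B = "\<lambda>n f f'. \<forall>x\<in>carrier (P (Suc n)). d' n (f' x) = f (d n x)"
  have "\<exists>f. \<forall>n. ?A n (f n) \<and> ?B n (f n) (f (Suc n))"
  proof (rule dependent_nat_choice)
    obtain f where f: "f \<in> module_homs R (P 0) (P' 0)" "\<And>x. x \<in> carrier (P 0) \<Longrightarrow> e' (f x) = e x"
      by (rule projective_lift[OF r(1)[of 0] P'[of 0] M r'(3) r(3)]) (use r'(4) dc in auto)
    have "f (d 0 x) \<in> d' 0 ` carrier (P' (Suc 0))" if x: "x \<in> carrier (P (Suc 0))" for x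
      using r'(5) f x ed module_homsD(1)[OF f(1)] dc by (simp add: a_kernel_iff)
    then show "\<exists>f. ?A 0 f" using f by blast
  next
    fix n f assume A: "?A n f"
    then have f: "f \<in> module_homs R (P n) (P' n)" by blast
    obtain f' where f': "f' \<in> module_homs R (P (Suc n)) (P' (Suc n))"
      "\<And>x. x \<in> carrier (P (Suc n)) \<Longrightarrow> d' n (f' x) = f (d n x)"
      by (rule projective_lift[OF r(1)[of "Suc n"] P'[of "Suc n"] P'[of n] r'(2)[of n]
            module_homs_comp[OF r(2)[of n] f]]) (use A in auto)
    have "f' (d (Suc n) x) \<in> d' (Suc n) ` carrier (P' (Suc (Suc n)))"
      if x: "x \<in> carrier (P (Suc (Suc n)))" for x
      using r'(6)[of n] f' x dd dc module_homsD(1)[OF f'(1)] module_homs_zero[OF f P P']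
      by (simp add: a_kernel_iff)
    then show "\<exists>f'. ?A (Suc n) f' \<and> ?B n f f'" using f' by blast
  qed
  then obtain f where "\<forall>n. ?A n (f n) \<and> ?B n (f n) (f (Suc n))" by blast
  then show thesis by (intro that[of f]) auto
qed

text \<open>A chain endomorphism covering zero is null homotopic. The homotopy identity is exported
  in positive degrees, the ones in which Ext is compared.\<close>

lemma null_homotopy:
  assumes M: "left_module R M" and res: "projective_resolution R M P d e"
    and k: "\<And>i. k i \<in> module_homs R (P i) (P i)"
    and kd: "\<And>i x. x \<in> carrier (P (Suc i)) \<Longrightarrow> d i (k (Suc i) x) = k i (d i x)"
    and ek: "\<And>x. x \<in> carrier (P 0) \<Longrightarrow> e (k 0 x) = \<zero>\<^bsub>M\<^esub>"
  obtains h where "\<And>i. h i \<in> module_homs R (P i) (P (Suc i))"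
    "\<And>i x. x \<in> carrier (P (Suc i)) \<Longrightarrow> k (Suc i) x = d (Suc i) (h (Suc i) x) \<oplus>\<^bsub>P (Suc i)\<^esub> h i (d i x)"
proof -
  note r = projective_resolutionD[OF res]
  have P: "left_module R (P i)" for i using r(1)[of i] by (simp add: projective_module_def)
  note dc = module_homsD(1)[OF r(2)] and kc = module_homsD(1)[OF k]
  have dd: "d i (d (Suc i) x) = \<zero>\<^bsub>P i\<^esub>" if "x \<in> carrier (P (Suc (Suc i)))" for i x
    using r(6)[of i] that a_kernel_iff[of "d (Suc i) x" "P (Suc i)" "P i" "d i"] by blast
  \<comment> \<open>The clause d h d = k d says that k - h d, one degree up, is killed by d; by
    exactness it then has image inside the next boundaries and can be lifted.\<close>
  let ?A = "\<lambda>n h. h \<in> module_homs R (P n) (P (Suc n)) \<and>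
      (\<forall>x\<in>carrier (P (Suc n)). d n (h (d n x)) = k n (d n x))"
  let ?B = "\<lambda>n h h'. \<forall>x\<in>carrier (P (Suc n)). k (Suc n) x = d (Suc n) (h' x) \<oplus>\<^bsub>P (Suc n)\<^esub> h (d n x)"
  have "\<exists>h. \<forall>n. ?A n (h n) \<and> ?B n (h n) (h (Suc n))"
  proof (rule dependent_nat_choice)
    obtain h where h: "h \<in> module_homs R (P 0) (P (Suc 0))" "\<And>x. x \<in> carrier (P 0) \<Longrightarrow> d 0 (h x) = k 0 x"
      by (rule projective_lift[OF r(1)[of 0] P[of "Suc 0"] P[of 0] r(2)[of 0] k[of 0]])
         (use r(5) ek kc in \<open>auto simp: a_kernel_iff\<close>)
    then show "\<exists>h. ?A 0 h" using dc by blast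
  next
    fix n h assume A: "?A n h"
    then have h: "h \<in> module_homs R (P n) (P (Suc n))"
      and dh: "\<And>x. x \<in> carrier (P (Suc n)) \<Longrightarrow> d n (h (d n x)) = k n (d n x)" by auto
    interpret P1: left_module R "P (Suc n)" by (rule P)
    interpret P0: left_module R "P n" by (rule P)
    note hc = module_homsD(1)[OF h]
    let ?k = "\<lambda>x. k (Suc n) x \<ominus>\<^bsub>P (Suc n)\<^esub> h (d n x)"
    have k': "?k \<in> module_homs R (P (Suc n)) (P (Suc n))"
      by (rule module_homs_diff[OF k module_homs_comp[OF r(2) h] P P])
    have im: "?k x \<in> d (Suc n) ` carrier (P (Suc (Suc n)))" if x: "x \<in> carrier (P (Suc n))" for x
    proof -
      have "d n (?k x) = \<zero>\<^bsub>P n\<^esub>"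
        using x by (simp add: module_homs_minus[OF r(2) P P] kc hc dc kd dh) (simp add: a_minus_def kc dc P0.M.r_neg)
      then show ?thesis using r(6)[of n] module_homsD(1)[OF k' x] by (simp add: a_kernel_iff)
    qed
    obtain h' where h': "h' \<in> module_homs R (P (Suc n)) (P (Suc (Suc n)))"
      "\<And>x. x \<in> carrier (P (Suc n)) \<Longrightarrow> d (Suc n) (h' x) = ?k x"
      by (rule projective_lift[OF r(1)[of "Suc n"] P[of "Suc (Suc n)"] P[of "Suc n"] r(2)[of "Suc n"] k'])
         (use im in auto)
    have "k (Suc n) x = d (Suc n) (h' x) \<oplus>\<^bsub>P (Suc n)\<^esub> h (d n x)" if x: "x \<in> carrier (P (Suc n))" for x
      using x by (simp add: h'(2) a_minus_def kc hc dc P1.M.a_assoc P1.M.l_neg)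
    moreover have "d (Suc n) (h' (d (Suc n) x)) = k (Suc n) (d (Suc n) x)"
      if x: "x \<in> carrier (P (Suc (Suc n)))" for x
      using x by (simp add: h'(2) dc dd module_homs_zero[OF h P P]) (simp add: a_minus_def kc dc)
    ultimately show "\<exists>h'. ?A (Suc n) h' \<and> ?B n h h'" using h'(1) by blast
  qed
  then obtain h where "\<forall>n. ?A n (h n) \<and> ?B n (h n) (h (Suc n))" by blast
  then show thesis by (intro that[of h]) auto
qed

text \<open>With comparison maps f and g in both directions, k = 1 - f g covers zero, so k = d' h +
  h d'. For a cocycle \<phi> on P' the composite \<phi> f is a cocycle on P, hence of the form
  \<psi> d. Therefore \<phi> = \<phi> f g + \<phi> k = (\<psi> g + \<phi> h) d'.\<close>

lemma hom_exact_resolution_transfer: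
  assumes M: "left_module R M" and N: "left_module R N"
    and res: "projective_resolution R M P d e" and res': "projective_resolution R M P' d' e'"
    and ex: "hom_exact R (P (Suc (Suc j))) (d (Suc j)) (P (Suc j)) (d j) (P j) N"
  shows "hom_exact R (P' (Suc (Suc j))) (d' (Suc j)) (P' (Suc j)) (d' j) (P' j) N"
proof (rule hom_exactI)
  fix \<phi> assume \<phi>: "\<phi> \<in> module_homs R (P' (Suc j)) N"
    and \<phi>d: "\<And>x. x \<in> carrier (P' (Suc (Suc j))) \<Longrightarrow> \<phi> (d' (Suc j) x) = \<zero>\<^bsub>N\<^esub>"
  note r = projective_resolutionD[OF res] and r' = projective_resolutionD[OF res']
  have P: "left_module R (P i)" for i using r(1)[of i] by (simp add: projective_module_def)
  have P': "left_module R (P' i)" for i using r'(1)[of i] by (simp add: projective_module_def)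
  interpret N: left_module R N by fact
  interpret M: left_module R M by fact
  obtain f where f: "\<And>i. f i \<in> module_homs R (P i) (P' i)"
    "\<And>i x. x \<in> carrier (P (Suc i)) \<Longrightarrow> d' i (f (Suc i) x) = f i (d i x)"
    "\<And>x. x \<in> carrier (P 0) \<Longrightarrow> e' (f 0 x) = e x"
    by (rule comparison_map[OF M res res'], rule that)
  obtain g where g: "\<And>i. g i \<in> module_homs R (P' i) (P i)"
    "\<And>i x. x \<in> carrier (P' (Suc i)) \<Longrightarrow> d i (g (Suc i) x) = g i (d' i x)"
    "\<And>x. x \<in> carrier (P' 0) \<Longrightarrow> e (g 0 x) = e' x"
    by (rule comparison_map[OF M res' res], rule that)
  note cl = module_homsD(1)[OF f(1)] module_homsD(1)[OF g(1)] module_homsD(1)[OF r(2)]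
    module_homsD(1)[OF r'(2)] module_homsD(1)[OF r'(3)] module_homsD(1)[OF \<phi>]
  define k where "k i x = x \<ominus>\<^bsub>P' i\<^esub> f i (g i x)" for i x
  have k: "k i \<in> module_homs R (P' i) (P' i)" for i
    unfolding k_def
    by (rule module_homs_diff[OF module_homs_id module_homs_comp[OF g(1) f(1)] P' P'])
  have kd: "d' i (k (Suc i) x) = k i (d' i x)" if "x \<in> carrier (P' (Suc i))" for i x
    using that by (simp add: k_def module_homs_minus[OF r'(2) P' P'] cl f(2) g(2))
  have ek: "e' (k 0 x) = \<zero>\<^bsub>M\<^esub>" if "x \<in> carrier (P' 0)" for x
    using that by (simp add: k_def module_homs_minus[OF r'(3) P' M] cl f(3) g(3))
      (simp add: a_minus_def cl M.M.r_neg)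
  obtain h where h: "\<And>i. h i \<in> module_homs R (P' i) (P' (Suc i))"
    "\<And>i x. x \<in> carrier (P' (Suc i)) \<Longrightarrow>
      k (Suc i) x = d' (Suc i) (h (Suc i) x) \<oplus>\<^bsub>P' (Suc i)\<^esub> h i (d' i x)"
    by (rule null_homotopy[OF M res' k kd ek], assumption, assumption, rule that)
  note hc = module_homsD(1)[OF h(1)]
  have "\<phi> (f (Suc j) (d (Suc j) x)) = \<zero>\<^bsub>N\<^esub>" if "x \<in> carrier (P (Suc (Suc j)))" for x
    using that \<phi>d f(2)[of x "Suc j"] by (metis cl(1))
  from hom_exactD[OF ex module_homs_comp[OF f(1) \<phi>] this]
  obtain \<psi> where \<psi>: "\<psi> \<in> module_homs R (P j) N"
    "\<And>y. y \<in> carrier (P (Suc j)) \<Longrightarrow> \<phi> (f (Suc j) y) = \<psi> (d j y)" by blast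
  let ?\<psi> = "\<lambda>x. \<psi> (g j x) \<oplus>\<^bsub>N\<^esub> \<phi> (h j x)"
  have "?\<psi> \<in> module_homs R (P' j) N"
    by (rule module_homs_add[OF module_homs_comp[OF g(1) \<psi>(1)] module_homs_comp[OF h(1) \<phi>] P' N])
  moreover have "\<phi> x = ?\<psi> (d' j x)" if x: "x \<in> carrier (P' (Suc j))" for x
  proof -
    interpret P1: left_module R "P' (Suc j)" by (rule P')
    have "x = f (Suc j) (g (Suc j) x) \<oplus>\<^bsub>P' (Suc j)\<^esub> k (Suc j) x"
      using x by (simp add: k_def a_minus_def cl P1.M.a_lcomm[of "f (Suc j) (g (Suc j) x)"] P1.M.r_neg)
    then have "\<phi> x = \<phi> (f (Suc j) (g (Suc j) x) \<oplus>\<^bsub>P' (Suc j)\<^esub> k (Suc j) x)" by simp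
    also have "\<dots> = \<phi> (f (Suc j) (g (Suc j) x)) \<oplus>\<^bsub>N\<^esub>
        (\<phi> (d' (Suc j) (h (Suc j) x)) \<oplus>\<^bsub>N\<^esub> \<phi> (h j (d' j x)))"
      using x by (simp add: h(2) module_homsD(2)[OF \<phi>] cl hc)
    also have "\<dots> = ?\<psi> (d' j x)"
      using x by (simp add: \<psi>(2) g(2) \<phi>d cl hc)
    finally show ?thesis .
  qed
  ultimately show "\<exists>\<psi>\<in>module_homs R (P' j) N. \<forall>y\<in>carrier (P' (Suc j)). \<phi> y = \<psi> (d' j y)"
    by (intro bexI[of _ ?\<psi>]) auto
qed

section \<open>Transport of resolutions along isomorphisms\<close>

lemma exact_iso:
  assumes ex: "f ` carrier M = a_kernel N K g"
    and g: "g \<in> module_homs R N K" and K: "left_module R K" and K': "left_module R K'"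
    and a: "inverse_homs R M M' \<alpha> \<alpha>'" and b: "inverse_homs R N N' \<beta> \<beta>'" and c: "inverse_homs R K K' \<gamma> \<gamma>'"
  shows "(\<lambda>x. \<beta> (f (\<alpha>' x))) ` carrier M' = a_kernel N' K' (\<lambda>y. \<gamma> (g (\<beta>' y)))"
proof -
  note A = inverse_homsD[OF a] and B = inverse_homsD[OF b] and C = inverse_homsD[OF c]
  note cl = module_homsD(1)[OF A(1)] module_homsD(1)[OF A(2)] module_homsD(1)[OF B(1)]
    module_homsD(1)[OF B(2)]
  have fN: "f x \<in> carrier N" "g (f x) = \<zero>\<^bsub>K\<^esub>" if "x \<in> carrier M" for x
  proof -
    have "f x \<in> a_kernel N K g" using ex that by blast
    then show "f x \<in> carrier N" "g (f x) = \<zero>\<^bsub>K\<^esub>" by (auto simp: a_kernel_iff)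
  qed
  show ?thesis
  proof (intro equalityI subsetI)
    fix y assume "y \<in> (\<lambda>x. \<beta> (f (\<alpha>' x))) ` carrier M'"
    then show "y \<in> a_kernel N' K' (\<lambda>y. \<gamma> (g (\<beta>' y)))"
      by (auto simp: a_kernel_iff fN cl B(3) module_homs_zero[OF C(1) K K'])
  next
    fix y assume y: "y \<in> a_kernel N' K' (\<lambda>y. \<gamma> (g (\<beta>' y)))"
    then have yN: "y \<in> carrier N'" "\<gamma> (g (\<beta>' y)) = \<zero>\<^bsub>K'\<^esub>" by (auto simp: a_kernel_iff)
    then have "g (\<beta>' y) = \<zero>\<^bsub>K\<^esub>"
      using C(3)[of "g (\<beta>' y)"] cl module_homsD(1)[OF g] module_homs_zero[OF C(2) K' K] by simp
    then have "\<beta>' y \<in> f ` carrier M" unfolding ex using yN cl by (simp add: a_kernel_iff)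
    then obtain x where x: "x \<in> carrier M" "\<beta>' y = f x" by blast
    then have "y = \<beta> (f (\<alpha>' (\<alpha> x)))" using B(4)[OF yN(1)] by (simp add: A(3))
    then show "y \<in> (\<lambda>x. \<beta> (f (\<alpha>' x))) ` carrier M'" using cl x by blast
  qed
qed

lemma hom_exact_iso:
  assumes ex: "hom_exact R M f N g K T" and f: "f \<in> module_homs R M N"
    and a: "inverse_homs R M M' \<alpha> \<alpha>'" and b: "inverse_homs R N N' \<beta> \<beta>'" and c: "inverse_homs R K K' \<gamma> \<gamma>'"
    and g: "g \<in> module_homs R N K"
  shows "hom_exact R M' (\<lambda>x. \<beta> (f (\<alpha>' x))) N' (\<lambda>y. \<gamma> (g (\<beta>' y))) K' T"
proof (rule hom_exactI)
  note A = inverse_homsD[OF a] and B = inverse_homsD[OF b] and C = inverse_homsD[OF c]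
  note cl = module_homsD(1)[OF A(1)] module_homsD(1)[OF A(2)] module_homsD(1)[OF B(1)]
    module_homsD(1)[OF B(2)]
  fix \<phi> assume \<phi>: "\<phi> \<in> module_homs R N' T" and z: "\<And>x. x \<in> carrier M' \<Longrightarrow> \<phi> (\<beta> (f (\<alpha>' x))) = \<zero>\<^bsub>T\<^esub>"
  have "\<phi> (\<beta> (f x)) = \<zero>\<^bsub>T\<^esub>" if "x \<in> carrier M" for x
    using z[of "\<alpha> x"] that cl by (simp add: A(3))
  from hom_exactD[OF ex module_homs_comp[OF B(1) \<phi>] this]
  obtain \<psi> where \<psi>: "\<psi> \<in> module_homs R K T" "\<And>y. y \<in> carrier N \<Longrightarrow> \<phi> (\<beta> y) = \<psi> (g y)" by blast
  have "\<phi> y = \<psi> (\<gamma>' (\<gamma> (g (\<beta>' y))))" if y: "y \<in> carrier N'" for y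
    using \<psi>(2)[of "\<beta>' y"] y by (simp add: cl B(4) C(3) module_homsD(1)[OF g])
  then show "\<exists>\<psi>\<in>module_homs R K' T. \<forall>y\<in>carrier N'. \<phi> y = \<psi> (\<gamma> (g (\<beta>' y)))"
    using module_homs_comp[OF C(2) \<psi>(1)] by (intro bexI[of _ "\<lambda>x. \<psi> (\<gamma>' x)"]) auto
qed

lemma inverse_homs_id: "inverse_homs R M M (\<lambda>x. x) (\<lambda>x. x)"
  by (simp add: inverse_homs_def module_homs_id)

text \<open>Finitely generated projective is recorded as membership in add of the regular module, a
  condition that the lemmas on \<open>in_add\<close> carry through biproducts, isomorphisms and
  changes of ring.\<close>

definition fg_resolution ::
    "('r, 'a) ring_scheme \<Rightarrow> ('r, 'm, 'b) module_scheme \<Rightarrow> (nat \<Rightarrow> ('r, 'p) module)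
      \<Rightarrow> (nat \<Rightarrow> 'p \<Rightarrow> 'p) \<Rightarrow> ('p \<Rightarrow> 'm) \<Rightarrow> bool" where
  "fg_resolution R M P d e \<longleftrightarrow> projective_resolution R M P d e \<and>
    (\<forall>i. in_add R (regular_module R) (P i))"

lemma fg_resolutionI:
  assumes "ring R" "\<And>i. in_add R (regular_module R) (P i)"
    "\<And>i. d i \<in> module_homs R (P (Suc i)) (P i)"
    "e \<in> module_homs R (P 0) M" "e ` carrier (P 0) = carrier M"
    "d 0 ` carrier (P (Suc 0)) = a_kernel (P 0) M e"
    "\<And>i. d (Suc i) ` carrier (P (Suc (Suc i))) = a_kernel (P (Suc i)) (P i) (d i)"
  shows "fg_resolution R M P d e"
  using assms in_add_imp_fg_projective[OF assms(1,2)]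
  by (auto simp: fg_resolution_def projective_resolution_def fg_projective_module_def)

lemma fg_resolutionD:
  assumes "fg_resolution R M P d e"
  shows "projective_resolution R M P d e" "\<And>i. in_add R (regular_module R) (P i)"
    "\<And>i. left_module R (P i)"
  using assms by (auto simp: fg_resolution_def in_add_def)

text \<open>Each term is replaced on its own by an isomorphic copy, and the differentials are
  conjugated by these isomorphisms.\<close>

lemma fg_resolution_transport:
  fixes P :: "nat \<Rightarrow> ('r, 'p) module" and R :: "('r, 'x) ring_scheme"
  assumes M: "left_module R M" and fg: "fg_resolution R M P d e" and inf: "infinite (UNIV :: 'i set)"
  obtains P' :: "nat \<Rightarrow> ('r, 'i \<Rightarrow> 'r) module" and d' e' where "fg_resolution R M P' d' e'"
proof -
  have R: "ring R" using M by (rule ring_left_module)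
  note Rm = left_module_regular[OF R]
  note f = fg_resolutionD[OF fg]
  note r = projective_resolutionD[OF f(1)]
  have "\<exists>(Q :: ('r, 'i \<Rightarrow> 'r) module) a b. left_module R Q \<and> inverse_homs R (P i) Q a b" for i
    using in_add_transport[OF Rm f(2)[of i] inf] by metis
  then obtain P' :: "nat \<Rightarrow> ('r, 'i \<Rightarrow> 'r) module" and a b
    where P': "\<And>i. left_module R (P' i)" and ab: "\<And>i. inverse_homs R (P i) (P' i) (a i) (b i)"
    by metis
  note i = inverse_homsD[OF ab]
  let ?d = "\<lambda>i x. a i (d i (b (Suc i) x))" and ?e = "\<lambda>x. e (b 0 x)"
  have "fg_resolution R M P' ?d ?e"
  proof (rule fg_resolutionI[OF R])
    show "in_add R (regular_module R) (P' i)" for i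
      by (rule in_add_iso[OF Rm f(2) P' ab])
    show "?d i \<in> module_homs R (P' (Suc i)) (P' i)" for i
      by (intro module_homs_comp[OF _ i(1)] module_homs_comp[OF i(2) r(2)])
    show "?e \<in> module_homs R (P' 0) M" by (rule module_homs_comp[OF i(2) r(3)])
    have "b 0 ` carrier (P' 0) = carrier (P 0)"
      using module_homsD(1)[OF i(1)] module_homsD(1)[OF i(2)] i(3) by force
    then show "?e ` carrier (P' 0) = carrier M" using r(4) by (metis image_image)
    show "?d 0 ` carrier (P' (Suc 0)) = a_kernel (P' 0) M ?e"
      using exact_iso[OF r(5) r(3) M M ab ab inverse_homs_id] by simp
    show "?d (Suc i) ` carrier (P' (Suc (Suc i))) = a_kernel (P' (Suc i)) (P' i) (?d i)" for i
      by (rule exact_iso[OF r(6)[of i] r(2) f(3) P' ab ab ab])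
  qed
  then show thesis by (rule that)
qed

text \<open>The \<open>SOME\<close> in \<open>chosen_resolution\<close> yields a resolution only if
  one exists on functions of lists. The given one, transported to that type, is the witness;
  independence of the resolution then moves the exactness condition from the chosen resolution to
  the given one.\<close>

lemma trivial_Ext_iff_hom_exact:
  fixes M :: "('r, 'm, 'z) module_scheme"
  assumes M: "left_module R M" and N: "left_module R N" and fg: "fg_resolution R M P d e"
  shows "(\<forall>i>0. trivial_group (Ext R i M N)) \<longleftrightarrow>
    (\<forall>j. hom_exact R (P (Suc (Suc j))) (d (Suc j)) (P (Suc j)) (d j) (P j) N)"
proof -
  note res = fg_resolutionD(1)[OF fg]
  obtain Q :: "nat \<Rightarrow> ('r, ('m \<times> 'r) list \<Rightarrow> 'r) module" and c a where Q: "fg_resolution R M Q c a"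
    by (rule fg_resolution_transport[OF M fg infinite_UNIV_listI])
  obtain P' :: "nat \<Rightarrow> ('r, ('m \<times> 'r) list \<Rightarrow> 'r) module" and d' e'
    where ch: "chosen_resolution R M = (P', d', e')"
    by (metis prod_cases3)
  have "\<exists>t. case t of (P :: nat \<Rightarrow> ('r, ('m \<times> 'r) list \<Rightarrow> 'r) module, d, e) \<Rightarrow> projective_resolution R M P d e"
    using fg_resolutionD(1)[OF Q] by (intro exI[of _ "(Q, c, a)"]) simp
  from someI_ex[OF this] have res': "projective_resolution R M P' d' e'"
    using ch unfolding chosen_resolution_def by simp
  have "(\<forall>i>0. trivial_group (Ext R i M N)) \<longleftrightarrow> (\<forall>j. trivial_group (Ext R (Suc j) M N))"
    by (metis gr0_implies_Suc zero_less_Suc)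
  also have "\<dots> \<longleftrightarrow> (\<forall>j. hom_exact R (P (Suc (Suc j))) (d (Suc j)) (P (Suc j)) (d j) (P j) N)"
    using trivial_Ext_iff[OF N res' ch] hom_exact_resolution_transfer[OF M N res res']
      hom_exact_resolution_transfer[OF M N res' res] by blast
  finally show ?thesis .
qed

section \<open>Wakamatsu tilting modules\<close>

text \<open>Collects the third tilting condition. The first \<open>hom_exact\<close> clause has a
  zero map in front, so every homomorphism from \<open>R\<close> to \<open>T\<close> must extend
  along \<open>e\<close>: this is surjectivity of
  \<open>Hom(C 0, T) \<rightarrow> Hom(R, T)\<close>.\<close>

definition add_coresolution ::
    "('r, 'a) ring_scheme \<Rightarrow> ('r, 't, 'c) module_scheme \<Rightarrow> (nat \<Rightarrow> ('r, 'p) module) \<Rightarrow> ('r \<Rightarrow> 'p)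
      \<Rightarrow> (nat \<Rightarrow> 'p \<Rightarrow> 'p) \<Rightarrow> bool" where
  "add_coresolution R T C e d \<longleftrightarrow>
    (\<forall>j. in_add R T (C j)) \<and> exact_coresolution R C e d \<and>
    hom_exact R (regular_module R) (\<lambda>_. \<zero>\<^bsub>R\<^esub>) (regular_module R) e (C 0) T \<and>
    hom_exact R (regular_module R) e (C 0) (d 0) (C (Suc 0)) T \<and>
    (\<forall>j. hom_exact R (C j) (d j) (C (Suc j)) (d (Suc j)) (C (Suc (Suc j))) T)"

lemma exact_coresolutionD:
  assumes "exact_coresolution R C e d"
  shows "e \<in> module_homs R (regular_module R) (C 0)" "\<And>j. d j \<in> module_homs R (C j) (C (Suc j))"
    "inj_on e (carrier R)" "e ` carrier R = a_kernel (C 0) (C (Suc 0)) (d 0)"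
    "\<And>j. d j ` carrier (C j) = a_kernel (C (Suc j)) (C (Suc (Suc j))) (d (Suc j))"
    "\<And>r. r \<in> carrier R \<Longrightarrow> d 0 (e r) = \<zero>\<^bsub>C (Suc 0)\<^esub>"
    "\<And>j x. x \<in> carrier (C j) \<Longrightarrow> d (Suc j) (d j x) = \<zero>\<^bsub>C (Suc (Suc j))\<^esub>"
proof -
  show 1: "e \<in> module_homs R (regular_module R) (C 0)" "\<And>j. d j \<in> module_homs R (C j) (C (Suc j))"
    "inj_on e (carrier R)" "e ` carrier R = a_kernel (C 0) (C (Suc 0)) (d 0)"
    "\<And>j. d j ` carrier (C j) = a_kernel (C (Suc j)) (C (Suc (Suc j))) (d (Suc j))"
    using assms by (auto simp: exact_coresolution_def)
  show "d 0 (e r) = \<zero>\<^bsub>C (Suc 0)\<^esub>" if "r \<in> carrier R" for r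
    using imageI[OF that, of e] unfolding 1(4) by (simp add: a_kernel_iff)
  show "d (Suc j) (d j x) = \<zero>\<^bsub>C (Suc (Suc j))\<^esub>" if "x \<in> carrier (C j)" for j x
    using imageI[OF that, of "d j"] unfolding 1(5) by (simp add: a_kernel_iff)
qed

lemma Hom_exact_coresolution_iff:
  assumes T: "left_module R T" and C: "\<And>j. left_module R (C j)" and ex: "exact_coresolution R C e d"
  shows "Hom_exact_coresolution R C e d T \<longleftrightarrow>
    hom_exact R (regular_module R) (\<lambda>_. \<zero>\<^bsub>R\<^esub>) (regular_module R) e (C 0) T \<and>
    hom_exact R (regular_module R) e (C 0) (d 0) (C (Suc 0)) T \<and>
    (\<forall>j. hom_exact R (C j) (d j) (C (Suc j)) (d (Suc j)) (C (Suc (Suc j))) T)"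
proof -
  note Rm = left_module_regular[OF ring_left_module[OF T]]
  note c = exact_coresolutionD[OF ex]
  have z: "(\<lambda>_. \<zero>\<^bsub>R\<^esub>) \<in> module_homs R (regular_module R) (regular_module R)"
    using module_homs_const_zero[OF Rm, of "regular_module R"] by simp
  have ez: "e \<zero>\<^bsub>R\<^esub> = \<zero>\<^bsub>C 0\<^esub>"
    using module_homs_zero[OF c(1) Rm C] by simp
  \<comment> \<open>The kernel of the pullback along the zero map is everything, so surjectivity
    becomes an instance of exactness.\<close>
  have "a_kernel (Hom R (regular_module R) T) (Hom R (regular_module R) T)
      (pullback (regular_module R) (\<lambda>_. \<zero>\<^bsub>R\<^esub>)) = carrier (Hom R (regular_module R) T)"
    using module_homs_zero[OF _ Rm T]
    by (auto simp: a_kernel_iff pullback_def compose_def intro!: restrict_ext)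
  then have 0: "pullback (regular_module R) e ` carrier (Hom R (C 0) T) = carrier (Hom R (regular_module R) T)
      \<longleftrightarrow> hom_exact R (regular_module R) (\<lambda>_. \<zero>\<^bsub>R\<^esub>) (regular_module R) e (C 0) T"
    using pullback_exact_iff(2)[OF Rm Rm C[of 0] T z c(1)] ez by simp
  have 1: "pullback (C 0) (d 0) ` carrier (Hom R (C 1) T)
      = a_kernel (Hom R (C 0) T) (Hom R (regular_module R) T) (pullback (regular_module R) e)
      \<longleftrightarrow> hom_exact R (regular_module R) e (C 0) (d 0) (C (Suc 0)) T"
    using pullback_exact_iff(2)[OF Rm C[of 0] C[of "Suc 0"] T c(1) c(2)[of 0]] c(6) by simp
  have 2: "pullback (C (Suc j)) (d (Suc j)) ` carrier (Hom R (C (Suc (Suc j))) T)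
      = a_kernel (Hom R (C (Suc j)) T) (Hom R (C j) T) (pullback (C j) (d j))
      \<longleftrightarrow> hom_exact R (C j) (d j) (C (Suc j)) (d (Suc j)) (C (Suc (Suc j))) T" for j
    by (rule pullback_exact_iff(2)[OF C[of j] C[of "Suc j"] C[of "Suc (Suc j)"] T c(2)[of j] c(2)[of "Suc j"]])
       (rule c(7))
  show ?thesis unfolding Hom_exact_coresolution_def 0 1 2 ..
qed

text \<open>Removes the chosen resolution: the vanishing of Ext is tested on the same finitely
  generated resolution whose existence is claimed.\<close>

lemma wakamatsu_tilting_iff:
  fixes R :: "('r, 'x) ring_scheme" and T :: "('r, 't, 'z) module_scheme"
  assumes T: "left_module R T"
  shows "wakamatsu_tilting R T \<longleftrightarrow>
    (\<exists>(P :: nat \<Rightarrow> ('r, nat \<Rightarrow> 'r) module) d e. fg_resolution R T P d e \<and>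
      (\<forall>j. hom_exact R (P (Suc (Suc j))) (d (Suc j)) (P (Suc j)) (d j) (P j) T)) \<and>
    (\<exists>(C :: nat \<Rightarrow> ('r, nat \<Rightarrow> 't) module) e d. add_coresolution R T C e d)"
proof -
  have R: "ring R" using T by (rule ring_left_module)
  have fg: "projective_resolution R T P d e \<and> (\<forall>i. fg_projective_module R (P i)) \<longleftrightarrow> fg_resolution R T P d e"
    for P :: "nat \<Rightarrow> ('r, nat \<Rightarrow> 'r) module" and d e
    using fg_projective_imp_in_add in_add_imp_fg_projective[OF R] unfolding fg_resolution_def by blast
  have co: "(\<forall>j. in_add R T (C j)) \<and> exact_coresolution R C e d \<and> Hom_exact_coresolution R C e d T
      \<longleftrightarrow> add_coresolution R T C e d" for C :: "nat \<Rightarrow> ('r, nat \<Rightarrow> 't) module" and e d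
    unfolding add_coresolution_def
    using Hom_exact_coresolution_iff[OF T, of C e d] in_add_left_module[of R T] by metis
  have ext: "(\<exists>(P :: nat \<Rightarrow> ('r, nat \<Rightarrow> 'r) module) d e. fg_resolution R T P d e) \<and>
      (\<forall>i>0. trivial_group (Ext R i T T)) \<longleftrightarrow>
    (\<exists>(P :: nat \<Rightarrow> ('r, nat \<Rightarrow> 'r) module) d e. fg_resolution R T P d e \<and>
      (\<forall>j. hom_exact R (P (Suc (Suc j))) (d (Suc j)) (P (Suc j)) (d j) (P j) T))"
    using trivial_Ext_iff_hom_exact[OF T T] by metis
  show ?thesis
    unfolding wakamatsu_tilting_def has_fg_projective_resolution_def fg co ext[symmetric] using T by blast
qed

lemma add_coresolution_transport:
  fixes R :: "('r, 'x) ring_scheme" and T :: "('r, 't, 'z) module_scheme" and C :: "nat \<Rightarrow> ('r, 'p) module"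
  assumes T: "left_module R T" and co: "add_coresolution R T C e d" and inf: "infinite (UNIV :: 'i set)"
  obtains C' :: "nat \<Rightarrow> ('r, 'i \<Rightarrow> 't) module" and e' d' where "add_coresolution R T C' e' d'"
proof -
  note Rm = left_module_regular[OF ring_left_module[OF T]]
  have add: "\<And>j. in_add R T (C j)" and ex: "exact_coresolution R C e d"
    and h0: "hom_exact R (regular_module R) (\<lambda>_. \<zero>\<^bsub>R\<^esub>) (regular_module R) e (C 0) T"
    and h1: "hom_exact R (regular_module R) e (C 0) (d 0) (C (Suc 0)) T"
    and h2: "\<And>j. hom_exact R (C j) (d j) (C (Suc j)) (d (Suc j)) (C (Suc (Suc j))) T"
    using co by (auto simp: add_coresolution_def)
  have C: "left_module R (C j)" for j using add by (rule in_add_left_module)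
  note c = exact_coresolutionD[OF ex]
  have "\<exists>(Q :: ('r, 'i \<Rightarrow> 't) module) a b. left_module R Q \<and> inverse_homs R (C j) Q a b" for j
    using in_add_transport[OF T add[of j] inf] by metis
  then obtain C' :: "nat \<Rightarrow> ('r, 'i \<Rightarrow> 't) module" and a b
    where C': "\<And>i. left_module R (C' i)" and ab: "\<And>i. inverse_homs R (C i) (C' i) (a i) (b i)"
    by metis
  note i = inverse_homsD[OF ab]
  let ?d = "\<lambda>j x. a (Suc j) (d j (b j x))" and ?e = "\<lambda>x. a 0 (e x)"
  have "exact_coresolution R C' ?e ?d"
    unfolding exact_coresolution_def
  proof (intro conjI allI)
    show "?e \<in> module_homs R (regular_module R) (C' 0)" by (rule module_homs_comp[OF c(1) i(1)])
    show "?d j \<in> module_homs R (C' j) (C' (Suc j))" for j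
      by (intro module_homs_comp[OF _ i(1)] module_homs_comp[OF i(2) c(2)])
    show "inj_on ?e (carrier R)"
    proof (rule inj_onI)
      fix x y assume xy: "x \<in> carrier R" "y \<in> carrier R" "a 0 (e x) = a 0 (e y)"
      have "e x \<in> carrier (C 0)" "e y \<in> carrier (C 0)" using module_homsD(1)[OF c(1)] xy by auto
      then have "e x = e y" using arg_cong[OF xy(3), of "b 0"] by (simp add: i(3))
      then show "x = y" using c(3) xy by (simp add: inj_on_eq_iff)
    qed
    have "e ` carrier (regular_module R) = a_kernel (C 0) (C (Suc 0)) (d 0)" using c(4) by simp
    from exact_iso[OF this c(2) C C' inverse_homs_id ab ab]
    show "?e ` carrier R = a_kernel (C' 0) (C' 1) (?d 0)" by simp
    show "?d j ` carrier (C' j) = a_kernel (C' (Suc j)) (C' (Suc (Suc j))) (?d (Suc j))" for j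
      by (rule exact_iso[OF c(5)[of j] c(2) C C' ab ab ab])
  qed
  moreover have "hom_exact R (regular_module R) (\<lambda>_. \<zero>\<^bsub>R\<^esub>) (regular_module R) ?e (C' 0) T"
  proof -
    have z: "(\<lambda>_. \<zero>\<^bsub>R\<^esub>) \<in> module_homs R (regular_module R) (regular_module R)"
      using module_homs_const_zero[OF Rm, of "regular_module R"] by simp
    from hom_exact_iso[OF h0 z inverse_homs_id inverse_homs_id ab c(1)] show ?thesis .
  qed
  moreover have "hom_exact R (regular_module R) ?e (C' 0) (?d 0) (C' (Suc 0)) T"
    by (rule hom_exact_iso[OF h1 c(1) inverse_homs_id ab ab c(2)])
  moreover have "hom_exact R (C' j) (?d j) (C' (Suc j)) (?d (Suc j)) (C' (Suc (Suc j))) T" for j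
    by (rule hom_exact_iso[OF h2[of j] c(2) ab ab ab c(2)])
  moreover have "in_add R T (C' j)" for j by (rule in_add_iso[OF T add C' ab])
  ultimately show thesis by (intro that[of C' ?e ?d]) (simp add: add_coresolution_def)
qed

text \<open>Resolution and coresolution may be built on whatever element types are
  convenient.\<close>

lemma wakamatsu_tiltingI:
  fixes R :: "('r, 'x) ring_scheme" and T :: "('r, 't, 'z) module_scheme"
  assumes T: "left_module R T" and fg: "fg_resolution R T P d e"
    and ex: "\<And>j. hom_exact R (P (Suc (Suc j))) (d (Suc j)) (P (Suc j)) (d j) (P j) T"
    and co: "add_coresolution R T C e' d'"
  shows "wakamatsu_tilting R T"
proof -
  obtain P' :: "nat \<Rightarrow> ('r, nat \<Rightarrow> 'r) module" and c a where P': "fg_resolution R T P' c a"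
    by (rule fg_resolution_transport[OF T fg infinite_UNIV_nat])
  have "\<forall>j. hom_exact R (P' (Suc (Suc j))) (c (Suc j)) (P' (Suc j)) (c j) (P' j) T"
    using hom_exact_resolution_transfer[OF T T fg_resolutionD(1)[OF fg] fg_resolutionD(1)[OF P'] ex] by blast
  moreover obtain C' :: "nat \<Rightarrow> ('r, nat \<Rightarrow> 't) module" and a' c' where "add_coresolution R T C' a' c'"
    by (rule add_coresolution_transport[OF T co infinite_UNIV_nat])
  ultimately show ?thesis unfolding wakamatsu_tilting_iff[OF T] using P' by blast
qed

section \<open>Resolutions and coresolutions of retracts\<close>

text \<open>The components \<open>v i\<close> of a map into \<open>Q\<close> are maps into
  \<open>T\<close>; each is factored separately and the factors are reassembled with the maps
  \<open>u i\<close>.\<close>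

lemma hom_exact_in_add:
  assumes T: "left_module R T" and N: "left_module R N" and K: "left_module R K"
    and ex: "hom_exact R M f N g K T" and Q: "in_add R T Q"
    and f: "\<And>x. x \<in> carrier M \<Longrightarrow> f x \<in> carrier N" and g: "g \<in> module_homs R N K"
  shows "hom_exact R M f N g K Q"
proof (rule hom_exactI)
  fix \<phi> assume \<phi>: "\<phi> \<in> module_homs R N Q" and z: "\<And>x. x \<in> carrier M \<Longrightarrow> \<phi> (f x) = \<zero>\<^bsub>Q\<^esub>"
  obtain n :: nat and u v where Qm: "left_module R Q" and dec: "add_decomposition R T Q {..<n} u v"
    by (rule in_addE[OF Q T])
  interpret Q: left_module R Q by (rule Qm)
  note a = add_decompositionD[OF dec]
  have "\<exists>\<psi>\<in>module_homs R K T. \<forall>y\<in>carrier N. v i (\<phi> y) = \<psi> (g y)" if "i \<in> {..<n}" for i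
    by (rule hom_exactD[OF ex module_homs_comp[OF \<phi> a(3)[OF that]]])
       (simp add: z module_homs_zero[OF a(3)[OF that] Qm T])
  then obtain \<psi> where \<psi>: "\<And>i. i \<in> {..<n} \<Longrightarrow> \<psi> i \<in> module_homs R K T"
    "\<And>i y. i \<in> {..<n} \<Longrightarrow> y \<in> carrier N \<Longrightarrow> v i (\<phi> y) = \<psi> i (g y)" by metis
  have "(\<lambda>x. finsum Q (\<lambda>i. u i (\<psi> i x)) {..<n}) \<in> module_homs R K Q"
    by (rule module_homs_sum[OF K Qm]) (rule module_homs_comp[OF \<psi>(1) a(2)])
  moreover have "\<phi> y = finsum Q (\<lambda>i. u i (\<psi> i (g y))) {..<n}" if y: "y \<in> carrier N" for y
  proof -
    have "\<phi> y = finsum Q (\<lambda>i. u i (v i (\<phi> y))) {..<n}"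
      using a(4) module_homsD(1)[OF \<phi> y] by simp
    also have "\<dots> = finsum Q (\<lambda>i. u i (\<psi> i (g y))) {..<n}"
      using y by (intro Q.M.finsum_cong') (simp_all add: \<psi> module_homsD(1)[OF a(2)] module_homsD(1)[OF \<psi>(1)] module_homsD(1)[OF g])
    finally show ?thesis .
  qed
  ultimately show "\<exists>\<psi>\<in>module_homs R K Q. \<forall>y\<in>carrier N. \<phi> y = \<psi> (g y)"
    by (intro bexI[of _ "\<lambda>x. finsum Q (\<lambda>i. u i (\<psi> i x)) {..<n}"]) auto
qed

text \<open>The map induced by \<open>g\<close> on the image of \<open>p\<close>, pulled back along
  \<open>f\<close>. It is well defined since \<open>g\<close> kills the kernel of \<open>p\<close>,
  and it takes the place of a map out of a quotient module.\<close>

lemma module_homs_factor: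
  assumes D: "left_module R D" and C: "left_module R C" and B: "left_module R B" and Q: "left_module R Q"
    and p: "p \<in> module_homs R D C" and f: "f \<in> module_homs R B C" and g: "g \<in> module_homs R D Q"
    and im: "\<And>b. b \<in> carrier B \<Longrightarrow> f b \<in> p ` carrier D"
    and ker: "\<And>x. x \<in> carrier D \<Longrightarrow> p x = \<zero>\<^bsub>C\<^esub> \<Longrightarrow> g x = \<zero>\<^bsub>Q\<^esub>"
  obtains k where "k \<in> module_homs R B Q"
    "\<And>b x. b \<in> carrier B \<Longrightarrow> x \<in> carrier D \<Longrightarrow> p x = f b \<Longrightarrow> k b = g x"
proof -
  interpret D: left_module R D by fact
  interpret C: left_module R C by fact
  interpret B: left_module R B by fact
  interpret Q: left_module R Q by fact
  note pD = module_homsD[OF p] and fD = module_homsD[OF f] and gD = module_homsD[OF g]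
  have wd: "g x = g y" if "x \<in> carrier D" "y \<in> carrier D" "p x = p y" for x y
  proof -
    have "p (x \<ominus>\<^bsub>D\<^esub> y) = \<zero>\<^bsub>C\<^esub>"
      using that by (simp add: module_homs_minus[OF p D C]) (simp add: a_minus_def C.M.r_neg pD)
    then have "g (x \<ominus>\<^bsub>D\<^esub> y) = \<zero>\<^bsub>Q\<^esub>" using ker that by simp
    then have "g x \<ominus>\<^bsub>Q\<^esub> g y = \<zero>\<^bsub>Q\<^esub>" using that by (simp add: module_homs_minus[OF g D Q])
    then show ?thesis
      using Q.M.add.inv_solve_right[of "\<zero>\<^bsub>Q\<^esub>" "g x" "g y"] that gD(1) by (simp add: a_minus_def)
  qed
  define c where "c b = (SOME x. x \<in> carrier D \<and> p x = f b)" for b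
  have c: "c b \<in> carrier D \<and> p (c b) = f b" if "b \<in> carrier B" for b
    unfolding c_def by (rule someI_ex) (use im[OF that] in auto)
  have "(\<lambda>b. g (c b)) \<in> module_homs R B Q"
  proof (rule module_homsI)
    fix a b assume ab: "a \<in> carrier B" "b \<in> carrier B"
    have "g (c (a \<oplus>\<^bsub>B\<^esub> b)) = g (c a \<oplus>\<^bsub>D\<^esub> c b)"
      using ab c by (intro wd) (simp_all add: pD fD)
    then show "g (c (a \<oplus>\<^bsub>B\<^esub> b)) = g (c a) \<oplus>\<^bsub>Q\<^esub> g (c b)" using ab c by (simp add: gD)
  next
    fix r b assume rb: "r \<in> carrier R" "b \<in> carrier B"
    have "g (c (r \<odot>\<^bsub>B\<^esub> b)) = g (r \<odot>\<^bsub>D\<^esub> c b)"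
      using rb c by (intro wd) (simp_all add: pD fD B.smult_closed D.smult_closed)
    then show "g (c (r \<odot>\<^bsub>B\<^esub> b)) = r \<odot>\<^bsub>Q\<^esub> g (c b)" using rb c by (simp add: gD)
  qed (use c gD in auto)
  then show thesis by (rule that) (use c wd in metis)
qed

text \<open>With L the image of \<open>q\<close>, the map x to (\<beta> x, x) embeds the syzygy
  \<open>K\<close> into the sum of L and \<open>D\<close>, and (l, x) to l + x - \<beta> x is a
  retraction. This needs only that \<beta> maps \<open>K\<close> into L and that 1 - \<beta> maps
  \<open>D\<close> into \<open>K\<close>, which is what the recursion preserves. Covering L by
  \<open>P (Suc n)\<close> gives the next term.\<close>

lemma fg_resolution_retract:
  fixes R :: "('r, 'x) ring_scheme" and P :: "nat \<Rightarrow> ('r, 'p) module"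
  assumes T: "left_module R T" and U: "left_module R U"
    and s: "s \<in> module_homs R T U" and p: "p \<in> module_homs R U T"
    and ps: "\<And>t. t \<in> carrier T \<Longrightarrow> p (s t) = t"
    and fg: "fg_resolution R U P d e"
  obtains P' :: "nat \<Rightarrow> ('r, nat \<Rightarrow> 'r) module" and d' e' where "fg_resolution R T P' d' e'"
proof -
  \<comment> \<open>The given resolution is moved first, so that every stage of the recursion has
    one and the same type.\<close>
  obtain P :: "nat \<Rightarrow> ('r, nat \<Rightarrow> 'r) module" and d e where fg: "fg_resolution R U P d e"
    by (rule fg_resolution_transport[OF U fg infinite_UNIV_nat])
  have R: "ring R" using T by (rule ring_left_module)
  note Rm = left_module_regular[OF R]
  note f = fg_resolutionD[OF fg]
  note r = projective_resolutionD[OF f(1)] and P = f(3)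
  note dc = module_homsD(1)[OF r(2)]
  \<comment> \<open>\<open>K\<close> is the \<open>n\<close>-th syzygy of \<open>T\<close>. Modulo \<open>q(P (n + 1))\<close>, \<open>\<beta>\<close> splits the projection
    \<open>D / q(P (n + 1)) \<rightarrow> D / K\<close>. The next term is \<open>D' = P (n + 1) \<oplus> D\<close> with
    \<open>\<delta>(z, x) = q z + x - \<beta> x\<close>, and \<open>\<beta>'(w) = (l w, \<delta> w)\<close> where \<open>q l = \<beta> \<delta>\<close>.\<close>
  let ?A = "\<lambda>n (D :: ('r, nat \<Rightarrow> 'r) module, K, \<beta>, q, \<delta> :: (nat \<Rightarrow> 'r) \<Rightarrow> nat \<Rightarrow> 'r).
    in_add R (regular_module R) D \<and> submodule K R D \<and> \<beta> \<in> module_homs R D D \<and>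
    q \<in> module_homs R (P (Suc n)) D \<and> (\<forall>z\<in>carrier (P (Suc n)). q z \<in> K) \<and>
    (\<forall>z\<in>carrier (P (Suc n)). q z = \<zero>\<^bsub>D\<^esub> \<longleftrightarrow> z \<in> d (Suc n) ` carrier (P (Suc (Suc n)))) \<and>
    (\<forall>x\<in>K. \<beta> x \<in> q ` carrier (P (Suc n))) \<and> (\<forall>x\<in>carrier D. x \<ominus>\<^bsub>D\<^esub> \<beta> x \<in> K) \<and>
    (n = 0 \<longrightarrow> D = P 0 \<and> K = a_kernel (P 0) T (\<lambda>x. p (e x)))"
  let ?B = "\<lambda>(n::nat) (D :: ('r, nat \<Rightarrow> 'r) module, K, \<beta> :: (nat \<Rightarrow> 'r) \<Rightarrow> nat \<Rightarrow> 'r, q :: (nat \<Rightarrow> 'r) \<Rightarrow> nat \<Rightarrow> 'r, \<delta> :: (nat \<Rightarrow> 'r) \<Rightarrow> nat \<Rightarrow> 'r)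
      (D' :: ('r, nat \<Rightarrow> 'r) module, K', \<beta>' :: (nat \<Rightarrow> 'r) \<Rightarrow> nat \<Rightarrow> 'r, q' :: (nat \<Rightarrow> 'r) \<Rightarrow> nat \<Rightarrow> 'r, \<delta>').
    \<delta>' \<in> module_homs R D' D \<and> \<delta>' ` carrier D' = K \<and> K' = a_kernel D' D \<delta>'"
  have "\<exists>S. \<forall>n. ?A n (S n) \<and> ?B n (S n) (S (Suc n))"
  proof (rule dependent_nat_choice)
    let ?K = "a_kernel (P 0) T (\<lambda>x. p (e x))"
    interpret P0: left_module R "P 0" by (rule P)
    interpret T: left_module R T by fact
    note ec = module_homsD(1)[OF r(3)] and pc = module_homsD(1)[OF p] and sc = module_homsD(1)[OF s]
    have pe: "(\<lambda>x. p (e x)) \<in> module_homs R (P 0) T" by (rule module_homs_comp[OF r(3) p])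
    \<comment> \<open>The idempotent \<open>s p\<close> of \<open>U\<close> is lifted along
      \<open>e\<close>; the lift need not be idempotent.\<close>
    obtain \<beta> where \<beta>: "\<beta> \<in> module_homs R (P 0) (P 0)" "\<And>x. x \<in> carrier (P 0) \<Longrightarrow> e (\<beta> x) = s (p (e x))"
      by (rule projective_lift[OF r(1)[of 0] P[of 0] U r(3) module_homs_comp[OF pe s]])
         (use r(4) ec pc sc in auto)
    note bc = module_homsD(1)[OF \<beta>(1)]
    have 1: "submodule ?K R (P 0)" by (rule submodule_kernel[OF P T pe])
    have ed: "e (d 0 z) = \<zero>\<^bsub>U\<^esub>" if "z \<in> carrier (P (Suc 0))" for z
      using r(5) that a_kernel_iff[of "d 0 z" "P 0" U e] by auto
    have 2: "d 0 z \<in> ?K" if "z \<in> carrier (P (Suc 0))" for z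
      using that ed module_homs_zero[OF p U T] dc by (simp add: a_kernel_iff)
    have 3: "d 0 z = \<zero>\<^bsub>P 0\<^esub> \<longleftrightarrow> z \<in> d (Suc 0) ` carrier (P (Suc (Suc 0)))" if "z \<in> carrier (P (Suc 0))" for z
      using r(6)[of 0] that by (simp add: a_kernel_iff)
    have 4: "\<beta> x \<in> d 0 ` carrier (P (Suc 0))" if "x \<in> ?K" for x
      using r(5) that \<beta>(2)[of x] bc module_homs_zero[OF s T U] by (simp add: a_kernel_iff)
    have 5: "x \<ominus>\<^bsub>P 0\<^esub> \<beta> x \<in> ?K" if "x \<in> carrier (P 0)" for x
      using that module_homs_minus[OF pe P T, of x "\<beta> x"] bc ec pc
      by (simp add: a_kernel_iff \<beta>(2) ps) (simp add: a_minus_def T.M.r_neg)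
    show "\<exists>S. ?A 0 S"
      by (rule exI[of _ "(P 0, ?K, \<beta>, d 0, \<lambda>x. x)"]) (use f(2) 1 2 3 4 5 \<beta>(1) r(2) in auto)
  next
    fix n S assume "?A n S"
    moreover obtain D K \<beta> q \<delta>0 where S: "S = (D, K, \<beta>, q, \<delta>0)" by (metis prod_cases5)
    ultimately have D: "in_add R (regular_module R) D" and K: "submodule K R D" and \<beta>: "\<beta> \<in> module_homs R D D"
      and q: "q \<in> module_homs R (P (Suc n)) D" and qK: "\<And>z. z \<in> carrier (P (Suc n)) \<Longrightarrow> q z \<in> K"
      and kerq: "\<And>z. z \<in> carrier (P (Suc n)) \<Longrightarrow> q z = \<zero>\<^bsub>D\<^esub> \<longleftrightarrow> z \<in> d (Suc n) ` carrier (P (Suc (Suc n)))"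
      and \<beta>K: "\<And>x. x \<in> K \<Longrightarrow> \<beta> x \<in> q ` carrier (P (Suc n))"
      and K\<beta>: "\<And>x. x \<in> carrier D \<Longrightarrow> x \<ominus>\<^bsub>D\<^esub> \<beta> x \<in> K" by auto
    have Dm: "left_module R D" using D by (rule in_add_left_module)
    interpret D: left_module R D by (rule Dm)
    interpret K: submodule K R D by (rule K)
    have KD: "x \<in> carrier D" if "x \<in> K" for x using that K.subset by auto
    note bc = module_homsD(1)[OF \<beta>]
    obtain D' :: "('r, nat \<Rightarrow> 'r) module" and i1 i2 p1 p2
      where D': "in_add R (regular_module R) D'" and bi: "biproduct R (P (Suc n)) D D' i1 i2 p1 p2"
      by (rule in_add_biproduct_exists[OF Rm f(2) D infinite_UNIV_nat])
    note b = biproductD[OF bi]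
    interpret D': left_module R D' by (rule b(1))
    note ic = module_homsD(1)[OF b(2)] module_homsD(1)[OF b(3)] module_homsD(1)[OF b(4)] module_homsD(1)[OF b(5)]
    define \<delta> where "\<delta> w = q (p1 w) \<oplus>\<^bsub>D\<^esub> (p2 w \<ominus>\<^bsub>D\<^esub> \<beta> (p2 w))" for w
    have \<delta>: "\<delta> \<in> module_homs R D' D"
      unfolding \<delta>_def
      by (rule module_homs_add[OF module_homs_comp[OF b(4) q]
            module_homs_diff[OF b(5) module_homs_comp[OF b(5) \<beta>] b(1) Dm] b(1) Dm])
    note \<delta>c = module_homsD(1)[OF \<delta>]
    have \<delta>i: "\<delta> (i1 z \<oplus>\<^bsub>D'\<^esub> i2 x) = q z \<oplus>\<^bsub>D\<^esub> (x \<ominus>\<^bsub>D\<^esub> \<beta> x)"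
      if "z \<in> carrier (P (Suc n))" "x \<in> carrier D" for z x
    proof -
      interpret P1: left_module R "P (Suc n)" by (rule P)
      show ?thesis using that
        by (simp add: \<delta>_def module_homsD(2)[OF b(4)] module_homsD(2)[OF b(5)] ic b(6-9))
    qed
    have split: "\<beta> x \<oplus>\<^bsub>D\<^esub> (x \<ominus>\<^bsub>D\<^esub> \<beta> x) = x" if "x \<in> carrier D" for x
      using that bc by (simp add: a_minus_def D.M.a_lcomm[of "\<beta> x"] D.M.r_neg)
    have \<delta>K: "\<delta> w \<in> K" if "w \<in> carrier D'" for w
      unfolding \<delta>_def using that qK K\<beta> K.m_closed ic by simp
    have im: "\<delta> ` carrier D' = K"
    proof
      show "K \<subseteq> \<delta> ` carrier D'"
      proof
        fix x assume x: "x \<in> K"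
        then obtain z where z: "z \<in> carrier (P (Suc n))" "q z = \<beta> x" using \<beta>K by force
        then have "x = \<delta> (i1 z \<oplus>\<^bsub>D'\<^esub> i2 x)" using KD[OF x] by (simp add: \<delta>i split)
        then show "x \<in> \<delta> ` carrier D'" using z KD[OF x] ic by blast
      qed
    qed (use \<delta>K in auto)
    have pr: "projective_module R D'"
      using in_add_imp_fg_projective[OF R D'] by (simp add: fg_projective_module_def)
    \<comment> \<open>The lift exists because \<delta> has image \<open>K\<close>, which \<beta>
      sends into the image of \<open>q\<close>.\<close>
    obtain l where l: "l \<in> module_homs R D' (P (Suc n))" "\<And>w. w \<in> carrier D' \<Longrightarrow> q (l w) = \<beta> (\<delta> w)"
      by (rule projective_lift[OF pr P[of "Suc n"] Dm q module_homs_comp[OF \<delta> \<beta>]]) (use \<beta>K \<delta>K in auto)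
    note lc = module_homsD(1)[OF l(1)]
    let ?K = "a_kernel D' D \<delta>" and ?q = "\<lambda>z. i1 (d (Suc n) z)"
    define \<beta>' where "\<beta>' w = i1 (l w) \<oplus>\<^bsub>D'\<^esub> i2 (\<delta> w)" for w
    have \<beta>': "\<beta>' \<in> module_homs R D' D'"
      unfolding \<beta>'_def by (rule module_homs_add[OF module_homs_comp[OF l(1) b(2)] module_homs_comp[OF \<delta> b(3)] b(1) b(1)])
    have 1: "submodule ?K R D'" by (rule submodule_kernel[OF b(1) Dm \<delta>])
    have q': "?q \<in> module_homs R (P (Suc (Suc n))) D'" by (rule module_homs_comp[OF r(2) b(2)])
    have i1z: "i1 z = \<zero>\<^bsub>D'\<^esub> \<longleftrightarrow> z = \<zero>\<^bsub>P (Suc n)\<^esub>" if "z \<in> carrier (P (Suc n))" for z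
      using b(6)[OF that] module_homs_zero[OF b(4) b(1) P] module_homs_zero[OF b(2) P b(1)] by metis
    have zz: "\<zero>\<^bsub>D\<^esub> \<ominus>\<^bsub>D\<^esub> \<beta> \<zero>\<^bsub>D\<^esub> = \<zero>\<^bsub>D\<^esub>"
      using module_homs_zero[OF \<beta> Dm Dm] D.M.r_neg[of "\<zero>\<^bsub>D\<^esub>"] by (simp add: a_minus_def)
    have 2: "?q z \<in> ?K" if z: "z \<in> carrier (P (Suc (Suc n)))" for z
    proof -
      have "q (d (Suc n) z) = \<zero>\<^bsub>D\<^esub>" using kerq[OF dc[OF z]] z by blast
      then show ?thesis using z zz by (simp add: a_kernel_iff \<delta>_def ic dc b(6,7))
    qed
    have 3: "?q z = \<zero>\<^bsub>D'\<^esub> \<longleftrightarrow> z \<in> d (Suc (Suc n)) ` carrier (P (Suc (Suc (Suc n))))"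
      if "z \<in> carrier (P (Suc (Suc n)))" for z
      using that r(6)[of "Suc n"] by (simp add: a_kernel_iff i1z dc)
    have 4: "\<beta>' w \<in> ?q ` carrier (P (Suc (Suc n)))" if "w \<in> ?K" for w
    proof -
      have w: "w \<in> carrier D'" "\<delta> w = \<zero>\<^bsub>D\<^esub>" using that by (auto simp: a_kernel_iff)
      then have "q (l w) = \<zero>\<^bsub>D\<^esub>" using l(2) module_homs_zero[OF \<beta> Dm Dm] by simp
      then obtain z where "z \<in> carrier (P (Suc (Suc n)))" "l w = d (Suc n) z" using kerq lc w by blast
      then show ?thesis using w module_homs_zero[OF b(3) Dm b(1)] ic dc by (simp add: \<beta>'_def)
    qed
    have 5: "w \<ominus>\<^bsub>D'\<^esub> \<beta>' w \<in> ?K" if w: "w \<in> carrier D'" for w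
    proof -
      \<comment> \<open>By the choice of \<open>l\<close> this is \<beta> (\<delta> w) + (\<delta> w
        - \<beta> (\<delta> w)), so 1 - \<beta>' maps into the new syzygy.\<close>
      have "\<delta> (\<beta>' w) = \<delta> w" unfolding \<beta>'_def using w by (simp add: \<delta>i lc \<delta>c l(2) split)
      then show ?thesis
        using w module_homsD(1)[OF \<beta>'] \<delta>c module_homs_minus[OF \<delta> b(1) Dm, of w "\<beta>' w"] D.M.r_neg
        by (simp add: a_kernel_iff a_minus_def)
    qed
    have "?A (Suc n) (D', ?K, \<beta>', ?q, \<delta>)" using D' 1 2 3 4 5 \<beta>' q' by simp
    moreover have "?B n S (D', ?K, \<beta>', ?q, \<delta>)" using \<delta> im by (simp add: S)
    ultimately show "\<exists>S'. ?A (Suc n) S' \<and> ?B n S S'" by blast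
  qed
  then obtain S where S': "\<forall>n. ?A n (S n) \<and> ?B n (S n) (S (Suc n))" by (rule exE)
  have S: "?A n (S n)" "?B n (S n) (S (Suc n))" for n
    by (rule conjunct1[OF spec[OF S']], rule conjunct2[OF spec[OF S']])
  define D where "D n = fst (S n)" for n
  define K where "K n = fst (snd (S n))" for n
  \<comment> \<open>Stage \<open>Suc n\<close> stores the differential from its own term to term
    \<open>n\<close>; the entry of stage 0 is a filler.\<close>
  define \<delta> where "\<delta> n = snd (snd (snd (snd (S (Suc n)))))" for n
  have D: "in_add R (regular_module R) (D n)" for n
    using S(1)[of n] by (simp add: D_def case_prod_unfold)
  have D0: "D 0 = P 0" "K 0 = a_kernel (P 0) T (\<lambda>x. p (e x))"
    using S(1)[of 0] by (simp_all add: D_def K_def case_prod_unfold)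
  have \<delta>: "\<delta> n \<in> module_homs R (D (Suc n)) (D n)" "\<delta> n ` carrier (D (Suc n)) = K n"
    "K (Suc n) = a_kernel (D (Suc n)) (D n) (\<delta> n)" for n
    using S(2)[of n] by (simp_all add: D_def K_def \<delta>_def case_prod_unfold)
  have "p ` carrier U = carrier T"
    using module_homsD(1)[OF p] module_homsD(1)[OF s] ps by force
  then have surj: "(\<lambda>x. p (e x)) ` carrier (D 0) = carrier T"
    using r(4) D0(1) by (metis image_image)
  have "fg_resolution R T D \<delta> (\<lambda>x. p (e x))"
    by (rule fg_resolutionI[OF R D \<delta>(1) _ surj])
       (use \<delta>(2,3) D0 module_homs_comp[OF r(3) p] in auto)
  then show thesis by (rule that)
qed

text \<open>Treats all spots of the coresolution alike: the kernel of \<open>d j\<close> is the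
  image of \<open>e\<close> for \<open>j = 0\<close> and of the preceding differential otherwise, so
  a map vanishing on that kernel extends along \<open>d j\<close>.\<close>

lemma coresolution_extension:
  fixes C :: "nat \<Rightarrow> ('r, 'p) module" and Q :: "('r, 'q, 'w) module_scheme"
  assumes e: "e ` carrier Y = a_kernel (C 0) (C (Suc 0)) (d 0)"
    and ex: "\<And>j. d j ` carrier (C j) = a_kernel (C (Suc j)) (C (Suc (Suc j))) (d (Suc j))"
    and h1: "hom_exact R Y e (C 0) (d 0) (C (Suc 0)) Q"
    and h2: "\<And>j. hom_exact R (C j) (d j) (C (Suc j)) (d (Suc j)) (C (Suc (Suc j))) Q"
    and k: "k \<in> module_homs R (C j) Q"
    and z: "\<And>x. x \<in> carrier (C j) \<Longrightarrow> d j x = \<zero>\<^bsub>C (Suc j)\<^esub> \<Longrightarrow> k x = \<zero>\<^bsub>Q\<^esub>"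
  shows "\<exists>\<psi>\<in>module_homs R (C (Suc j)) Q. \<forall>y\<in>carrier (C j). k y = \<psi> (d j y)"
proof (cases j)
  case 0
  have "k (e y) = \<zero>\<^bsub>Q\<^esub>" if "y \<in> carrier Y" for y
    using imageI[OF that, of e] z[of "e y"] unfolding e 0 by (simp add: a_kernel_iff)
  with hom_exactD[OF h1] k show ?thesis unfolding 0 by blast
next
  case (Suc i)
  have "k (d i y) = \<zero>\<^bsub>Q\<^esub>" if "y \<in> carrier (C i)" for y
    using imageI[OF that, of "d i"] z[of "d i y"] unfolding ex Suc by (simp add: a_kernel_iff)
  with hom_exactD[OF h2[of i]] k show ?thesis unfolding Suc by blast
qed

text \<open>Since \<phi> \<beta> kills the kernel of \<pi>, it descends to the image of \<pi>, which
  is the image of \<open>f\<close>; by \<open>ext\<close> it extends to a map h on all of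
  \<open>C\<close>. Then \<psi> is h on the first summand plus \<phi> on the second. Taking
  \<open>D'\<close> for \<open>Q\<close> yields the next \<beta>, taking \<open>T\<close> yields
  Hom-exactness.\<close>

lemma biproduct_extension:
  fixes Q :: "('r, 'q, 'w) module_scheme"
  assumes Dm: "left_module R D" and Bm: "left_module R B" and Cm: "left_module R C" and Qm: "left_module R Q"
    and bi: "biproduct R C D D' i1 i2 p1 p2"
    and \<pi>: "\<pi> \<in> module_homs R D C" and \<beta>: "\<beta> \<in> module_homs R D D" and f: "f \<in> module_homs R B C"
    and im: "\<pi> ` carrier D = f ` carrier B"
    and ext: "\<And>k. k \<in> module_homs R B Q \<Longrightarrow>
      (\<And>x. x \<in> carrier B \<Longrightarrow> f x = \<zero>\<^bsub>C\<^esub> \<Longrightarrow> k x = \<zero>\<^bsub>Q\<^esub>) \<Longrightarrow>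
      \<exists>\<psi>\<in>module_homs R C Q. \<forall>y\<in>carrier B. k y = \<psi> (f y)"
    and \<phi>: "\<phi> \<in> module_homs R D Q"
    and \<phi>\<beta>: "\<And>x. x \<in> carrier D \<Longrightarrow> \<pi> x = \<zero>\<^bsub>C\<^esub> \<Longrightarrow> \<phi> (\<beta> x) = \<zero>\<^bsub>Q\<^esub>"
  obtains \<psi> where "\<psi> \<in> module_homs R D' Q"
    "\<And>x w. x \<in> carrier D \<Longrightarrow> w \<in> carrier D' \<Longrightarrow> p1 w = \<pi> x \<Longrightarrow> \<psi> w = \<phi> (\<beta> x \<oplus>\<^bsub>D\<^esub> p2 w)"
proof -
  interpret D: left_module R D by (rule Dm)
  note b = biproductD[OF bi]
  note ic = module_homsD(1)[OF b(4)] module_homsD(1)[OF b(5)] and bc = module_homsD(1)[OF \<beta>]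
  obtain k where k: "k \<in> module_homs R B Q"
    "\<And>c x. c \<in> carrier B \<Longrightarrow> x \<in> carrier D \<Longrightarrow> \<pi> x = f c \<Longrightarrow> k c = \<phi> (\<beta> x)"
    by (rule module_homs_factor[OF Dm Cm Bm Qm \<pi> f module_homs_comp[OF \<beta> \<phi>]])
       (use im \<phi>\<beta> in auto)
  have "k c = \<zero>\<^bsub>Q\<^esub>" if "c \<in> carrier B" "f c = \<zero>\<^bsub>C\<^esub>" for c
    using k(2)[OF that(1), of "\<zero>\<^bsub>D\<^esub>"] that module_homs_zero[OF \<pi> Dm Cm] module_homs_zero[OF \<beta> Dm Dm]
      module_homs_zero[OF \<phi> Dm Qm] by simp
  from ext[OF k(1) this] obtain h where h: "h \<in> module_homs R C Q"
    "\<And>c. c \<in> carrier B \<Longrightarrow> k c = h (f c)" by blast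
  have h\<pi>: "h (\<pi> x) = \<phi> (\<beta> x)" if x: "x \<in> carrier D" for x
  proof -
    have "\<pi> x \<in> f ` carrier B" using im x by blast
    then obtain c where c: "c \<in> carrier B" "\<pi> x = f c" by blast
    then show ?thesis using h(2)[of c] k(2)[of c x] x by simp
  qed
  show thesis
    by (rule that[OF module_homs_add[OF module_homs_comp[OF b(4) h(1)] module_homs_comp[OF b(5) \<phi>] b(1) Qm]])
       (simp add: h\<pi> module_homsD(2)[OF \<phi>] bc ic)
qed

text \<open>The dual recursion, with modules in add of \<open>T\<close> in the role of injectives.
  That \<beta> fixes \<open>N\<close> pointwise and maps the kernel of \<pi> into \<open>N\<close>
  says that \<open>N\<close> splits off that kernel; then x with \<pi> x = 0 and x = \<beta> x lies
  in \<open>N\<close>, so \<delta> has kernel exactly \<open>N\<close>.\<close>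

lemma add_coresolution_retract:
  fixes R :: "('r, 'x) ring_scheme" and T :: "('r, 't, 'z) module_scheme" and C :: "nat \<Rightarrow> ('r, 'p) module"
    and Y :: "('r, 'y, 'w) module_scheme"
  assumes T: "left_module R T" and Y: "left_module R Y"
    and s: "s \<in> module_homs R (regular_module R) Y" and p: "p \<in> module_homs R Y (regular_module R)"
    and ps: "\<And>r. r \<in> carrier R \<Longrightarrow> p (s r) = r"
    and C: "\<And>j. in_add R T (C j)" and e: "e \<in> module_homs R Y (C 0)"
    and d: "\<And>j. d j \<in> module_homs R (C j) (C (Suc j))"
    and inj: "inj_on e (carrier Y)" and ex0: "e ` carrier Y = a_kernel (C 0) (C (Suc 0)) (d 0)"
    and ex: "\<And>j. d j ` carrier (C j) = a_kernel (C (Suc j)) (C (Suc (Suc j))) (d (Suc j))"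
    and h0: "hom_exact R Y (\<lambda>_. \<zero>\<^bsub>Y\<^esub>) Y e (C 0) T"
    and h1: "hom_exact R Y e (C 0) (d 0) (C (Suc 0)) T"
    and h2: "\<And>j. hom_exact R (C j) (d j) (C (Suc j)) (d (Suc j)) (C (Suc (Suc j))) T"
  obtains C' :: "nat \<Rightarrow> ('r, nat \<Rightarrow> 't) module" and e' d' where "add_coresolution R T C' e' d'"
proof -
  have R: "ring R" using T by (rule ring_left_module)
  note Rm = left_module_regular[OF R]
  have Cm: "left_module R (C j)" for j using C by (rule in_add_left_module)
  interpret R: ring R by (rule R)
  interpret Y: left_module R Y by (rule Y)
  note ec = module_homsD(1)[OF e] and dc = module_homsD(1)[OF d] and sc = module_homsD(1)[OF s]
    and pc = module_homsD(1)[OF p]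
  \<comment> \<open>Together with \<open>extQ\<close> below, this is the relative injectivity of
    modules in add of \<open>T\<close>: maps into them extend along \<open>e\<close> and along every
    \<open>d j\<close> as soon as they kill the kernel.\<close>
  have ext0: "\<exists>\<psi>\<in>module_homs R (C 0) Q. \<forall>y\<in>carrier Y. k y = \<psi> (e y)"
    if Q: "in_add R T Q" and k: "k \<in> module_homs R Y Q" for Q :: "('r, nat \<Rightarrow> 't) module" and k
    by (rule hom_exactD[OF hom_exact_in_add[OF T Y Cm h0 Q _ e] k])
       (simp_all add: module_homs_zero[OF k Y in_add_left_module[OF Q]])
  have extQ: "\<exists>\<psi>\<in>module_homs R (C (Suc j)) Q. \<forall>y\<in>carrier (C j). k y = \<psi> (d j y)"
    if Q: "in_add R T Q" and k: "k \<in> module_homs R (C j) Q"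
      and z: "\<And>x. x \<in> carrier (C j) \<Longrightarrow> d j x = \<zero>\<^bsub>C (Suc j)\<^esub> \<Longrightarrow> k x = \<zero>\<^bsub>Q\<^esub>"
    for Q :: "('r, nat \<Rightarrow> 't) module" and j k
    by (rule coresolution_extension[where C=C and e=e and d=d, OF ex0 ex
          hom_exact_in_add[OF T Cm Cm h1 Q ec d] hom_exact_in_add[OF T Cm Cm h2 Q dc d] k z])
  note extT = coresolution_extension[where C=C and e=e and d=d, OF ex0 ex h1 h2]
  \<comment> \<open>The initial term is moved to the element type of the terms to be built; the
    later \<open>C (Suc n)\<close> enter only as summands and keep their type.\<close>
  obtain C0 :: "('r, nat \<Rightarrow> 't) module" and a b where C0: "left_module R C0" and ab: "inverse_homs R (C 0) C0 a b"
    by (rule in_add_transport[OF T C[of 0] infinite_UNIV_nat])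
  note i = inverse_homsD[OF ab]
  note ac = module_homsD(1)[OF i(1)] module_homsD(1)[OF i(2)]
  have C0add: "in_add R T C0" by (rule in_add_iso[OF T C C0 ab])
  let ?e = "\<lambda>r. a (e (s r))"
  have e': "?e \<in> module_homs R (regular_module R) C0"
    by (rule module_homs_comp[OF module_homs_comp[OF s e] i(1)])
  \<comment> \<open>\<open>N\<close> is the image in \<open>D\<close> of the previous term, and \<open>\<beta>\<close> extends a retraction of \<open>ker \<pi>\<close>
    onto \<open>N\<close>. The next term is \<open>D' = C (n + 1) \<oplus> D\<close> with \<open>\<delta> x = (\<pi> x, x - \<beta> x)\<close>; any map \<open>\<phi>\<close>
    on \<open>D\<close> killing \<open>N\<close> gives \<open>(\<pi> x, y) \<mapsto> \<phi>(\<beta> x + y)\<close>, which extends to \<open>D'\<close> and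
    restricts to \<open>\<phi>\<close> along \<open>\<delta>\<close>.\<close>
  let ?A = "\<lambda>n (D :: ('r, nat \<Rightarrow> 't) module, N, \<beta>, \<pi>, \<delta> :: (nat \<Rightarrow> 't) \<Rightarrow> nat \<Rightarrow> 't).
    in_add R T D \<and> submodule N R D \<and> \<beta> \<in> module_homs R D D \<and> \<pi> \<in> module_homs R D (C (Suc n)) \<and>
    (\<forall>x\<in>N. \<pi> x = \<zero>\<^bsub>C (Suc n)\<^esub> \<and> \<beta> x = x) \<and>
    (\<forall>x\<in>carrier D. \<pi> x = \<zero>\<^bsub>C (Suc n)\<^esub> \<longrightarrow> \<beta> x \<in> N) \<and>
    \<pi> ` carrier D = d n ` carrier (C n) \<and> (n = 0 \<longrightarrow> D = C0 \<and> N = ?e ` carrier R)"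
  let ?B = "\<lambda>(n::nat) (D :: ('r, nat \<Rightarrow> 't) module, N, \<beta> :: (nat \<Rightarrow> 't) \<Rightarrow> nat \<Rightarrow> 't, \<pi> :: (nat \<Rightarrow> 't) \<Rightarrow> 'p, \<delta> :: (nat \<Rightarrow> 't) \<Rightarrow> nat \<Rightarrow> 't)
      (D' :: ('r, nat \<Rightarrow> 't) module, N', \<beta>' :: (nat \<Rightarrow> 't) \<Rightarrow> nat \<Rightarrow> 't, \<pi>' :: (nat \<Rightarrow> 't) \<Rightarrow> 'p, \<delta>').
    \<delta>' \<in> module_homs R D D' \<and> N = a_kernel D D' \<delta>' \<and> N' = \<delta>' ` carrier D \<and>
    (\<forall>\<phi>\<in>module_homs R D T. (\<forall>x\<in>N. \<phi> x = \<zero>\<^bsub>T\<^esub>) \<longrightarrow> (\<exists>\<psi>\<in>module_homs R D' T. \<forall>x\<in>carrier D. \<phi> x = \<psi> (\<delta>' x)))"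
  have "\<exists>S. \<forall>n. ?A n (S n) \<and> ?B n (S n) (S (Suc n))"
  proof (rule dependent_nat_choice)
    have N: "submodule (?e ` carrier R) R C0"
      using submodule_image[OF Rm C0 e'] by simp
    have pi: "(\<lambda>x. d 0 (b x)) \<in> module_homs R C0 (C (Suc 0))" by (rule module_homs_comp[OF i(2) d])
    have "(\<lambda>y. ?e (p y)) \<in> module_homs R Y C0" by (rule module_homs_comp[OF p e'])
    from ext0[OF C0add this] obtain \<beta> where \<beta>: "\<beta> \<in> module_homs R (C 0) C0"
      "\<And>y. y \<in> carrier Y \<Longrightarrow> ?e (p y) = \<beta> (e y)" by blast
    have \<beta>b: "(\<lambda>x. \<beta> (b x)) \<in> module_homs R C0 C0" by (rule module_homs_comp[OF i(2) \<beta>(1)])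
    have de: "d 0 (e y) = \<zero>\<^bsub>C (Suc 0)\<^esub>" if "y \<in> carrier Y" for y
      using ex0 that a_kernel_iff[of "e y" "C 0" "C (Suc 0)" "d 0"] by blast
    have 1: "d 0 (b x) = \<zero>\<^bsub>C (Suc 0)\<^esub> \<and> \<beta> (b x) = x" if "x \<in> ?e ` carrier R" for x
      using that sc ec de ps by (auto simp: i(3) simp flip: \<beta>(2))
    have 2: "\<beta> (b x) \<in> ?e ` carrier R" if "x \<in> carrier C0" "d 0 (b x) = \<zero>\<^bsub>C (Suc 0)\<^esub>" for x
    proof -
      have "b x \<in> e ` carrier Y" using that ac by (simp add: ex0 a_kernel_iff)
      then obtain y where "y \<in> carrier Y" "b x = e y" by blast
      then show ?thesis using pc[of y] by (auto simp flip: \<beta>(2))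
    qed
    have "b ` carrier C0 = carrier (C 0)" using ac i(3) by force
    then have 3: "(\<lambda>x. d 0 (b x)) ` carrier C0 = d 0 ` carrier (C 0)" by (metis image_image)
    show "\<exists>S. ?A 0 S"
      by (rule exI[of _ "(C0, ?e ` carrier R, \<lambda>x. \<beta> (b x), \<lambda>x. d 0 (b x), \<lambda>x. x)"])
         (simp add: C0add N pi \<beta>b 1 2 3)
  next
    fix n S assume "?A n S"
    moreover obtain D N \<beta> \<pi> \<delta>0 where S: "S = (D, N, \<beta>, \<pi>, \<delta>0)" by (metis prod_cases5)
    ultimately have D: "in_add R T D" and N: "submodule N R D" and \<beta>: "\<beta> \<in> module_homs R D D"
      and \<pi>: "\<pi> \<in> module_homs R D (C (Suc n))"
      and N\<pi>: "\<And>x. x \<in> N \<Longrightarrow> \<pi> x = \<zero>\<^bsub>C (Suc n)\<^esub>" and N\<beta>: "\<And>x. x \<in> N \<Longrightarrow> \<beta> x = x"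
      and \<beta>N: "\<And>x. x \<in> carrier D \<Longrightarrow> \<pi> x = \<zero>\<^bsub>C (Suc n)\<^esub> \<Longrightarrow> \<beta> x \<in> N"
      and im: "\<pi> ` carrier D = d n ` carrier (C n)" by auto
    have Dm: "left_module R D" using D by (rule in_add_left_module)
    interpret D: left_module R D by (rule Dm)
    interpret N: submodule N R D by (rule N)
    have ND: "x \<in> carrier D" if "x \<in> N" for x using that N.subset by auto
    note bc = module_homsD(1)[OF \<beta>] and \<pi>c = module_homsD(1)[OF \<pi>]
    obtain D' :: "('r, nat \<Rightarrow> 't) module" and i1 i2 p1 p2
      where D': "in_add R T D'" and bi: "biproduct R (C (Suc n)) D D' i1 i2 p1 p2"
      by (rule in_add_biproduct_exists[OF T C D infinite_UNIV_nat])
    note b = biproductD[OF bi]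
    interpret D': left_module R D' by (rule b(1))
    interpret C1: left_module R "C (Suc n)" by (rule Cm)
    note ic = module_homsD(1)[OF b(2)] module_homsD(1)[OF b(3)] module_homsD(1)[OF b(4)] module_homsD(1)[OF b(5)]
    define \<delta> where "\<delta> x = i1 (\<pi> x) \<oplus>\<^bsub>D'\<^esub> i2 (x \<ominus>\<^bsub>D\<^esub> \<beta> x)" for x
    have \<delta>: "\<delta> \<in> module_homs R D D'"
      unfolding \<delta>_def
      by (rule module_homs_add[OF module_homs_comp[OF \<pi> b(2)]
            module_homs_comp[OF module_homs_diff[OF module_homs_id \<beta> Dm Dm] b(3)] Dm b(1)])
    note \<delta>c = module_homsD(1)[OF \<delta>]
    have p\<delta>: "p1 (\<delta> x) = \<pi> x" "p2 (\<delta> x) = x \<ominus>\<^bsub>D\<^esub> \<beta> x" if "x \<in> carrier D" for x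
      using that \<pi>c bc by (simp_all add: \<delta>_def module_homsD(2)[OF b(4)] module_homsD(2)[OF b(5)] ic b(6-9))
    have diff0: "x \<ominus>\<^bsub>D\<^esub> \<beta> x = \<zero>\<^bsub>D\<^esub> \<longleftrightarrow> \<beta> x = x" if "x \<in> carrier D" for x
      using D.M.add.inv_solve_right[OF D.M.zero_closed that bc[OF that]] D.M.l_zero[OF bc[OF that]]
      unfolding a_minus_def by metis
    have ker: "N = a_kernel D D' \<delta>"
    proof (intro equalityI subsetI)
      fix x assume x: "x \<in> N"
      then show "x \<in> a_kernel D D' \<delta>"
        using N\<pi>[OF x] diff0[OF ND[OF x]] N\<beta>[OF x] ND[OF x] module_homs_zero[OF b(2) Cm b(1)]
          module_homs_zero[OF b(3) Dm b(1)] by (simp add: a_kernel_iff \<delta>_def)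
    next
      fix x assume "x \<in> a_kernel D D' \<delta>"
      then have x: "x \<in> carrier D" "\<delta> x = \<zero>\<^bsub>D'\<^esub>" by (auto simp: a_kernel_iff)
      have "\<pi> x = \<zero>\<^bsub>C (Suc n)\<^esub>" "x \<ominus>\<^bsub>D\<^esub> \<beta> x = \<zero>\<^bsub>D\<^esub>"
        using p\<delta>[OF x(1)] module_homs_zero[OF b(4) b(1) Cm] module_homs_zero[OF b(5) b(1) Dm] x(2) by auto
      then show "x \<in> N" using \<beta>N[OF x(1)] diff0[OF x(1)] by simp
    qed
    have split: "\<beta> x \<oplus>\<^bsub>D\<^esub> (x \<ominus>\<^bsub>D\<^esub> \<beta> x) = x" if "x \<in> carrier D" for x
      using that bc by (simp add: a_minus_def D.M.a_lcomm[of "\<beta> x"] D.M.r_neg)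
    have \<delta>N: "\<delta> x = \<zero>\<^bsub>D'\<^esub>" if "x \<in> N" for x using that unfolding ker by (simp add: a_kernel_iff)
    \<comment> \<open>Here \<phi> is \<delta> itself, so \<beta>' sends a pair (\<pi> x, y) to
      \<delta> (\<beta> x + y). At \<delta> x = (\<pi> x, x - \<beta> x) the value is \<delta> x, so
      \<beta>' fixes the new image.\<close>
    obtain \<beta>' where \<beta>': "\<beta>' \<in> module_homs R D' D'"
      "\<And>x w. x \<in> carrier D \<Longrightarrow> w \<in> carrier D' \<Longrightarrow> p1 w = \<pi> x \<Longrightarrow> \<beta>' w = \<delta> (\<beta> x \<oplus>\<^bsub>D\<^esub> p2 w)"
      by (rule biproduct_extension[OF Dm Cm[of n] Cm[of "Suc n"] b(1) bi \<pi> \<beta> d[of n] im extQ[OF D'] \<delta>])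
         (use \<beta>N \<delta>N in auto)
    let ?N = "\<delta> ` carrier D" and ?\<pi> = "\<lambda>w. d (Suc n) (p1 w)"
    have 1: "submodule ?N R D'" by (rule submodule_image[OF Dm b(1) \<delta>])
    have 2: "?\<pi> \<in> module_homs R D' (C (Suc (Suc n)))" by (rule module_homs_comp[OF b(4) d])
    have im_iff: "y \<in> \<pi> ` carrier D \<longleftrightarrow> y \<in> carrier (C (Suc n)) \<and> d (Suc n) y = \<zero>\<^bsub>C (Suc (Suc n))\<^esub>" for y
      unfolding im ex by (simp add: a_kernel_iff)
    have 3: "?\<pi> (\<delta> x) = \<zero>\<^bsub>C (Suc (Suc n))\<^esub> \<and> \<beta>' (\<delta> x) = \<delta> x" if x: "x \<in> carrier D" for x
      using im_iff[of "\<pi> x"] x \<beta>'(2)[OF x \<delta>c[OF x]] by (simp add: p\<delta> split)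
    have 4: "\<beta>' w \<in> ?N" if w: "w \<in> carrier D'" "?\<pi> w = \<zero>\<^bsub>C (Suc (Suc n))\<^esub>" for w
    proof -
      have "p1 w \<in> \<pi> ` carrier D" using w ic by (simp add: im_iff)
      then obtain x where "x \<in> carrier D" "p1 w = \<pi> x" by blast
      then show ?thesis using \<beta>'(2)[of x w] w bc ic by auto
    qed
    have "p1 ` carrier D' = carrier (C (Suc n))"
      using ic b(6) by force
    then have 5: "?\<pi> ` carrier D' = d (Suc n) ` carrier (C (Suc n))" by (metis image_image)
    have 6: "\<exists>\<psi>\<in>module_homs R D' T. \<forall>x\<in>carrier D. \<phi> x = \<psi> (\<delta> x)"
      if \<phi>: "\<phi> \<in> module_homs R D T" and z: "\<forall>x\<in>N. \<phi> x = \<zero>\<^bsub>T\<^esub>" for \<phi>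
    proof -
      obtain \<psi> where \<psi>: "\<psi> \<in> module_homs R D' T"
        "\<And>x w. x \<in> carrier D \<Longrightarrow> w \<in> carrier D' \<Longrightarrow> p1 w = \<pi> x \<Longrightarrow> \<psi> w = \<phi> (\<beta> x \<oplus>\<^bsub>D\<^esub> p2 w)"
        by (rule biproduct_extension[OF Dm Cm[of n] Cm[of "Suc n"] T bi \<pi> \<beta> d[of n] im extT \<phi>])
           (use \<beta>N z in auto)
      have "\<phi> x = \<psi> (\<delta> x)" if x: "x \<in> carrier D" for x
        using \<psi>(2)[OF x \<delta>c[OF x]] by (simp add: p\<delta> split x)
      then show ?thesis using \<psi>(1) by blast
    qed
    have A: "?A (Suc n) (D', ?N, \<beta>', ?\<pi>, \<delta>)" using D' 1 2 3 4 5 \<beta>'(1) by simp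
    have B: "?B n S (D', ?N, \<beta>', ?\<pi>, \<delta>)" using \<delta> ker 6 by (simp add: S)
    show "\<exists>S'. ?A (Suc n) S' \<and> ?B n S S'"
      by (rule exI[of _ "(D', ?N, \<beta>', ?\<pi>, \<delta>)"], rule conjI[OF A B])
  qed
  then obtain S where S': "\<forall>n. ?A n (S n) \<and> ?B n (S n) (S (Suc n))" by (rule exE)
  have S: "?A n (S n)" "?B n (S n) (S (Suc n))" for n
    by (rule conjunct1[OF spec[OF S']], rule conjunct2[OF spec[OF S']])
  define D where "D n = fst (S n)" for n
  define N where "N n = fst (snd (S n))" for n
  \<comment> \<open>Stage \<open>Suc n\<close> stores the differential arriving at its own term from
    term \<open>n\<close>; stage 0 again holds a filler.\<close>
  define \<delta> where "\<delta> n = snd (snd (snd (snd (S (Suc n)))))" for n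
  have D: "in_add R T (D n)" for n
    using S(1)[of n] by (simp add: D_def case_prod_unfold)
  have D0: "D 0 = C0" "N 0 = ?e ` carrier R"
    using S(1)[of 0] by (simp_all add: D_def N_def case_prod_unfold)
  have \<delta>: "\<delta> n \<in> module_homs R (D n) (D (Suc n))" "N n = a_kernel (D n) (D (Suc n)) (\<delta> n)"
    "N (Suc n) = \<delta> n ` carrier (D n)"
    "\<And>\<phi>. \<phi> \<in> module_homs R (D n) T \<Longrightarrow> (\<And>x. x \<in> N n \<Longrightarrow> \<phi> x = \<zero>\<^bsub>T\<^esub>) \<Longrightarrow>
      \<exists>\<psi>\<in>module_homs R (D (Suc n)) T. \<forall>x\<in>carrier (D n). \<phi> x = \<psi> (\<delta> n x)" for n
    using S(2)[of n] by (simp_all add: D_def N_def \<delta>_def case_prod_unfold)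
  have "exact_coresolution R D ?e \<delta>"
    unfolding exact_coresolution_def
  proof (intro conjI allI)
    show "?e \<in> module_homs R (regular_module R) (D 0)" using e' D0 by simp
    show "inj_on ?e (carrier R)"
    proof (rule inj_onI)
      fix x y assume xy: "x \<in> carrier R" "y \<in> carrier R" "?e x = ?e y"
      have "b (?e x) = b (?e y)" using xy(3) by simp
      then have "e (s x) = e (s y)" using xy(1,2) sc ec by (simp add: i(3))
      then have "s x = s y" using inj sc xy by (simp add: inj_on_eq_iff)
      then show "x = y" using ps xy by metis
    qed
    show "?e ` carrier R = a_kernel (D 0) (D 1) (\<delta> 0)" using \<delta>(2)[of 0] D0 by simp
    show "\<delta> j ` carrier (D j) = a_kernel (D (Suc j)) (D (Suc (Suc j))) (\<delta> (Suc j))" for j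
      using \<delta>(2)[of "Suc j"] \<delta>(3)[of j] by simp
  qed (rule \<delta>(1))
  moreover have "hom_exact R (regular_module R) (\<lambda>_. \<zero>\<^bsub>R\<^esub>) (regular_module R) ?e (D 0) T"
  proof (rule hom_exactI)
    fix \<phi> assume \<phi>: "\<phi> \<in> module_homs R (regular_module R) T"
    have "\<phi> (p \<zero>\<^bsub>Y\<^esub>) = \<zero>\<^bsub>T\<^esub>" by (rule module_homs_zero[OF module_homs_comp[OF p \<phi>] Y T])
    from hom_exactD[OF h0 module_homs_comp[OF p \<phi>] this]
    obtain \<psi> where \<psi>: "\<psi> \<in> module_homs R (C 0) T" "\<And>y. y \<in> carrier Y \<Longrightarrow> \<phi> (p y) = \<psi> (e y)" by blast
    have "\<phi> r = \<psi> (b (?e r))" if "r \<in> carrier R" for r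
      using \<psi>(2)[of "s r"] that sc ec by (simp add: ps i(3))
    then show "\<exists>\<psi>\<in>module_homs R (D 0) T. \<forall>y\<in>carrier (regular_module R). \<phi> y = \<psi> (?e y)"
      using D0 module_homs_comp[OF i(2) \<psi>(1)] by (intro bexI[of _ "\<lambda>x. \<psi> (b x)"]) auto
  qed
  moreover have "hom_exact R (regular_module R) ?e (D 0) (\<delta> 0) (D (Suc 0)) T"
    by (rule hom_exactI, rule \<delta>(4)) (use D0 in auto)
  moreover have "hom_exact R (D j) (\<delta> j) (D (Suc j)) (\<delta> (Suc j)) (D (Suc (Suc j))) T" for j
    by (rule hom_exactI, rule \<delta>(4)) (use \<delta>(3)[of j] in auto)
  ultimately have "add_coresolution R T D ?e \<delta>" using D by (simp add: add_coresolution_def)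
  then show thesis by (rule that)
qed

section \<open>Change of rings\<close>

definition restrict_scalars :: "('r \<Rightarrow> 's) \<Rightarrow> ('s, 'm, 'b) module_scheme \<Rightarrow> ('r, 'm) module" where
  "restrict_scalars \<iota> N =
    \<lparr>carrier = carrier N, monoid.mult = undefined, one = undefined,
     ring.zero = \<zero>\<^bsub>N\<^esub>, add = add N, smult = (\<lambda>r x. \<iota> r \<odot>\<^bsub>N\<^esub> x)\<rparr>"

lemma restrict_scalars_simps [simp]:
  "carrier (restrict_scalars \<iota> N) = carrier N"
  "ring.zero (restrict_scalars \<iota> N) = \<zero>\<^bsub>N\<^esub>"
  "add (restrict_scalars \<iota> N) = add N"
  "smult (restrict_scalars \<iota> N) = (\<lambda>r x. \<iota> r \<odot>\<^bsub>N\<^esub> x)"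
  by (simp_all add: restrict_scalars_def)

text \<open>The two sums are taken in records of different types; additivity of the identity map
  compares them.\<close>

lemma finsum_restrict_scalars:
  assumes "abelian_group N" "\<And>i. i \<in> I \<Longrightarrow> f i \<in> carrier N"
  shows "finsum (restrict_scalars \<iota> N) f I = finsum N f I"
proof -
  have "abelian_group (restrict_scalars \<iota> N)" by (rule abelian_group_cong[OF assms(1)]) simp_all
  from additive_finsum[where f="\<lambda>x. x" and h=f and I=I, OF assms(1) this _ _ assms(2)] show ?thesis by simp
qed

locale ring_hom_noncomm = ring_hom_ring R A \<iota>
  for R :: "('r, 'x) ring_scheme" and A :: "('a, 'y) ring_scheme" and \<iota> :: "'r \<Rightarrow> 'a"
begin

abbreviation "rs \<equiv> restrict_scalars \<iota>"

lemma left_module_restrict_scalars: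
  assumes "left_module A N" shows "left_module R (rs N)"
proof -
  interpret N: left_module A N by fact
  have "abelian_group (rs N)" by (rule abelian_group_cong[OF N.M.abelian_group_axioms]) simp_all
  moreover have "left_module_axioms R (rs N)"
    by unfold_locales
       (simp_all add: N.smult_closed N.smult_l_distr N.smult_r_distr N.smult_assoc N.smult_one)
  ultimately show ?thesis using R.ring_axioms by (simp add: left_module_def)
qed

lemma module_homs_restrict_scalars: "f \<in> module_homs A M N \<Longrightarrow> f \<in> module_homs R (rs M) (rs N)"
  by (rule module_homsI) (simp_all add: module_homsD)

lemma in_add_restrict_scalars:
  assumes U: "left_module A U" and Q: "in_add A U Q"
  shows "in_add R (rs U) (rs Q)"
proof -
  obtain n :: nat and u g where Qm: "left_module A Q" and dec: "add_decomposition A U Q {..<n} u g"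
    by (rule in_addE[OF Q U])
  interpret Q: left_module A Q by (rule Qm)
  note d = add_decompositionD[OF dec]
  have "finsum (rs Q) (\<lambda>i. u i (g i x)) {..<n} = x" if "x \<in> carrier Q" for x
    using finsum_restrict_scalars[OF Q.M.abelian_group_axioms, of "{..<n}" "\<lambda>i. u i (g i x)"]
      module_homsD(1)[OF d(2)] module_homsD(1)[OF d(3)] d(4)[OF that] that by simp
  then have "add_decomposition R (rs U) (rs Q) {..<n} u g"
    using d(1) module_homs_restrict_scalars[OF d(2)] module_homs_restrict_scalars[OF d(3)]
    by (simp add: add_decomposition_def)
  then show ?thesis
    by (rule in_addI[OF left_module_restrict_scalars[OF Qm] left_module_restrict_scalars[OF U]])
qed

text \<open>An \<open>R\<close>-bimodule map from \<open>A\<close> to \<open>R\<close>. The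
  coordinates \<open>p i\<close>, the retraction \<open>q\<close> of a split extension and the
  Frobenius functional \<open>E\<close> are all of this kind.\<close>

definition bimodule_functional :: "('a \<Rightarrow> 'r) \<Rightarrow> bool" where
  "bimodule_functional \<chi> \<longleftrightarrow>
    (\<forall>x\<in>carrier A. \<chi> x \<in> carrier R) \<and>
    (\<forall>x\<in>carrier A. \<forall>y\<in>carrier A. \<chi> (x \<oplus>\<^bsub>A\<^esub> y) = \<chi> x \<oplus>\<^bsub>R\<^esub> \<chi> y) \<and>
    (\<forall>r\<in>carrier R. \<forall>x\<in>carrier A. \<chi> (\<iota> r \<otimes>\<^bsub>A\<^esub> x) = r \<otimes>\<^bsub>R\<^esub> \<chi> x) \<and>
    (\<forall>x\<in>carrier A. \<forall>r\<in>carrier R. \<chi> (x \<otimes>\<^bsub>A\<^esub> \<iota> r) = \<chi> x \<otimes>\<^bsub>R\<^esub> r)"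

lemma bimodule_functionalD:
  assumes "bimodule_functional \<chi>"
  shows "\<And>x. x \<in> carrier A \<Longrightarrow> \<chi> x \<in> carrier R"
    "\<And>x y. x \<in> carrier A \<Longrightarrow> y \<in> carrier A \<Longrightarrow> \<chi> (x \<oplus>\<^bsub>A\<^esub> y) = \<chi> x \<oplus>\<^bsub>R\<^esub> \<chi> y"
    "\<And>r x. r \<in> carrier R \<Longrightarrow> x \<in> carrier A \<Longrightarrow> \<chi> (\<iota> r \<otimes>\<^bsub>A\<^esub> x) = r \<otimes>\<^bsub>R\<^esub> \<chi> x"
    "\<And>x r. x \<in> carrier A \<Longrightarrow> r \<in> carrier R \<Longrightarrow> \<chi> (x \<otimes>\<^bsub>A\<^esub> \<iota> r) = \<chi> x \<otimes>\<^bsub>R\<^esub> r"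
  using assms by (auto simp: bimodule_functional_def)

lemma bimodule_functional_finsum:
  assumes "bimodule_functional \<chi>" "\<And>i. i \<in> I \<Longrightarrow> h i \<in> carrier A"
  shows "\<chi> (finsum A h I) = finsum R (\<lambda>i. \<chi> (h i)) I"
  by (rule additive_finsum[OF S.abelian_group_axioms R.abelian_group_axioms])
     (use bimodule_functionalD[OF assms(1)] assms(2) in auto)

end

section \<open>Induced modules over an extension with a centralizing dual basis\<close>

locale centrally_projective_hom = ring_hom_noncomm R A \<iota>
  for R :: "('r, 'x) ring_scheme" and A :: "('a, 'y) ring_scheme" and \<iota> :: "'r \<Rightarrow> 'a" +
  fixes n :: nat and c :: "nat \<Rightarrow> 'a" and p :: "nat \<Rightarrow> 'a \<Rightarrow> 'r"
  assumes c_closed: "\<And>i. i < n \<Longrightarrow> c i \<in> carrier A"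
    and c_central: "\<And>i r. i < n \<Longrightarrow> r \<in> carrier R \<Longrightarrow> \<iota> r \<otimes>\<^bsub>A\<^esub> c i = c i \<otimes>\<^bsub>A\<^esub> \<iota> r"
    and p_functional: "\<And>i. i < n \<Longrightarrow> bimodule_functional (p i)"
    and basis: "\<And>x. x \<in> carrier A \<Longrightarrow> finsum A (\<lambda>i. \<iota> (p i x) \<otimes>\<^bsub>A\<^esub> c i) {..<n} = x"
begin

lemmas p_simps = bimodule_functionalD[OF p_functional]

text \<open>
  Characterizes \<open>U\<close> as \<open>A \<otimes>\<^sub>R T\<close>, with \<open>\<eta> t = 1 \<otimes> t\<close> and \<open>\<pi> i (b \<otimes> t) = p i b \<cdot> t\<close>.
\<close>

definition induced ::
    "('r, 't, 'b) module_scheme \<Rightarrow> ('a, 'u, 'e) module_scheme \<Rightarrow> ('t \<Rightarrow> 'u) \<Rightarrow> (nat \<Rightarrow> 'u \<Rightarrow> 't) \<Rightarrow> bool"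
  where
  "induced T U \<eta> \<pi> \<longleftrightarrow> left_module R T \<and> left_module A U \<and> \<eta> \<in> module_homs R T (rs U) \<and>
    (\<forall>i<n. \<pi> i \<in> module_homs R (rs U) T) \<and>
    (\<forall>u\<in>carrier U. finsum U (\<lambda>i. c i \<odot>\<^bsub>U\<^esub> \<eta> (\<pi> i u)) {..<n} = u) \<and>
    (\<forall>i<n. \<forall>b\<in>carrier A. \<forall>t\<in>carrier T. \<pi> i (b \<odot>\<^bsub>U\<^esub> \<eta> t) = p i b \<odot>\<^bsub>T\<^esub> t)"

lemma inducedD:
  assumes "induced T U \<eta> \<pi>"
  shows "left_module R T" "left_module A U" "\<eta> \<in> module_homs R T (rs U)"
    "\<And>i. i < n \<Longrightarrow> \<pi> i \<in> module_homs R (rs U) T"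
    "\<And>u. u \<in> carrier U \<Longrightarrow> finsum U (\<lambda>i. c i \<odot>\<^bsub>U\<^esub> \<eta> (\<pi> i u)) {..<n} = u"
    "\<And>i b t. i < n \<Longrightarrow> b \<in> carrier A \<Longrightarrow> t \<in> carrier T \<Longrightarrow> \<pi> i (b \<odot>\<^bsub>U\<^esub> \<eta> t) = p i b \<odot>\<^bsub>T\<^esub> t"
    "\<And>t. t \<in> carrier T \<Longrightarrow> \<eta> t \<in> carrier U"
    "\<And>i u. i < n \<Longrightarrow> u \<in> carrier U \<Longrightarrow> \<pi> i u \<in> carrier T"
  using assms module_homsD(1)[of \<eta> R T "rs U"] module_homsD(1)[of "\<pi> _" R "rs U" T]
  by (auto simp: induced_def)

text \<open>The point of centrality: multiplication by \<open>c i\<close> on an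
  \<open>A\<close>-module is \<open>R\<close>-linear because \<open>c i\<close> commutes with the
  image of \<open>R\<close>.\<close>

lemma module_homs_smult_c:
  assumes N: "left_module A N" and i: "i < n"
  shows "(\<lambda>x. c i \<odot>\<^bsub>N\<^esub> x) \<in> module_homs R (rs N) (rs N)"
proof -
  interpret N: left_module A N by fact
  show ?thesis
    by (rule module_homsI)
       (simp_all add: N.smult_closed N.smult_r_distr c_closed c_central i flip: N.smult_assoc)
qed

text \<open>The existence half of the adjunction between induction and restriction. The extension is
  u to the sum of c i times \<phi> (\<pi> i u), where \<pi> i u are the coordinates of u.\<close>

lemma induced_extension:
  assumes ind: "induced T U \<eta> \<pi>" and N: "left_module A N" and \<phi>: "\<phi> \<in> module_homs R T (rs N)"
  obtains \<psi> where "\<psi> \<in> module_homs A U N" "\<And>t. t \<in> carrier T \<Longrightarrow> \<psi> (\<eta> t) = \<phi> t"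
proof -
  note i = inducedD[OF ind]
  interpret N: left_module A N by fact
  interpret U: left_module A U by (rule i(2))
  interpret T: left_module R T by (rule i(1))
  have rsU: "left_module R (rs U)" "left_module R (rs N)"
    using left_module_restrict_scalars i(2) N by auto
  have \<phi>D: "\<phi> t \<in> carrier N" "r \<in> carrier R \<Longrightarrow> \<phi> (r \<odot>\<^bsub>T\<^esub> t) = \<iota> r \<odot>\<^bsub>N\<^esub> \<phi> t" if "t \<in> carrier T" for t r
    using module_homsD[OF \<phi>] that by simp_all
  define \<psi> where "\<psi> u = finsum (rs N) (\<lambda>i. c i \<odot>\<^bsub>N\<^esub> \<phi> (\<pi> i u)) {..<n}" for u
  have "\<psi> \<in> module_homs R (rs U) (rs N)"
    unfolding \<psi>_def
    by (rule module_homs_sum[OF rsU])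
       (rule module_homs_comp[OF module_homs_comp[OF i(4) \<phi>] module_homs_smult_c[OF N]], simp_all)
  then have \<psi>D: "\<psi> u \<in> carrier N" "v \<in> carrier U \<Longrightarrow> \<psi> (u \<oplus>\<^bsub>U\<^esub> v) = \<psi> u \<oplus>\<^bsub>N\<^esub> \<psi> v" if "u \<in> carrier U" for u v
    using module_homsD[of \<psi> R "rs U" "rs N"] that by simp_all
  have \<psi>_eq: "\<psi> u = finsum N (\<lambda>i. c i \<odot>\<^bsub>N\<^esub> \<phi> (\<pi> i u)) {..<n}" if "u \<in> carrier U" for u
    unfolding \<psi>_def
    by (rule finsum_restrict_scalars[OF N.M.abelian_group_axioms])
       (simp add: N.smult_closed c_closed \<phi>D i(8) that)
  \<comment> \<open>On b times \<eta> t the dual basis collapses: \<phi> contributes the scalars p i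
    b, which move past the centralizing \<open>c i\<close> to give b again. Full
    \<open>A\<close>-linearity reduces to this because such elements span \<open>U\<close>.\<close>
  have \<psi>\<eta>: "\<psi> (b \<odot>\<^bsub>U\<^esub> \<eta> t) = b \<odot>\<^bsub>N\<^esub> \<phi> t" if b: "b \<in> carrier A" and t: "t \<in> carrier T" for b t
  proof -
    have "\<psi> (b \<odot>\<^bsub>U\<^esub> \<eta> t) = finsum N (\<lambda>i. c i \<odot>\<^bsub>N\<^esub> \<phi> (\<pi> i (b \<odot>\<^bsub>U\<^esub> \<eta> t))) {..<n}"
      using b t i(7) by (intro \<psi>_eq U.smult_closed) auto
    also have "\<dots> = finsum N (\<lambda>i. (\<iota> (p i b) \<otimes>\<^bsub>A\<^esub> c i) \<odot>\<^bsub>N\<^esub> \<phi> t) {..<n}"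
      by (rule N.M.finsum_cong')
         (simp_all add: i(6) b t \<phi>D p_simps c_closed c_central N.smult_assoc N.smult_closed Pi_def)
    also have "\<dots> = finsum A (\<lambda>i. \<iota> (p i b) \<otimes>\<^bsub>A\<^esub> c i) {..<n} \<odot>\<^bsub>N\<^esub> \<phi> t"
      by (rule finsum_smult[OF N, symmetric]) (simp_all add: b t \<phi>D p_simps c_closed)
    also have "\<dots> = b \<odot>\<^bsub>N\<^esub> \<phi> t" by (simp add: basis b)
    finally show ?thesis .
  qed
  have "\<psi> \<in> module_homs A U N"
  proof (rule module_homsI)
    fix b u assume b: "b \<in> carrier A" and u: "u \<in> carrier U"
    have cl: "c i \<odot>\<^bsub>U\<^esub> \<eta> (\<pi> i u) \<in> carrier U" if "i < n" for i
      using that u by (simp add: U.smult_closed c_closed i(7,8))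
    have "b \<odot>\<^bsub>U\<^esub> u = b \<odot>\<^bsub>U\<^esub> finsum U (\<lambda>i. c i \<odot>\<^bsub>U\<^esub> \<eta> (\<pi> i u)) {..<n}" using i(5)[OF u] by simp
    also have "\<dots> = finsum U (\<lambda>i. b \<odot>\<^bsub>U\<^esub> (c i \<odot>\<^bsub>U\<^esub> \<eta> (\<pi> i u))) {..<n}"
      by (rule smult_finsum[OF i(2) b]) (simp add: cl)
    finally have "\<psi> (b \<odot>\<^bsub>U\<^esub> u) = \<psi> (finsum U (\<lambda>i. b \<odot>\<^bsub>U\<^esub> (c i \<odot>\<^bsub>U\<^esub> \<eta> (\<pi> i u))) {..<n})" by simp
    also have "\<dots> = finsum N (\<lambda>i. \<psi> (b \<odot>\<^bsub>U\<^esub> (c i \<odot>\<^bsub>U\<^esub> \<eta> (\<pi> i u)))) {..<n}"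
      by (rule additive_finsum[OF U.M.abelian_group_axioms N.M.abelian_group_axioms])
         (simp_all add: \<psi>D cl b U.smult_closed)
    also have "\<dots> = finsum N (\<lambda>i. b \<odot>\<^bsub>N\<^esub> (c i \<odot>\<^bsub>N\<^esub> \<phi> (\<pi> i u))) {..<n}"
    proof (rule N.M.finsum_cong')
      fix i assume "i \<in> {..<n}"
      then have i': "i < n" by simp
      have "b \<odot>\<^bsub>U\<^esub> (c i \<odot>\<^bsub>U\<^esub> \<eta> (\<pi> i u)) = (b \<otimes>\<^bsub>A\<^esub> c i) \<odot>\<^bsub>U\<^esub> \<eta> (\<pi> i u)"
        using b u i' by (simp add: U.smult_assoc c_closed i(7,8))
      then show "\<psi> (b \<odot>\<^bsub>U\<^esub> (c i \<odot>\<^bsub>U\<^esub> \<eta> (\<pi> i u))) = b \<odot>\<^bsub>N\<^esub> (c i \<odot>\<^bsub>N\<^esub> \<phi> (\<pi> i u))"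
        using b u i' by (simp add: \<psi>\<eta> N.smult_assoc c_closed i(8) \<phi>D)
    qed (simp_all add: N.smult_closed b u c_closed i(8) \<phi>D Pi_def)
    also have "\<dots> = b \<odot>\<^bsub>N\<^esub> \<psi> u"
      unfolding \<psi>_eq[OF u]
      by (rule smult_finsum[OF N b, symmetric]) (simp add: N.smult_closed u c_closed i(8) \<phi>D)
    finally show "\<psi> (b \<odot>\<^bsub>U\<^esub> u) = b \<odot>\<^bsub>N\<^esub> \<psi> u" .
  qed (simp_all add: \<psi>D)
  moreover have "\<psi> (\<eta> t) = \<phi> t" if "t \<in> carrier T" for t
    using \<psi>\<eta>[OF S.one_closed that] that by (simp add: U.smult_one N.smult_one i(7) \<phi>D)
  ultimately show thesis by (rule that)
qed

text \<open>The uniqueness half of the adjunction: the coordinate expansion shows that the image of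
  \<eta> generates \<open>U\<close> over \<open>A\<close>.\<close>

lemma induced_homs_eq:
  assumes ind: "induced T U \<eta> \<pi>" and N: "left_module A N"
    and f: "f \<in> module_homs A U N" and g: "g \<in> module_homs A U N"
    and eq: "\<And>t. t \<in> carrier T \<Longrightarrow> f (\<eta> t) = g (\<eta> t)" and u: "u \<in> carrier U"
  shows "f u = g u"
proof -
  note i = inducedD[OF ind]
  interpret U: left_module A U by (rule i(2))
  interpret N: left_module A N by (rule N)
  have cl: "c i \<odot>\<^bsub>U\<^esub> \<eta> (\<pi> i u) \<in> carrier U" if "i \<in> {..<n}" for i
    using that u by (simp add: U.smult_closed c_closed i(7,8))
  have "f u = finsum N (\<lambda>i. f (c i \<odot>\<^bsub>U\<^esub> \<eta> (\<pi> i u))) {..<n}"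
    using module_homs_finsum[where h="\<lambda>i. c i \<odot>\<^bsub>U\<^esub> \<eta> (\<pi> i u)" and I="{..<n}", OF f i(2) N cl] i(5)[OF u] by simp
  also have "\<dots> = finsum N (\<lambda>i. g (c i \<odot>\<^bsub>U\<^esub> \<eta> (\<pi> i u))) {..<n}"
    using u by (intro N.M.finsum_cong')
      (simp_all add: module_homsD[OF f] module_homsD[OF g] eq c_closed i(7,8) N.smult_closed Pi_def)
  also have "\<dots> = g u"
    using module_homs_finsum[where h="\<lambda>i. c i \<odot>\<^bsub>U\<^esub> \<eta> (\<pi> i u)" and I="{..<n}", OF g i(2) N cl] i(5)[OF u] by simp
  finally show ?thesis .
qed

text \<open>The map \<chi> \<otimes> T, written in coordinates as the sum of \<chi> (c i) times
  \<pi> i. Each summand is \<open>R\<close>-linear because \<chi> (c i) is central in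
  \<open>R\<close>: \<chi> is a bimodule map and \<open>c i\<close> centralizes
  \<open>R\<close>.\<close>

lemma induced_contraction:
  assumes ind: "induced T U \<eta> \<pi>" and \<chi>: "bimodule_functional \<chi>"
  obtains \<rho> where "\<rho> \<in> module_homs R (rs U) T"
    "\<And>b t. b \<in> carrier A \<Longrightarrow> t \<in> carrier T \<Longrightarrow> \<rho> (b \<odot>\<^bsub>U\<^esub> \<eta> t) = \<chi> b \<odot>\<^bsub>T\<^esub> t"
proof -
  note i = inducedD[OF ind] and x = bimodule_functionalD[OF \<chi>]
  interpret U: left_module A U by (rule i(2))
  interpret T: left_module R T by (rule i(1))
  let ?\<rho> = "\<lambda>u. finsum T (\<lambda>i. \<chi> (c i) \<odot>\<^bsub>T\<^esub> \<pi> i u) {..<n}"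
  have xc: "\<chi> (c i) \<otimes>\<^bsub>R\<^esub> r = r \<otimes>\<^bsub>R\<^esub> \<chi> (c i)" if "i < n" "r \<in> carrier R" for i r
    using x(3)[OF that(2) c_closed[OF that(1)]] x(4)[OF c_closed[OF that(1)] that(2)] c_central[OF that]
    by simp
  have "(\<lambda>t. \<chi> (c i) \<odot>\<^bsub>T\<^esub> t) \<in> module_homs R T T" if "i < n" for i
    by (rule module_homsI)
       (simp_all add: T.smult_closed T.smult_r_distr x(1) c_closed that xc flip: T.smult_assoc)
  then have "?\<rho> \<in> module_homs R (rs U) T"
    by (intro module_homs_sum[OF left_module_restrict_scalars[OF i(2)] i(1)] module_homs_comp[OF i(4)]) simp_all
  moreover have "?\<rho> (b \<odot>\<^bsub>U\<^esub> \<eta> t) = \<chi> b \<odot>\<^bsub>T\<^esub> t" if b: "b \<in> carrier A" and t: "t \<in> carrier T" for b t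
  proof -
    have "?\<rho> (b \<odot>\<^bsub>U\<^esub> \<eta> t) = finsum T (\<lambda>i. \<chi> (\<iota> (p i b) \<otimes>\<^bsub>A\<^esub> c i) \<odot>\<^bsub>T\<^esub> t) {..<n}"
    proof (rule T.M.finsum_cong')
      fix i assume "i \<in> {..<n}"
      then have i': "i < n" by simp
      show "\<chi> (c i) \<odot>\<^bsub>T\<^esub> \<pi> i (b \<odot>\<^bsub>U\<^esub> \<eta> t) = \<chi> (\<iota> (p i b) \<otimes>\<^bsub>A\<^esub> c i) \<odot>\<^bsub>T\<^esub> t"
        using b t i' by (simp add: i(6) x p_simps c_closed xc flip: T.smult_assoc)
    qed (simp_all add: b t x p_simps c_closed T.smult_closed Pi_def)
    also have "\<dots> = finsum R (\<lambda>i. \<chi> (\<iota> (p i b) \<otimes>\<^bsub>A\<^esub> c i)) {..<n} \<odot>\<^bsub>T\<^esub> t"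
      by (rule finsum_smult[OF i(1) t, symmetric]) (simp add: b x p_simps c_closed)
    also have "finsum R (\<lambda>i. \<chi> (\<iota> (p i b) \<otimes>\<^bsub>A\<^esub> c i)) {..<n} = \<chi> b"
      using bimodule_functional_finsum[OF \<chi>, of "{..<n}" "\<lambda>i. \<iota> (p i b) \<otimes>\<^bsub>A\<^esub> c i"] basis[OF b]
      by (simp add: b p_simps c_closed)
    finally show ?thesis .
  qed
  ultimately show thesis by (rule that)
qed

text \<open>The identification of \<open>A \<otimes> R\<close> with \<open>A\<close>, which lets
  free modules and the start of a coresolution be treated as induced.\<close>

lemma induced_regular: "induced (regular_module R) (regular_module A) \<iota> p"
proof -
  have "finsum (regular_module A) (\<lambda>i. c i \<otimes>\<^bsub>A\<^esub> \<iota> (p i u)) {..<n} = u" if u: "u \<in> carrier A" for u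
  proof -
    have ag: "abelian_group (regular_module A)"
      using left_module_regular[OF S.ring_axioms] by (rule abelian_group_left_module)
    have "finsum (regular_module A) (\<lambda>i. c i \<otimes>\<^bsub>A\<^esub> \<iota> (p i u)) {..<n} = finsum A (\<lambda>i. c i \<otimes>\<^bsub>A\<^esub> \<iota> (p i u)) {..<n}"
      by (rule additive_finsum[where f="\<lambda>x. x", OF S.abelian_group_axioms ag, symmetric])
         (simp_all add: c_closed p_simps u)
    also have "\<dots> = finsum A (\<lambda>i. \<iota> (p i u) \<otimes>\<^bsub>A\<^esub> c i) {..<n}"
      by (rule S.finsum_cong') (simp_all add: c_closed c_central p_simps u Pi_def)
    also have "\<dots> = u" by (rule basis[OF u])
    finally show ?thesis .
  qed
  then show ?thesis
    unfolding induced_def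
    by (intro conjI left_module_regular R.ring_axioms S.ring_axioms module_homsI allI impI ballI)
       (simp_all add: p_simps)
qed

text \<open>Over \<open>R\<close> the coordinate expansion of \<open>U\<close> is itself an
  \<open>add_decomposition\<close>, with n summands.\<close>

lemma in_add_restrict_induced:
  assumes ind: "induced T U \<eta> \<pi>"
  shows "in_add R T (rs U)"
proof -
  note i = inducedD[OF ind]
  interpret U: left_module A U by (rule i(2))
  have "finsum (rs U) (\<lambda>i. c i \<odot>\<^bsub>U\<^esub> \<eta> (\<pi> i u)) {..<n} = u" if "u \<in> carrier U" for u
    using finsum_restrict_scalars[OF U.M.abelian_group_axioms, of "{..<n}" "\<lambda>i. c i \<odot>\<^bsub>U\<^esub> \<eta> (\<pi> i u)"]
    by (simp add: that i(5,7,8) U.smult_closed c_closed)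
  then have "add_decomposition R T (rs U) {..<n} (\<lambda>i t. c i \<odot>\<^bsub>U\<^esub> \<eta> t) \<pi>"
    using module_homs_comp[OF i(3) module_homs_smult_c[OF i(2)]] i(4) by (simp add: add_decomposition_def)
  then show ?thesis by (rule in_addI[OF left_module_restrict_scalars[OF i(2)] i(1)])
qed

lemma in_add_restrict:
  assumes ind: "induced T U \<eta> \<pi>" and Q: "in_add A U Q"
  shows "in_add R T (rs Q)"
  by (rule in_add_trans[OF inducedD(1)[OF ind] in_add_restrict_induced[OF ind]
        in_add_restrict_scalars[OF inducedD(2)[OF ind] Q]])

section \<open>Induced maps and exactness, tested on coordinates\<close>

lemma induced_ext:
  assumes ind: "induced T U \<eta> \<pi>" and u: "u \<in> carrier U" and v: "v \<in> carrier U"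
    and eq: "\<And>i. i < n \<Longrightarrow> \<pi> i u = \<pi> i v"
  shows "u = v"
proof -
  note i = inducedD[OF ind]
  interpret U: left_module A U by (rule i(2))
  have "finsum U (\<lambda>i. c i \<odot>\<^bsub>U\<^esub> \<eta> (\<pi> i u)) {..<n} = finsum U (\<lambda>i. c i \<odot>\<^bsub>U\<^esub> \<eta> (\<pi> i v)) {..<n}"
    by (rule U.M.finsum_cong') (simp_all add: eq v U.smult_closed c_closed i(7,8) Pi_def)
  then show ?thesis using i(5) u v by simp
qed

text \<open>Says that f' is A \<otimes> f. It is a relation because \<eta> and the carrier of an
  induced module are fixed only up to isomorphism.\<close>

definition induced_map ::
    "('r, 'm, 'b) module_scheme \<Rightarrow> ('a, 'u, 'e) module_scheme \<Rightarrow> ('m \<Rightarrow> 'u)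
      \<Rightarrow> ('a, 'v, 'f) module_scheme \<Rightarrow> ('k \<Rightarrow> 'v) \<Rightarrow> ('m \<Rightarrow> 'k) \<Rightarrow> ('u \<Rightarrow> 'v) \<Rightarrow> bool" where
  "induced_map M U \<eta> V \<eta>' f f' \<longleftrightarrow> f' \<in> module_homs A U V \<and> (\<forall>t\<in>carrier M. f' (\<eta> t) = \<eta>' (f t))"

lemma induced_mapD:
  assumes "induced_map M U \<eta> V \<eta>' f f'"
  shows "f' \<in> module_homs A U V" "\<And>t. t \<in> carrier M \<Longrightarrow> f' (\<eta> t) = \<eta>' (f t)"
  using assms by (auto simp: induced_map_def)

lemma induced_map_exists:
  assumes "induced M U \<eta> \<pi>" "induced N V \<eta>' \<pi>'" "f \<in> module_homs R M N"
  shows "\<exists>f'. induced_map M U \<eta> V \<eta>' f f'"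
  using induced_extension[OF assms(1) inducedD(2)[OF assms(2)] module_homs_comp[OF assms(3) inducedD(3)[OF assms(2)]]]
  unfolding induced_map_def by metis

lemma induced_map_component:
  assumes U: "induced M U \<eta> \<pi>" and V: "induced N V \<eta>' \<pi>'" and f: "f \<in> module_homs R M N"
    and f': "induced_map M U \<eta> V \<eta>' f f'" and i: "i < n" and u: "u \<in> carrier U"
  shows "\<pi>' i (f' u) = f (\<pi> i u)"
proof -
  note a = inducedD[OF U] and b = inducedD[OF V] and h = induced_mapD[OF f']
  interpret U: left_module A U by (rule a(2))
  interpret V: left_module A V by (rule b(2))
  interpret N: left_module R N by (rule b(1))
  interpret M: left_module R M by (rule a(1))
  note f'R = module_homs_restrict_scalars[OF h(1)]
  have cl: "c j \<odot>\<^bsub>U\<^esub> \<eta> (\<pi> j u) \<in> carrier (rs U)" if "j \<in> {..<n}" for j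
    using that u by (simp add: U.smult_closed c_closed a(7,8))
  have rsU: "left_module R (rs U)" by (rule left_module_restrict_scalars[OF a(2)])
  have u': "finsum (rs U) (\<lambda>j. c j \<odot>\<^bsub>U\<^esub> \<eta> (\<pi> j u)) {..<n} = u"
    using finsum_restrict_scalars[OF U.M.abelian_group_axioms, of "{..<n}" "\<lambda>j. c j \<odot>\<^bsub>U\<^esub> \<eta> (\<pi> j u)"] cl a(5)[OF u]
    by simp
  have "\<pi>' i (f' u) = finsum N (\<lambda>j. \<pi>' i (f' (c j \<odot>\<^bsub>U\<^esub> \<eta> (\<pi> j u)))) {..<n}"
    using module_homs_finsum[where h="\<lambda>i. c i \<odot>\<^bsub>U\<^esub> \<eta> (\<pi> i u)" and I="{..<n}", OF module_homs_comp[OF f'R b(4)[OF i]] rsU b(1) cl] u' by simp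
  also have "\<dots> = finsum N (\<lambda>j. f (\<pi> i (c j \<odot>\<^bsub>U\<^esub> \<eta> (\<pi> j u)))) {..<n}"
    by (rule N.M.finsum_cong')
       (simp_all add: i u module_homsD[OF h(1)] h(2) c_closed a(6,7,8) b(6) module_homsD[OF f] p_simps
         N.smult_closed Pi_def)
  also have "\<dots> = f (\<pi> i u)"
    using module_homs_finsum[where h="\<lambda>i. c i \<odot>\<^bsub>U\<^esub> \<eta> (\<pi> i u)" and I="{..<n}", OF module_homs_comp[OF a(4)[OF i] f] rsU b(1) cl] u' by simp
  finally show ?thesis .
qed

text \<open>If each coordinate of v is the image of some m i, then v is the image of the sum of c i
  times \<eta> (m i), by the coordinate expansion of v.\<close>

lemma induced_image_iff:
  assumes U: "induced M U \<eta> \<pi>" and V: "induced N V \<eta>' \<pi>'" and f: "f \<in> module_homs R M N"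
    and f': "induced_map M U \<eta> V \<eta>' f f'" and v: "v \<in> carrier V"
  shows "v \<in> f' ` carrier U \<longleftrightarrow> (\<forall>i<n. \<pi>' i v \<in> f ` carrier M)"
proof
  note a = inducedD[OF U] and b = inducedD[OF V] and h = induced_mapD[OF f']
  assume "v \<in> f' ` carrier U"
  then show "\<forall>i<n. \<pi>' i v \<in> f ` carrier M"
    using induced_map_component[OF U V f f'] a(8) by auto
next
  note a = inducedD[OF U] and b = inducedD[OF V] and h = induced_mapD[OF f']
  interpret U: left_module A U by (rule a(2))
  interpret V: left_module A V by (rule b(2))
  assume "\<forall>i<n. \<pi>' i v \<in> f ` carrier M"
  then have "\<forall>i<n. \<exists>x\<in>carrier M. \<pi>' i v = f x" by blast
  then obtain m where m: "\<And>i. i < n \<Longrightarrow> m i \<in> carrier M \<and> \<pi>' i v = f (m i)" by metis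
  have cl: "c i \<odot>\<^bsub>U\<^esub> \<eta> (m i) \<in> carrier U" if "i \<in> {..<n}" for i
    using that m by (simp add: U.smult_closed c_closed a(7))
  have "v = finsum V (\<lambda>i. c i \<odot>\<^bsub>V\<^esub> \<eta>' (\<pi>' i v)) {..<n}" using b(5)[OF v] by simp
  also have "\<dots> = finsum V (\<lambda>i. f' (c i \<odot>\<^bsub>U\<^esub> \<eta> (m i))) {..<n}"
    by (rule V.M.finsum_cong')
       (simp_all add: m module_homsD[OF h(1)] h(2) c_closed a(7) b(7) module_homsD(1)[OF f] V.smult_closed Pi_def)
  also have "\<dots> = f' (finsum U (\<lambda>i. c i \<odot>\<^bsub>U\<^esub> \<eta> (m i)) {..<n})"
    by (rule module_homs_finsum[OF h(1) a(2) b(2) cl, symmetric])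
  finally show "v \<in> f' ` carrier U" using cl by (auto intro!: image_eqI U.M.finsum_closed)
qed

lemma induced_zero_iff:
  assumes U: "induced M U \<eta> \<pi>" and u: "u \<in> carrier U"
  shows "u = \<zero>\<^bsub>U\<^esub> \<longleftrightarrow> (\<forall>i<n. \<pi> i u = \<zero>\<^bsub>M\<^esub>)"
proof -
  note a = inducedD[OF U]
  interpret U: left_module A U by (rule a(2))
  have "\<pi> i \<zero>\<^bsub>U\<^esub> = \<zero>\<^bsub>M\<^esub>" if "i < n" for i
    using module_homs_zero[OF a(4)[OF that] left_module_restrict_scalars[OF a(2)] a(1)] by simp
  then show ?thesis using induced_ext[OF U u U.M.zero_closed] by auto
qed

text \<open>Membership in the image and in the kernel are both decided coordinate by coordinate,
  because coordinates commute with induced maps. This is flatness of \<open>A\<close>, without a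
  tensor product in sight.\<close>

lemma induced_exact:
  assumes U: "induced M U \<eta> \<pi>" and V: "induced N V \<eta>' \<pi>'" and W: "induced K W \<eta>'' \<pi>''"
    and f: "f \<in> module_homs R M N" and g: "g \<in> module_homs R N K"
    and f': "induced_map M U \<eta> V \<eta>' f f'" and g': "induced_map N V \<eta>' W \<eta>'' g g'"
    and ex: "f ` carrier M = a_kernel N K g"
  shows "f' ` carrier U = a_kernel V W g'"
proof -
  have "v \<in> f' ` carrier U \<longleftrightarrow> v \<in> a_kernel V W g'" if v: "v \<in> carrier V" for v
    unfolding induced_image_iff[OF U V f f' v] ex
    using v induced_zero_iff[OF W module_homsD(1)[OF induced_mapD(1)[OF g'] v]]
      induced_map_component[OF V W g g' _ v] inducedD(8)[OF V] by (simp add: a_kernel_iff)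
  moreover have "f' ` carrier U \<subseteq> carrier V" using module_homsD(1)[OF induced_mapD(1)[OF f']] by auto
  moreover have "a_kernel V W g' \<subseteq> carrier V" by (auto simp: a_kernel_iff)
  ultimately show ?thesis by blast
qed

lemma induced_surj:
  assumes U: "induced M U \<eta> \<pi>" and V: "induced N V \<eta>' \<pi>'" and f: "f \<in> module_homs R M N"
    and f': "induced_map M U \<eta> V \<eta>' f f'" and ex: "f ` carrier M = carrier N"
  shows "f' ` carrier U = carrier V"
  using induced_image_iff[OF U V f f'] module_homsD(1)[OF induced_mapD(1)[OF f']] inducedD(8)[OF V]
  unfolding ex by blast

lemma induced_inj:
  assumes U: "induced M U \<eta> \<pi>" and V: "induced N V \<eta>' \<pi>'" and f: "f \<in> module_homs R M N"
    and f': "induced_map M U \<eta> V \<eta>' f f'" and inj: "inj_on f (carrier M)"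
  shows "inj_on f' (carrier U)"
proof (rule inj_onI)
  fix u v assume uv: "u \<in> carrier U" "v \<in> carrier U" "f' u = f' v"
  have "f (\<pi> i u) = f (\<pi> i v)" if "i < n" for i
    using induced_map_component[OF U V f f' that] uv by metis
  then show "u = v"
    using induced_ext[OF U uv(1,2)] inj inducedD(8)[OF U] uv by (simp add: inj_on_eq_iff)
qed

text \<open>Induction is applied to each map of the decomposition. That the induced maps again sum
  to the identity is checked on the image of \<eta>', which determines \<open>A\<close>-linear
  maps.\<close>

lemma induced_in_add:
  assumes U: "induced T U \<eta> \<pi>" and V: "induced Q V \<eta>' \<pi>'" and add: "in_add R T Q"
  shows "in_add A U V"
proof -
  note a = inducedD[OF U] and b = inducedD[OF V]
  interpret V: left_module A V by (rule b(2))
  interpret Q: left_module R Q by (rule b(1))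
  obtain m :: nat and u g where dec: "add_decomposition R T Q {..<m} u g"
    by (rule in_addE[OF add a(1)])
  note d = add_decompositionD[OF dec]
  have "\<forall>j\<in>{..<m}. \<exists>f'. induced_map T U \<eta> V \<eta>' (u j) f'" "\<forall>j\<in>{..<m}. \<exists>f'. induced_map Q V \<eta>' U \<eta> (g j) f'"
    using induced_map_exists[OF U V d(2)] induced_map_exists[OF V U d(3)] by auto
  then obtain u' g' where u': "\<And>j. j \<in> {..<m} \<Longrightarrow> induced_map T U \<eta> V \<eta>' (u j) (u' j)"
    and g': "\<And>j. j \<in> {..<m} \<Longrightarrow> induced_map Q V \<eta>' U \<eta> (g j) (g' j)" by metis
  note ud = induced_mapD[OF u'] and gd = induced_mapD[OF g']
  let ?F = "\<lambda>v. finsum V (\<lambda>j. u' j (g' j v)) {..<m}"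
  have F: "?F \<in> module_homs A V V"
    by (rule module_homs_sum[OF b(2) b(2)]) (rule module_homs_comp[OF gd(1) ud(1)])
  have "?F (\<eta>' x) = \<eta>' x" if x: "x \<in> carrier Q" for x
  proof -
    have "?F (\<eta>' x) = finsum V (\<lambda>j. \<eta>' (u j (g j x))) {..<m}"
      by (rule V.M.finsum_cong')
         (simp_all add: ud(2) gd(2) x module_homsD(1)[OF d(3)] module_homsD(1)[OF d(2)] b(7) Pi_def)
    also have "\<dots> = \<eta>' (finsum Q (\<lambda>j. u j (g j x)) {..<m})"
      using additive_finsum[of Q V \<eta>' "{..<m}" "\<lambda>j. u j (g j x)"] module_homsD[OF b(3)]
        V.M.abelian_group_axioms Q.M.abelian_group_axioms x module_homsD(1)[OF d(3)] module_homsD(1)[OF d(2)] by simp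
    also have "\<dots> = \<eta>' x" using d(4)[OF x] by simp
    finally show ?thesis .
  qed
  then have "?F v = v" if "v \<in> carrier V" for v
    using induced_homs_eq[OF V b(2) F module_homs_id _ that] by simp
  then have "add_decomposition A U V {..<m} u' g'"
    using ud(1) gd(1) by (simp add: add_decomposition_def)
  then show ?thesis by (rule in_addI[OF b(2) a(2)])
qed

text \<open>By adjunction the problem is one about \<open>R\<close>-maps from \<open>N\<close> to
  \<open>U\<close>; its coordinates are n instances of the hypothesis. The resulting factors are
  recombined with the \<open>c i\<close> and extended \<open>A\<close>-linearly.\<close>

lemma induced_hom_exact:
  assumes M: "induced M M' \<eta>M \<pi>M" and N: "induced N N' \<eta>N \<pi>N" and K: "induced K K' \<eta>K \<pi>K"
    and T: "induced T U \<eta> \<pi>"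
    and f: "f \<in> module_homs R M N" and g: "g \<in> module_homs R N K"
    and f': "induced_map M M' \<eta>M N' \<eta>N f f'" and g': "induced_map N N' \<eta>N K' \<eta>K g g'"
    and ex: "hom_exact R M f N g K T"
  shows "hom_exact A M' f' N' g' K' U"
proof (rule hom_exactI)
  note m = inducedD[OF M] and nn = inducedD[OF N] and k = inducedD[OF K] and t = inducedD[OF T]
  note fd = induced_mapD[OF f'] and gd = induced_mapD[OF g']
  interpret U: left_module A U by (rule t(2))
  have rsU: "left_module R (rs U)" by (rule left_module_restrict_scalars[OF t(2)])
  fix \<phi> assume \<phi>: "\<phi> \<in> module_homs A N' U" and z: "\<And>x. x \<in> carrier M' \<Longrightarrow> \<phi> (f' x) = \<zero>\<^bsub>U\<^esub>"
  have \<phi>\<eta>: "(\<lambda>x. \<phi> (\<eta>N x)) \<in> module_homs R N (rs U)"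
    by (rule module_homs_comp[OF nn(3) module_homs_restrict_scalars[OF \<phi>]])
  have "\<exists>\<psi>\<in>module_homs R K T. \<forall>y\<in>carrier N. \<pi> i (\<phi> (\<eta>N y)) = \<psi> (g y)" if i: "i < n" for i
  proof (rule hom_exactD[OF ex module_homs_comp[OF \<phi>\<eta> t(4)[OF i]]])
    show "\<pi> i (\<phi> (\<eta>N (f x))) = \<zero>\<^bsub>T\<^esub>" if "x \<in> carrier M" for x
      using z[OF m(7)[OF that]] fd(2)[OF that] module_homs_zero[OF t(4)[OF i] rsU t(1)] by simp
  qed
  then obtain \<psi> where \<psi>: "\<And>i. i < n \<Longrightarrow> \<psi> i \<in> module_homs R K T"
    "\<And>i y. i < n \<Longrightarrow> y \<in> carrier N \<Longrightarrow> \<pi> i (\<phi> (\<eta>N y)) = \<psi> i (g y)" by metis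
  define \<psi>' where "\<psi>' x = finsum (rs U) (\<lambda>i. c i \<odot>\<^bsub>U\<^esub> \<eta> (\<psi> i x)) {..<n}" for x
  have \<psi>': "\<psi>' \<in> module_homs R K (rs U)"
    unfolding \<psi>'_def
    by (rule module_homs_sum[OF k(1) rsU])
       (rule module_homs_comp[OF module_homs_comp[OF \<psi>(1) t(3)] module_homs_smult_c[OF t(2)]], simp_all)
  obtain \<Psi> where \<Psi>: "\<Psi> \<in> module_homs A K' U" "\<And>x. x \<in> carrier K \<Longrightarrow> \<Psi> (\<eta>K x) = \<psi>' x"
    by (rule induced_extension[OF K t(2) \<psi>'], rule that)
  have "\<phi> y = \<Psi> (g' y)" if y: "y \<in> carrier N'" for y
  proof (rule induced_homs_eq[OF N t(2) \<phi> module_homs_comp[OF gd(1) \<Psi>(1)] _ y])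
    fix x assume x: "x \<in> carrier N"
    have gx: "g x \<in> carrier K" by (rule module_homsD(1)[OF g x])
    have ux: "\<phi> (\<eta>N x) \<in> carrier U" using module_homsD(1)[OF \<phi> nn(7)[OF x]] .
    have "\<psi>' (g x) = finsum U (\<lambda>i. c i \<odot>\<^bsub>U\<^esub> \<eta> (\<psi> i (g x))) {..<n}"
      unfolding \<psi>'_def
      by (rule finsum_restrict_scalars[OF U.M.abelian_group_axioms])
         (simp add: U.smult_closed c_closed t(7) module_homsD(1)[OF \<psi>(1)] gx)
    also have "\<dots> = finsum U (\<lambda>i. c i \<odot>\<^bsub>U\<^esub> \<eta> (\<pi> i (\<phi> (\<eta>N x)))) {..<n}"
      by (rule U.M.finsum_cong') (simp_all add: \<psi>(2)[OF _ x] U.smult_closed c_closed t(7) module_homsD(1)[OF \<psi>(1)] gx Pi_def)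
    also have "\<dots> = \<phi> (\<eta>N x)" by (rule t(5)[OF ux])
    finally show "\<phi> (\<eta>N x) = \<Psi> (g' (\<eta>N x))" by (simp add: gd(2) x \<Psi>(2) gx)
  qed
  then show "\<exists>\<psi>\<in>module_homs A K' U. \<forall>y\<in>carrier N'. \<phi> y = \<psi> (g' y)"
    using \<Psi>(1) by blast
qed

text \<open>Descent along a split extension. A map \<phi> into \<open>T\<close> is induced up to
  \<open>A\<close>, factored there, and recovered by the contraction \<rho> along \<open>q\<close>,
  which satisfies \<rho> \<eta> = 1. This yields the vanishing of Ext in the converse.\<close>

lemma hom_exact_of_induced:
  assumes M: "induced M M' \<eta>M \<pi>M" and N: "induced N N' \<eta>N \<pi>N" and K: "induced K K' \<eta>K \<pi>K"
    and T: "induced T U \<eta> \<pi>"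
    and f: "f \<in> module_homs R M N" and g: "g \<in> module_homs R N K"
    and f': "induced_map M M' \<eta>M N' \<eta>N f f'" and g': "induced_map N N' \<eta>N K' \<eta>K g g'"
    and q: "bimodule_functional q" "q \<one>\<^bsub>A\<^esub> = \<one>\<^bsub>R\<^esub>"
    and ex: "hom_exact A M' f' N' g' K' U"
  shows "hom_exact R M f N g K T"
proof (rule hom_exactI)
  note nn = inducedD[OF N] and k = inducedD[OF K] and t = inducedD[OF T]
  note fd = induced_mapD[OF f'] and gd = induced_mapD[OF g']
  interpret U: left_module A U by (rule t(2))
  interpret T: left_module R T by (rule t(1))
  obtain \<rho> where \<rho>: "\<rho> \<in> module_homs R (rs U) T"
    "\<And>b t. b \<in> carrier A \<Longrightarrow> t \<in> carrier T \<Longrightarrow> \<rho> (b \<odot>\<^bsub>U\<^esub> \<eta> t) = q b \<odot>\<^bsub>T\<^esub> t"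
    by (rule induced_contraction[OF T q(1)], rule that)
  have \<rho>\<eta>: "\<rho> (\<eta> x) = x" if "x \<in> carrier T" for x
    using \<rho>(2)[OF S.one_closed that] that by (simp add: q(2) U.smult_one T.smult_one t(7))
  fix \<phi> assume \<phi>: "\<phi> \<in> module_homs R N T" and z: "\<And>x. x \<in> carrier M \<Longrightarrow> \<phi> (f x) = \<zero>\<^bsub>T\<^esub>"
  obtain \<Phi> where \<Phi>: "\<Phi> \<in> module_homs A N' U" "\<And>x. x \<in> carrier N \<Longrightarrow> \<Phi> (\<eta>N x) = \<eta> (\<phi> x)"
    by (rule induced_extension[OF N t(2) module_homs_comp[OF \<phi> t(3)]], rule that)
  have \<eta>0: "\<eta> \<zero>\<^bsub>T\<^esub> = \<zero>\<^bsub>U\<^esub>"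
    using module_homs_zero[OF t(3) t(1) left_module_restrict_scalars[OF t(2)]] by simp
  have "\<Phi> (f' x) = \<zero>\<^bsub>U\<^esub>" if x: "x \<in> carrier M'" for x
    by (rule induced_homs_eq[OF M t(2) module_homs_comp[OF fd(1) \<Phi>(1)] module_homs_const_zero[OF t(2)] _ x])
       (simp add: fd(2) \<Phi>(2) module_homsD(1)[OF f] z \<eta>0)
  from hom_exactD[OF ex \<Phi>(1) this] obtain \<Psi> where \<Psi>: "\<Psi> \<in> module_homs A K' U"
    "\<And>y. y \<in> carrier N' \<Longrightarrow> \<Phi> y = \<Psi> (g' y)" by blast
  have "\<phi> y = \<rho> (\<Psi> (\<eta>K (g y)))" if y: "y \<in> carrier N" for y
    using \<Psi>(2)[OF nn(7)[OF y]] \<rho>\<eta>[OF module_homsD(1)[OF \<phi> y]] by (simp add: \<Phi>(2) gd(2) y)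
  then show "\<exists>\<psi>\<in>module_homs R K T. \<forall>y\<in>carrier N. \<phi> y = \<psi> (g y)"
    using module_homs_comp[OF module_homs_comp[OF k(3) module_homs_restrict_scalars[OF \<Psi>(1)]] \<rho>(1)]
    by (intro bexI[of _ "\<lambda>x. \<rho> (\<Psi> (\<eta>K x))"]) auto
qed

end

section \<open>The tensor product\<close>

lemma frag_extend_closed:
  assumes "Poly_Mapping.keys x \<subseteq> S" "\<And>z. z \<in> S \<Longrightarrow> Poly_Mapping.keys (f z) \<subseteq> S'"
  shows "Poly_Mapping.keys (frag_extend f x) \<subseteq> S'"
  using keys_frag_extend[of f x] assms by blast

context ring_hom_noncomm
begin

text \<open>Isolates the quotient construction behind balanced generators \<tau> x m, an induction
  principle and a universal property. The latter takes values in \<open>M\<close> because it serves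
  to define coordinates there; the induction uses differences, as induction over a free Abelian
  group does.\<close>

lemma extend_scalars_presentation:
  fixes M :: "('r, 'm, 'z) module_scheme"
  assumes M: "left_module R M"
  obtains \<tau> :: "'a \<Rightarrow> 'm \<Rightarrow> (('a \<times> 'm) \<Rightarrow>\<^sub>0 int) set" where
    "left_module A (extend_scalars R A \<iota> M)"
    "\<And>x m. x \<in> carrier A \<Longrightarrow> m \<in> carrier M \<Longrightarrow> \<tau> x m \<in> carrier (extend_scalars R A \<iota> M)"
    "\<And>x y m. x \<in> carrier A \<Longrightarrow> y \<in> carrier A \<Longrightarrow> m \<in> carrier M \<Longrightarrow>
      \<tau> (x \<oplus>\<^bsub>A\<^esub> y) m = \<tau> x m \<oplus>\<^bsub>extend_scalars R A \<iota> M\<^esub> \<tau> y m"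
    "\<And>x m m'. x \<in> carrier A \<Longrightarrow> m \<in> carrier M \<Longrightarrow> m' \<in> carrier M \<Longrightarrow>
      \<tau> x (m \<oplus>\<^bsub>M\<^esub> m') = \<tau> x m \<oplus>\<^bsub>extend_scalars R A \<iota> M\<^esub> \<tau> x m'"
    "\<And>x r m. x \<in> carrier A \<Longrightarrow> r \<in> carrier R \<Longrightarrow> m \<in> carrier M \<Longrightarrow>
      \<tau> (x \<otimes>\<^bsub>A\<^esub> \<iota> r) m = \<tau> x (r \<odot>\<^bsub>M\<^esub> m)"
    "\<And>a x m. a \<in> carrier A \<Longrightarrow> x \<in> carrier A \<Longrightarrow> m \<in> carrier M \<Longrightarrow>
      a \<odot>\<^bsub>extend_scalars R A \<iota> M\<^esub> \<tau> x m = \<tau> (a \<otimes>\<^bsub>A\<^esub> x) m"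
    "\<And>P u. u \<in> carrier (extend_scalars R A \<iota> M) \<Longrightarrow> P \<zero>\<^bsub>extend_scalars R A \<iota> M\<^esub> \<Longrightarrow>
      (\<And>u v. u \<in> carrier (extend_scalars R A \<iota> M) \<Longrightarrow> v \<in> carrier (extend_scalars R A \<iota> M) \<Longrightarrow>
        P u \<Longrightarrow> P v \<Longrightarrow> P (u \<ominus>\<^bsub>extend_scalars R A \<iota> M\<^esub> v)) \<Longrightarrow>
      (\<And>x m. x \<in> carrier A \<Longrightarrow> m \<in> carrier M \<Longrightarrow> P (\<tau> x m)) \<Longrightarrow> P u"
    "\<And>b. (\<And>x m. x \<in> carrier A \<Longrightarrow> m \<in> carrier M \<Longrightarrow> b x m \<in> carrier M) \<Longrightarrow>
      (\<And>x y m. x \<in> carrier A \<Longrightarrow> y \<in> carrier A \<Longrightarrow> m \<in> carrier M \<Longrightarrow>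
        b (x \<oplus>\<^bsub>A\<^esub> y) m = b x m \<oplus>\<^bsub>M\<^esub> b y m) \<Longrightarrow>
      (\<And>x m m'. x \<in> carrier A \<Longrightarrow> m \<in> carrier M \<Longrightarrow> m' \<in> carrier M \<Longrightarrow>
        b x (m \<oplus>\<^bsub>M\<^esub> m') = b x m \<oplus>\<^bsub>M\<^esub> b x m') \<Longrightarrow>
      (\<And>x r m. x \<in> carrier A \<Longrightarrow> r \<in> carrier R \<Longrightarrow> m \<in> carrier M \<Longrightarrow>
        b (x \<otimes>\<^bsub>A\<^esub> \<iota> r) m = b x (r \<odot>\<^bsub>M\<^esub> m)) \<Longrightarrow>
      \<exists>\<phi>. (\<forall>u\<in>carrier (extend_scalars R A \<iota> M). \<phi> u \<in> carrier M) \<and>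
        (\<forall>u\<in>carrier (extend_scalars R A \<iota> M). \<forall>v\<in>carrier (extend_scalars R A \<iota> M).
          \<phi> (u \<oplus>\<^bsub>extend_scalars R A \<iota> M\<^esub> v) = \<phi> u \<oplus>\<^bsub>M\<^esub> \<phi> v) \<and>
        (\<forall>x\<in>carrier A. \<forall>m\<in>carrier M. \<phi> (\<tau> x m) = b x m)"
proof -
  interpret M: left_module R M by fact
  let ?E = "carrier A \<times> carrier M"
  define F where "F = free_Abelian_group ?E"
  define rel where "rel = tensor_relations R (ring_bimodule A id \<iota>) M"
  define K where "K = generate F rel"
  define h where "h a = frag_extend (\<lambda>(x, m). frag_of (a \<otimes>\<^bsub>A\<^esub> x, m) :: ('a \<times> 'm) \<Rightarrow>\<^sub>0 int)" for a
  let ?U = "extend_scalars R A \<iota> M"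
  interpret F: comm_group F unfolding F_def by (rule abelian_free_Abelian_group)
  have Fc: "u \<in> carrier F \<longleftrightarrow> Poly_Mapping.keys u \<subseteq> ?E" for u by (simp add: F_def)
  have Fm: "u \<otimes>\<^bsub>F\<^esub> v = u + v" "\<one>\<^bsub>F\<^esub> = 0" for u v by (simp_all add: F_def)
  have Fadd: "u + v \<in> carrier F" if "u \<in> carrier F" "v \<in> carrier F" for u v
    using F.m_closed[OF that] by (simp add: Fm)
  have Fdiff: "u - v \<in> carrier F" if "u \<in> carrier F" "v \<in> carrier F" for u v
    using that keys_diff[of u v] by (auto simp: Fc)
  have F0: "0 \<in> carrier F" using F.one_closed by (simp add: Fm)
  have Finv: "inv\<^bsub>F\<^esub> u = - u" if "u \<in> carrier F" for u using that by (simp add: F_def)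
  have Fgen: "frag_of (x, m) \<in> carrier F" if "x \<in> carrier A" "m \<in> carrier M" for x m
    using that by (simp add: Fc)
  have relF: "rel \<subseteq> carrier F"
    unfolding rel_def tensor_relations_def ring_bimodule_simps
    by (intro Un_least subsetI; elim CollectE exE conjE; hypsubst;
        intro Fdiff Fgen S.m_closed S.a_closed M.M.a_closed M.smult_closed hom_closed; assumption)
  have K: "subgroup K F" unfolding K_def by (rule F.generate_is_subgroup[OF relF])
  interpret K: subgroup K F by (rule K)
  interpret N: normal K F by (rule F.subgroup_imp_normal[OF K])
  have KF: "u \<in> carrier F" if "u \<in> K" for u using that K.subset by blast
  have K0: "0 \<in> K" using K.one_closed by (simp add: Fm)
  have Kadd: "u + v \<in> K" if "u \<in> K" "v \<in> K" for u v using K.m_closed[OF that] by (simp add: Fm)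
  have Kdiff: "u - v \<in> K" if "u \<in> K" "v \<in> K" for u v
    using K.m_closed[OF that(1) K.m_inv_closed[OF that(2)]] that by (simp add: Fm Finv KF)
  have relK: "u \<in> K" if "u \<in> rel" for u unfolding K_def by (rule generate.incl[OF that])
  define co where "co u = K #>\<^bsub>F\<^esub> u" for u
  have co_mem: "v \<in> co u \<longleftrightarrow> (\<exists>k\<in>K. v = k + u)" for u v
    by (simp add: co_def r_coset_def Fm)
  have co_eq: "co u = co v \<longleftrightarrow> u - v \<in> K" if "u \<in> carrier F" "v \<in> carrier F" for u v
  proof
    assume "co u = co v"
    moreover have "u \<in> co u" using K0 by (auto simp: co_mem)
    ultimately show "u - v \<in> K" by (auto simp: co_mem)
  next
    assume k: "u - v \<in> K"
    show "co u = co v"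
    proof (intro equalityI subsetI)
      fix w assume "w \<in> co u"
      then obtain k' where "k' \<in> K" "w = k' + u" by (auto simp: co_mem)
      then have "w = (k' + (u - v)) + v" "k' + (u - v) \<in> K" using Kadd[OF _ k] by simp_all
      then show "w \<in> co v" unfolding co_mem by blast
    next
      fix w assume "w \<in> co v"
      then obtain k' where "k' \<in> K" "w = k' + v" by (auto simp: co_mem)
      then have "w = (k' - (u - v)) + u" "k' - (u - v) \<in> K" using Kdiff[OF _ k] by simp_all
      then show "w \<in> co u" unfolding co_mem by blast
    qed
  qed
  have U: "carrier ?U = carrier (F Mod K)" "\<zero>\<^bsub>?U\<^esub> = \<one>\<^bsub>F Mod K\<^esub>" "add ?U = monoid.mult (F Mod K)"
    "smult ?U = (\<lambda>a C. K <#>\<^bsub>F\<^esub> (h a ` C))"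
    by (simp_all add: extend_scalars_def tensor_product_def Let_def F_def K_def h_def rel_def)
  have Uc: "carrier ?U = co ` carrier F" by (simp add: U carrier_FactGroup co_def)
  have Uc': "co u \<in> carrier ?U" if "u \<in> carrier F" for u using that by (simp add: Uc)
  have U0: "\<zero>\<^bsub>?U\<^esub> = co 0"
    unfolding U by (simp add: FactGroup_def co_def r_coset_def Fm)
  have Uadd: "co u \<oplus>\<^bsub>?U\<^esub> co v = co (u + v)" if "u \<in> carrier F" "v \<in> carrier F" for u v
    unfolding U using N.rcos_sum[OF that] by (simp add: co_def Fm)
  have h_add: "h a (u + v) = h a u + h a v" for a u v by (simp add: h_def frag_extend_add)
  have h_diff: "h a (u - v) = h a u - h a v" for a u v by (simp add: h_def frag_extend_diff)
  have h_gen: "h a (frag_of (x, m)) = frag_of (a \<otimes>\<^bsub>A\<^esub> x, m)" for a x m by (simp add: h_def)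
  have h0: "h a 0 = 0" for a by (simp add: h_def)
  have hF: "h a u \<in> carrier F" if "a \<in> carrier A" "u \<in> carrier F" for a u
    unfolding Fc h_def by (rule frag_extend_closed) (use that in \<open>auto simp: Fc\<close>)
  have relI: "x \<in> carrier A \<Longrightarrow> y \<in> carrier A \<Longrightarrow> m \<in> carrier M \<Longrightarrow>
      frag_of (x \<oplus>\<^bsub>A\<^esub> y, m) - frag_of (x, m) - frag_of (y, m) \<in> rel"
    "x \<in> carrier A \<Longrightarrow> m \<in> carrier M \<Longrightarrow> m' \<in> carrier M \<Longrightarrow>
      frag_of (x, m \<oplus>\<^bsub>M\<^esub> m') - frag_of (x, m) - frag_of (x, m') \<in> rel"
    "x \<in> carrier A \<Longrightarrow> r \<in> carrier R \<Longrightarrow> m \<in> carrier M \<Longrightarrow>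
      frag_of (x \<otimes>\<^bsub>A\<^esub> \<iota> r, m) - frag_of (x, r \<odot>\<^bsub>M\<^esub> m) \<in> rel" for x y m m' r
    unfolding rel_def tensor_relations_def ring_bimodule_simps by blast+
  have relE: "Q u" if "u \<in> rel"
    "\<And>x y m. x \<in> carrier A \<Longrightarrow> y \<in> carrier A \<Longrightarrow> m \<in> carrier M \<Longrightarrow>
      Q (frag_of (x \<oplus>\<^bsub>A\<^esub> y, m) - frag_of (x, m) - frag_of (y, m))"
    "\<And>x m m'. x \<in> carrier A \<Longrightarrow> m \<in> carrier M \<Longrightarrow> m' \<in> carrier M \<Longrightarrow>
      Q (frag_of (x, m \<oplus>\<^bsub>M\<^esub> m') - frag_of (x, m) - frag_of (x, m'))"
    "\<And>x r m. x \<in> carrier A \<Longrightarrow> r \<in> carrier R \<Longrightarrow> m \<in> carrier M \<Longrightarrow>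
      Q (frag_of (x \<otimes>\<^bsub>A\<^esub> \<iota> r, m) - frag_of (x, r \<odot>\<^bsub>M\<^esub> m))" for Q u
    using that(1) unfolding rel_def tensor_relations_def ring_bimodule_simps
    by (elim UnE CollectE exE conjE) (simp_all only: that(2-4))
  \<comment> \<open>Left multiplication sends each relation to one of the same kind, since it is
    additive and commutes with the right action. Hence it preserves the generated subgroup
    \<open>K\<close>.\<close>
  have h_rel: "h a u \<in> rel" if "u \<in> rel" "a \<in> carrier A" for a u
    using that(1)
    by (rule relE)
       (simp_all only: h_diff h_gen S.r_distr that(2) relI S.m_closed M.M.a_closed M.smult_closed
          hom_closed flip: S.m_assoc)
  have hK: "h a u \<in> K" if "u \<in> K" "a \<in> carrier A" for a u
    using that(1) unfolding K_def
  proof (induction u rule: generate.induct)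
    case one then show ?case by (simp add: Fm h0 generate.one[of F, unfolded Fm])
  next
    case (incl u) then show ?case using h_rel[OF _ that(2)] by (intro generate.incl)
  next
    case (inv u)
    then have "u \<in> carrier F" using relF by blast
    moreover have "h a (- u) = - h a u" using h_diff[of a 0 u] by (simp add: h0)
    ultimately show ?case
      using generate.inv[OF h_rel[OF inv that(2)], of F] hF[OF that(2)] by (simp add: Finv)
  next
    case (eng u v) then show ?case using generate.eng by (force simp: Fm h_add)
  qed
  have Usmult: "a \<odot>\<^bsub>?U\<^esub> co u = co (h a u)" if "a \<in> carrier A" "u \<in> carrier F" for a u
  proof -
    have "K <#>\<^bsub>F\<^esub> (h a ` co u) = co (h a u)"
    proof (intro equalityI subsetI)
      fix w assume "w \<in> K <#>\<^bsub>F\<^esub> (h a ` co u)"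
      then obtain k k' where "k \<in> K" "k' \<in> K" "w = k + h a (k' + u)"
        by (auto simp: set_mult_def Fm co_mem)
      then have "w = (k + h a k') + h a u" "k + h a k' \<in> K"
        using Kadd[OF _ hK[OF _ that(1)]] by (simp_all add: h_add add.assoc)
      then show "w \<in> co (h a u)" unfolding co_mem by blast
    next
      fix w assume "w \<in> co (h a u)"
      then obtain k where k: "k \<in> K" "w = k + h a u" by (auto simp: co_mem)
      moreover have "u \<in> co u" using K0 by (auto simp: co_mem)
      ultimately show "w \<in> K <#>\<^bsub>F\<^esub> (h a ` co u)" by (auto simp: set_mult_def Fm)
    qed
    then show ?thesis by (simp add: U)
  qed
  \<comment> \<open>Two additive endomorphisms of the free group that agree modulo \<open>K\<close>
    on generators agree modulo \<open>K\<close> everywhere. This reduces the module axioms to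
    identities between single pairs.\<close>
  have hom_eq: "co (f u) = co (g u)" if u: "u \<in> carrier F"
    and fd: "\<And>u v. f (u - v) = f u - f v" and gd: "\<And>u v. g (u - v) = g u - g v"
    and fF: "\<And>u. u \<in> carrier F \<Longrightarrow> f u \<in> carrier F" and gF: "\<And>u. u \<in> carrier F \<Longrightarrow> g u \<in> carrier F"
    and gen: "\<And>x m. x \<in> carrier A \<Longrightarrow> m \<in> carrier M \<Longrightarrow> f (frag_of (x, m)) - g (frag_of (x, m)) \<in> K"
    for f g u
  proof -
    have "f u - g u \<in> K"
      using u unfolding Fc
    proof (induction u rule: free_Abelian_group_induct[consumes 1, case_names zero diff gen])
      case zero
      show ?case using fd[of 0 0] gd[of 0 0] K0 by simp
    next
      case (diff u v)
      then show ?case using Kdiff[of "f u - g u" "f v - g v"] by (simp add: fd gd algebra_simps)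
    qed (use gen in auto)
    then show ?thesis using co_eq fF gF u by simp
  qed
  have "abelian_group ?U"
  proof (rule abelian_groupI)
    fix x assume "x \<in> carrier ?U"
    then obtain u where u: "x = co u" "u \<in> carrier F" by (auto simp: Uc)
    then show "\<exists>y\<in>carrier ?U. y \<oplus>\<^bsub>?U\<^esub> x = \<zero>\<^bsub>?U\<^esub>"
      using Fdiff[OF F0 u(2)] by (intro bexI[of _ "co (- u)"]) (simp_all add: Uadd U0 Uc')
  qed (auto simp: Uc U0 Uadd Fadd F0 add_ac simp del: set_eq_iff intro!: imageI arg_cong[where f=co])
  moreover have "left_module_axioms A ?U"
  proof
    fix a b x assume a: "a \<in> carrier A" and b: "b \<in> carrier A" and x: "x \<in> carrier ?U"
    from x obtain u where u: "x = co u" "u \<in> carrier F" by (auto simp: Uc)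
    show "(a \<oplus>\<^bsub>A\<^esub> b) \<odot>\<^bsub>?U\<^esub> x = a \<odot>\<^bsub>?U\<^esub> x \<oplus>\<^bsub>?U\<^esub> b \<odot>\<^bsub>?U\<^esub> x"
    proof -
      have "co (h (a \<oplus>\<^bsub>A\<^esub> b) u) = co (h a u + h b u)"
      proof (rule hom_eq[OF u(2)])
        fix y m assume "y \<in> carrier A" "m \<in> carrier M"
        then show "h (a \<oplus>\<^bsub>A\<^esub> b) (frag_of (y, m)) - (h a (frag_of (y, m)) + h b (frag_of (y, m))) \<in> K"
          unfolding h_gen diff_diff_add[symmetric] using a b
          by (simp only: S.l_distr) (intro relK relI S.m_closed)
      qed (simp_all add: h_diff hF a b Fadd)
      then show ?thesis using a b u by (simp add: Usmult Uadd hF)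
    qed
    show "(a \<otimes>\<^bsub>A\<^esub> b) \<odot>\<^bsub>?U\<^esub> x = a \<odot>\<^bsub>?U\<^esub> (b \<odot>\<^bsub>?U\<^esub> x)"
    proof -
      have "co (h (a \<otimes>\<^bsub>A\<^esub> b) u) = co (h a (h b u))"
        by (rule hom_eq[OF u(2)]) (simp_all add: h_diff hF a b h_gen S.m_assoc K0)
      then show ?thesis using a b u by (simp add: Usmult hF)
    qed
  next
    fix a x assume "a \<in> carrier A" "x \<in> carrier ?U"
    then show "a \<odot>\<^bsub>?U\<^esub> x \<in> carrier ?U" by (auto simp: Uc Usmult hF)
  next
    fix a x y assume "a \<in> carrier A" "x \<in> carrier ?U" "y \<in> carrier ?U"
    then show "a \<odot>\<^bsub>?U\<^esub> (x \<oplus>\<^bsub>?U\<^esub> y) = a \<odot>\<^bsub>?U\<^esub> x \<oplus>\<^bsub>?U\<^esub> a \<odot>\<^bsub>?U\<^esub> y"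
      by (auto simp: Uc Usmult Uadd Fadd hF h_add)
  next
    fix x assume "x \<in> carrier ?U"
    then obtain u where u: "x = co u" "u \<in> carrier F" by (auto simp: Uc)
    have "co (h \<one>\<^bsub>A\<^esub> u) = co u"
      by (rule hom_eq[OF u(2)]) (simp_all add: h_diff hF h_gen K0)
    then show "\<one>\<^bsub>A\<^esub> \<odot>\<^bsub>?U\<^esub> x = x" using u by (simp add: Usmult)
  qed
  ultimately have lm: "left_module A ?U" using S.ring_axioms by (simp add: left_module_def)
  interpret U: left_module A ?U by (rule lm)
  have Udiff: "co u \<ominus>\<^bsub>?U\<^esub> co v = co (u - v)" if "u \<in> carrier F" "v \<in> carrier F" for u v
  proof -
    have "co (- v) \<oplus>\<^bsub>?U\<^esub> co v = \<zero>\<^bsub>?U\<^esub>" "co (- v) \<in> carrier ?U"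
      using Fdiff[OF F0 that(2)] that by (simp_all add: Uadd U0 Uc')
    then have "\<ominus>\<^bsub>?U\<^esub> co v = co (- v)" using U.M.minus_equality that by (simp add: Uc')
    then show ?thesis using Fdiff[OF F0 that(2)] that by (simp add: a_minus_def Uadd)
  qed
  show thesis
  proof (rule that[of "\<lambda>x m. co (frag_of (x, m))", OF lm])
    show "co (frag_of (x, m)) \<in> carrier ?U" if "x \<in> carrier A" "m \<in> carrier M" for x m
      using that by (intro Uc' Fgen)
    show "co (frag_of (x \<oplus>\<^bsub>A\<^esub> y, m)) = co (frag_of (x, m)) \<oplus>\<^bsub>?U\<^esub> co (frag_of (y, m))"
      if "x \<in> carrier A" "y \<in> carrier A" "m \<in> carrier M" for x y m
    proof -
      have "frag_of (x \<oplus>\<^bsub>A\<^esub> y, m) - (frag_of (x, m) + frag_of (y, m)) \<in> K"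
        unfolding diff_diff_add[symmetric] using that by (intro relK relI)
      then show ?thesis using that by (simp add: Uadd Fgen co_eq Fadd del: Fc)
    qed
    show "co (frag_of (x, m \<oplus>\<^bsub>M\<^esub> m')) = co (frag_of (x, m)) \<oplus>\<^bsub>?U\<^esub> co (frag_of (x, m'))"
      if "x \<in> carrier A" "m \<in> carrier M" "m' \<in> carrier M" for x m m'
    proof -
      have "frag_of (x, m \<oplus>\<^bsub>M\<^esub> m') - (frag_of (x, m) + frag_of (x, m')) \<in> K"
        unfolding diff_diff_add[symmetric] using that by (intro relK relI)
      then show ?thesis using that by (simp add: Uadd Fgen co_eq Fadd)
    qed
    show "co (frag_of (x \<otimes>\<^bsub>A\<^esub> \<iota> r, m)) = co (frag_of (x, r \<odot>\<^bsub>M\<^esub> m))"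
      if "x \<in> carrier A" "r \<in> carrier R" "m \<in> carrier M" for x r m
    proof -
      have "frag_of (x \<otimes>\<^bsub>A\<^esub> \<iota> r, m) - frag_of (x, r \<odot>\<^bsub>M\<^esub> m) \<in> K"
        using that by (intro relK relI)
      then show ?thesis using that by (simp add: Fgen co_eq M.smult_closed)
    qed
    show "a \<odot>\<^bsub>?U\<^esub> co (frag_of (x, m)) = co (frag_of (a \<otimes>\<^bsub>A\<^esub> x, m))"
      if "a \<in> carrier A" "x \<in> carrier A" "m \<in> carrier M" for a x m
      using that by (simp add: Usmult Fgen h_gen)
    show "P u" if u: "u \<in> carrier ?U" and P0: "P \<zero>\<^bsub>?U\<^esub>"
      and Pd: "\<And>u v. u \<in> carrier ?U \<Longrightarrow> v \<in> carrier ?U \<Longrightarrow> P u \<Longrightarrow> P v \<Longrightarrow> P (u \<ominus>\<^bsub>?U\<^esub> v)"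
      and Pg: "\<And>x m. x \<in> carrier A \<Longrightarrow> m \<in> carrier M \<Longrightarrow> P (co (frag_of (x, m)))" for P u
    proof -
      obtain w where w: "u = co w" "Poly_Mapping.keys w \<subseteq> ?E" using u by (auto simp: Uc Fc)
      have "P (co w)"
        using w(2)
      proof (induction w rule: free_Abelian_group_induct[consumes 1, case_names zero diff gen])
        case (diff x y)
        then have "x \<in> carrier F" "y \<in> carrier F" by (simp_all add: Fc)
        then show ?case using Pd[of "co x" "co y"] diff by (simp add: Udiff Uc')
      qed (use P0 Pg in \<open>auto simp: U0\<close>)
      then show ?thesis by (simp add: w)
    qed
    fix b assume b: "\<And>x m. x \<in> carrier A \<Longrightarrow> m \<in> carrier M \<Longrightarrow> b x m \<in> carrier M"
      and b1: "\<And>x y m. x \<in> carrier A \<Longrightarrow> y \<in> carrier A \<Longrightarrow> m \<in> carrier M \<Longrightarrow>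
        b (x \<oplus>\<^bsub>A\<^esub> y) m = b x m \<oplus>\<^bsub>M\<^esub> b y m"
      and b2: "\<And>x m m'. x \<in> carrier A \<Longrightarrow> m \<in> carrier M \<Longrightarrow> m' \<in> carrier M \<Longrightarrow>
        b x (m \<oplus>\<^bsub>M\<^esub> m') = b x m \<oplus>\<^bsub>M\<^esub> b x m'"
      and b3: "\<And>x r m. x \<in> carrier A \<Longrightarrow> r \<in> carrier R \<Longrightarrow> m \<in> carrier M \<Longrightarrow>
        b (x \<otimes>\<^bsub>A\<^esub> \<iota> r) m = b x (r \<odot>\<^bsub>M\<^esub> m)"
    have "(\<lambda>(x, m). b x m) ` ?E \<subseteq> carrier (add_monoid M)" using b by auto
    then obtain f where f: "f \<in> hom F (add_monoid M)" and fg: "\<And>z. z \<in> ?E \<Longrightarrow> f (frag_of z) = (\<lambda>(x, m). b x m) z"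
      using comm_group.free_Abelian_group_universal[OF M.M.a_comm_group] unfolding F_def by blast
    have fc: "f u \<in> carrier M" if "u \<in> carrier F" for u using f that by (auto simp: hom_def)
    have fadd: "f (u + v) = f u \<oplus>\<^bsub>M\<^esub> f v" if "u \<in> carrier F" "v \<in> carrier F" for u v
      using Group.hom_mult[OF f that] by (simp add: Fm)
    have fd: "f (u - v) = f u \<ominus>\<^bsub>M\<^esub> f v" if uv: "u \<in> carrier F" "v \<in> carrier F" for u v
    proof -
      have "f u = f (u - v) \<oplus>\<^bsub>M\<^esub> f v" using fadd[OF Fdiff[OF uv] uv(2)] by simp
      then show ?thesis using fc uv Fdiff[OF uv] by (simp add: a_minus_def M.M.a_assoc M.M.r_neg)
    qed
    have fg': "f (frag_of (x, m)) = b x m" if "x \<in> carrier A" "m \<in> carrier M" for x m using fg that by simp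
    have z: "b x m \<ominus>\<^bsub>M\<^esub> b x m = \<zero>\<^bsub>M\<^esub>" if "x \<in> carrier A" "m \<in> carrier M" for x m
      using b[OF that] by (simp add: a_minus_def M.M.r_neg)
    have sub2: "(s \<oplus>\<^bsub>M\<^esub> t) \<ominus>\<^bsub>M\<^esub> s \<ominus>\<^bsub>M\<^esub> t = \<zero>\<^bsub>M\<^esub>" if "s \<in> carrier M" "t \<in> carrier M" for s t
    proof -
      have "(s \<oplus>\<^bsub>M\<^esub> t) \<ominus>\<^bsub>M\<^esub> s \<ominus>\<^bsub>M\<^esub> t = (s \<ominus>\<^bsub>M\<^esub> s) \<oplus>\<^bsub>M\<^esub> (t \<ominus>\<^bsub>M\<^esub> t)"
        unfolding a_minus_def using that by (simp add: M.M.a_ac)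
      then show ?thesis using that by (simp add: a_minus_def M.M.r_neg)
    qed
    \<comment> \<open>The balancedness of b says that f kills every relation, so f factors through
      the quotient.\<close>
    have "rel \<subseteq> kernel F (add_monoid M) f"
    proof
      fix u assume u: "u \<in> rel"
      have "f u = \<zero>\<^bsub>M\<^esub>"
        using u by (rule relE) (simp_all add: fd Fgen Fdiff fg' b b1 b2 b3 sub2 z M.smult_closed del: Fc)
      then show "u \<in> kernel F (add_monoid M) f" using u relF by (auto simp: kernel_def)
    qed
    moreover have "group_hom F (add_monoid M) f"
      using f M.M.a_group F.is_group by (simp add: group_hom_def group_hom_axioms_def)
    ultimately have "K \<subseteq> kernel F (add_monoid M) f"
      unfolding K_def by (intro F.generate_subgroup_incl group_hom.subgroup_kernel)
    then have fK: "f u = \<zero>\<^bsub>M\<^esub>" if "u \<in> K" for u using that by (auto simp: kernel_def)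
    have fco: "f u = f v" if uv: "u \<in> carrier F" "v \<in> carrier F" "K #>\<^bsub>F\<^esub> u = K #>\<^bsub>F\<^esub> v" for u v
    proof -
      have "u - v \<in> K" using co_eq[OF uv(1,2)] uv(3) by (simp add: co_def)
      then show ?thesis using fadd[OF Fdiff[OF uv(1,2)] uv(2)] fK fc uv by simp
    qed
    obtain g where g: "g \<in> hom (F Mod K) (add_monoid M)" "\<And>u. u \<in> carrier F \<Longrightarrow> g (K #>\<^bsub>F\<^esub> u) = f u"
      by (rule FactGroup_universal[OF f N.normal_axioms fco], assumption, assumption, assumption, rule that)
    have "\<forall>u\<in>carrier ?U. g u \<in> carrier M" using g(1) by (auto simp: U hom_def)
    moreover have "\<forall>u\<in>carrier ?U. \<forall>v\<in>carrier ?U. g (u \<oplus>\<^bsub>?U\<^esub> v) = g u \<oplus>\<^bsub>M\<^esub> g v"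
      using Group.hom_mult[OF g(1)] by (simp add: U)
    moreover have "\<forall>x\<in>carrier A. \<forall>m\<in>carrier M. g (co (frag_of (x, m))) = b x m"
      using g(2) fg' by (simp add: co_def Fgen)
    ultimately show "\<exists>\<phi>. (\<forall>u\<in>carrier ?U. \<phi> u \<in> carrier M) \<and>
        (\<forall>u\<in>carrier ?U. \<forall>v\<in>carrier ?U. \<phi> (u \<oplus>\<^bsub>?U\<^esub> v) = \<phi> u \<oplus>\<^bsub>M\<^esub> \<phi> v) \<and>
        (\<forall>x\<in>carrier A. \<forall>m\<in>carrier M. \<phi> (co (frag_of (x, m))) = b x m)" by blast
  qed
qed

end

section \<open>Dual bases of the extension\<close>

lemma left_module_cong:
  assumes "left_module R M" "carrier M' = carrier M" "ring.zero M' = ring.zero M" "add M' = add M" "smult M' = smult M"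
  shows "left_module R M'"
proof -
  interpret M: left_module R M by fact
  have "abelian_group M'" by (rule abelian_group_cong[OF M.M.abelian_group_axioms]) (simp_all add: assms)
  moreover have "left_module_axioms R M'"
    by unfold_locales
       (simp_all add: assms M.smult_closed M.smult_l_distr M.smult_r_distr M.smult_assoc M.smult_one)
  ultimately show ?thesis using M.R.ring_axioms by (simp add: left_module_def)
qed

lemma bimodule_copies_simps [simp]:
  "carrier (bimodule_copies I M) = carrier (copies I M)"
  "ring.zero (bimodule_copies I M) = ring.zero (copies I M)"
  "add (bimodule_copies I M) = add (copies I M)"
  "smult (bimodule_copies I M) = smult (copies I M)"
  "rsmult (bimodule_copies I M) = (\<lambda>f s. \<lambda>i\<in>I. rsmult M (f i) s)"
  by (simp_all add: bimodule_copies_def)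

text \<open>The \<open>c i\<close> are the images of the standard basis vectors of R^n under the
  projection to the summand followed by the inverse isomorphism; the \<open>p i\<close> are the
  coordinates of f. In R^n one has r e_i = e_i r, and bimodule maps preserve this, so the
  \<open>c i\<close> centralize \<open>R\<close>.\<close>

lemma centrally_projective_basis:
  assumes cp: "centrally_projective_extension R A \<iota>"
  obtains n c p where "centrally_projective_hom R A \<iota> n c p"
proof -
  have hom: "ring_hom_ring R A \<iota>" using cp by (simp add: centrally_projective_extension_def)
  interpret ring_hom_noncomm R A \<iota> by (simp add: ring_hom_noncomm_def hom)
  obtain n :: nat where "iso_bimodule_direct_summand R R (ring_bimodule A \<iota> \<iota>)
      (bimodule_copies {..<n} (regular_module R))"
    using cp by (auto simp: centrally_projective_extension_def)
  define B where "B = bimodule_copies {..<n} (regular_module R)"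
  define AA where "AA = ring_bimodule A \<iota> \<iota>"
  obtain N N' f where N: "submodule N R B" and Nr: "\<And>r x. r \<in> carrier R \<Longrightarrow> x \<in> N \<Longrightarrow> rsmult B x r \<in> N"
    and N': "submodule N' R B" and N'r: "\<And>r x. r \<in> carrier R \<Longrightarrow> x \<in> N' \<Longrightarrow> rsmult B x r \<in> N'"
    and int: "N \<inter> N' = {\<zero>\<^bsub>B\<^esub>}" and sum: "set_add B N N' = carrier B"
    and f: "f \<in> bimodule_isos R R AA (B\<lparr>carrier := N\<rparr>)"
    using \<open>iso_bimodule_direct_summand R R _ _\<close>
    unfolding iso_bimodule_direct_summand_def bimodule_direct_summand_def subbimodule_def
      B_def[symmetric] AA_def[symmetric] by blast
  have Rm: "left_module R (regular_module R)" by (rule left_module_regular[OF R.ring_axioms])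
  have Cm: "left_module R (copies {..<n} (regular_module R))" by (rule left_module_copies[OF Rm])
  have Bm: "left_module R B" by (rule left_module_cong[OF Cm]) (simp_all add: B_def)
  have AAm: "left_module R AA" unfolding AA_def by (rule left_module_ring_bimodule[OF hom])
  interpret N: submodule N R B by fact
  interpret N': submodule N' R B by fact
  have sub: "a \<in> carrier B" if "a \<in> N \<or> a \<in> N'" for a
    using that N.subset N'.subset by auto
  obtain pr where pr: "pr \<in> module_homs R B (B\<lparr>carrier := N\<rparr>)"
    "\<And>x. x \<in> carrier B \<Longrightarrow> \<exists>y\<in>N'. x = pr x \<oplus>\<^bsub>B\<^esub> y"
    "\<And>a b. a \<in> N \<Longrightarrow> b \<in> N' \<Longrightarrow> pr (a \<oplus>\<^bsub>B\<^esub> b) = a"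
    by (rule direct_sum_projection[OF Bm N N' int sum], rule that)
  have prN: "pr x \<in> N" if "x \<in> carrier B" for x using module_homsD(1)[OF pr(1) that] by simp
  interpret B: left_module R B by (rule Bm)
  have pr_id: "pr a = a" if "a \<in> N" for a
    using pr(3)[OF that, of "\<zero>\<^bsub>B\<^esub>"] that sub[of a] N'.one_closed by simp
  have r_add: "rsmult B (x \<oplus>\<^bsub>B\<^esub> y) r = rsmult B x r \<oplus>\<^bsub>B\<^esub> rsmult B y r"
    if "x \<in> carrier B" "y \<in> carrier B" "r \<in> carrier R" for x y r
    using that by (auto simp: B_def R.l_distr PiE_iff intro!: restrict_ext)
  \<comment> \<open>Both summands are stable under the right action, so acting on the decomposition
    of x gives the decomposition of x r.\<close>
  have pr_r: "pr (rsmult B x r) = rsmult B (pr x) r" if x: "x \<in> carrier B" and r: "r \<in> carrier R" for x r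
  proof -
    obtain y where y: "y \<in> N'" "x = pr x \<oplus>\<^bsub>B\<^esub> y" using pr(2)[OF x] by blast
    have "rsmult B x r = rsmult B (pr x) r \<oplus>\<^bsub>B\<^esub> rsmult B y r"
      using r_add[of "pr x" y r] y sub prN[OF x] r by simp
    then show ?thesis using pr(3)[OF Nr[OF r prN[OF x]] N'r[OF r y(1)]] by simp
  qed
  have fiso: "f \<in> module_isos R AA (B\<lparr>carrier := N\<rparr>)"
    and fh: "f \<in> module_homs R AA (B\<lparr>carrier := N\<rparr>)"
    and fr: "\<And>x r. x \<in> carrier A \<Longrightarrow> r \<in> carrier R \<Longrightarrow> f (x \<otimes>\<^bsub>A\<^esub> \<iota> r) = rsmult B (f x) r"
    using f by (auto simp: bimodule_isos_def bimodule_homs_def module_isos_def AA_def)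
  obtain g where g: "g \<in> module_homs R (B\<lparr>carrier := N\<rparr>) AA" "\<And>x. x \<in> carrier AA \<Longrightarrow> g (f x) = x"
    "\<And>y. y \<in> carrier (B\<lparr>carrier := N\<rparr>) \<Longrightarrow> f (g y) = y"
    by (rule module_iso_inverse[OF AAm fiso], rule that)
  have fN: "f x \<in> N" if "x \<in> carrier A" for x using module_homsD(1)[OF fh] that by (simp add: AA_def)
  have fB: "f x \<in> carrier B" if "x \<in> carrier A" for x using fN[OF that] sub by blast
  have gA: "g y \<in> carrier A" if "y \<in> N" for y using module_homsD(1)[OF g(1)] that by (simp add: AA_def)
  have gr: "g (rsmult B y r) = g y \<otimes>\<^bsub>A\<^esub> \<iota> r" if "y \<in> N" "r \<in> carrier R" for y r
    using g(2)[of "g y \<otimes>\<^bsub>A\<^esub> \<iota> r"] fr[OF gA[OF that(1)] that(2)] g(3)[of y] gA[OF that(1)] that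
    by (simp add: AA_def)
  have G: "(\<lambda>x. g (pr x)) \<in> module_homs R B AA" by (rule module_homs_comp[OF pr(1) g(1)])
  have G': "(\<lambda>x. g (pr x)) \<in> module_homs R (copies {..<n} (regular_module R)) AA"
    using module_homsD[OF G] by (intro module_homsI) (simp_all add: B_def)
  let ?e = "\<lambda>i. \<lambda>j\<in>{..<n}. if j = i then \<one>\<^bsub>R\<^esub> else \<zero>\<^bsub>R\<^esub>"
  let ?c = "\<lambda>i. g (pr (?e i))" and ?p = "\<lambda>i x. f x i"
  have eB: "?e i \<in> carrier B" if "i < n" for i by (auto simp: B_def)
  have er: "r \<odot>\<^bsub>B\<^esub> ?e i = rsmult B (?e i) r" if "r \<in> carrier R" for i r
    using that by (auto simp: B_def intro!: restrict_ext)
  have "centrally_projective_hom R A \<iota> n ?c ?p"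
  proof
    show "?c i \<in> carrier A" if "i < n" for i using gA prN eB that by simp
    show "\<iota> r \<otimes>\<^bsub>A\<^esub> ?c i = ?c i \<otimes>\<^bsub>A\<^esub> \<iota> r" if "i < n" "r \<in> carrier R" for i r
    proof -
      have "\<iota> r \<otimes>\<^bsub>A\<^esub> ?c i = g (pr (r \<odot>\<^bsub>B\<^esub> ?e i))"
        using module_homsD(3)[OF G that(2) eB[OF that(1)]] by (simp add: AA_def)
      also have "\<dots> = ?c i \<otimes>\<^bsub>A\<^esub> \<iota> r"
        unfolding er[OF that(2)] pr_r[OF eB[OF that(1)] that(2)] by (rule gr[OF prN[OF eB[OF that(1)]] that(2)])
      finally show ?thesis .
    qed
    show "bimodule_functional (?p i)" if i: "i < n" for i
      unfolding bimodule_functional_def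
    proof (intro conjI ballI)
      fix x assume x: "x \<in> carrier A"
      show "f x i \<in> carrier R" using fB[OF x] i by (auto simp: B_def PiE_iff)
      show "f (x \<oplus>\<^bsub>A\<^esub> y) i = f x i \<oplus>\<^bsub>R\<^esub> f y i" if "y \<in> carrier A" for y
        using module_homsD(2)[OF fh, of x y] x that i by (simp add: AA_def B_def)
      show "f (\<iota> r \<otimes>\<^bsub>A\<^esub> x) i = r \<otimes>\<^bsub>R\<^esub> f x i" if "r \<in> carrier R" for r
        using module_homsD(3)[OF fh that, of x] x i by (simp add: AA_def B_def)
      show "f (x \<otimes>\<^bsub>A\<^esub> \<iota> r) i = f x i \<otimes>\<^bsub>R\<^esub> r" if "r \<in> carrier R" for r
        using fr[OF x that] i by (simp add: B_def)
    qed
    show "finsum A (\<lambda>i. \<iota> (f x i) \<otimes>\<^bsub>A\<^esub> ?c i) {..<n} = x" if x: "x \<in> carrier A" for x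
    proof -
      have fx: "f x \<in> carrier (copies {..<n} (regular_module R))" using fB[OF x] by (simp add: B_def)
      have fxi: "f x i \<in> carrier R" if "i < n" for i using fx that by (auto simp: PiE_iff)
      let ?h = "\<lambda>i. \<lambda>j\<in>{..<n}. if j = i then f x i else \<zero>\<^bsub>regular_module R\<^esub>"
      have h: "?h i = f x i \<odot>\<^bsub>B\<^esub> ?e i" if "i < n" for i
        using fxi[OF that] by (auto simp: B_def intro!: restrict_ext)
      have hc: "?h i \<in> carrier (copies {..<n} (regular_module R))" if "i \<in> {..<n}" for i
        using B.smult_closed[OF fxi eB, of i i] h[of i] that by (simp add: B_def)
      have "finsum A (\<lambda>i. \<iota> (f x i) \<otimes>\<^bsub>A\<^esub> ?c i) {..<n} = finsum A (\<lambda>i. g (pr (?h i))) {..<n}"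
      proof (rule S.finsum_cong')
        fix i assume "i \<in> {..<n}"
        then have i: "i < n" by simp
        show "\<iota> (f x i) \<otimes>\<^bsub>A\<^esub> ?c i = g (pr (?h i))"
          unfolding h[OF i] using module_homsD(3)[OF G fxi[OF i] eB[OF i]] by (simp add: AA_def)
      next
        show "(\<lambda>i. g (pr (?h i))) \<in> {..<n} \<rightarrow> carrier A"
          using module_homsD(1)[OF G' hc] by (simp add: AA_def Pi_def)
      qed simp
      also have "\<dots> = g (pr (finsum (copies {..<n} (regular_module R)) ?h {..<n}))"
        by (rule additive_finsum[symmetric, where f="\<lambda>x. g (pr x)", OF abelian_group_left_module[OF Cm] S.abelian_group_axioms _ _ hc])
           (use module_homsD(1,2)[OF G'] in \<open>simp_all add: AA_def\<close>)
      also have "finsum (copies {..<n} (regular_module R)) ?h {..<n} = f x"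
        by (rule copies_eq_finsum[OF Rm fx]) auto
      also have "g (pr (f x)) = x" using g(2)[of x] x fN by (simp add: pr_id AA_def)
      finally show ?thesis .
    qed
  qed
  then show thesis by (rule that)
qed

lemma split_extension_functional:
  assumes "split_extension R A \<iota>"
  obtains q where "ring_hom_noncomm.bimodule_functional R A \<iota> q" "q \<one>\<^bsub>A\<^esub> = \<one>\<^bsub>R\<^esub>"
proof -
  interpret ring_hom_noncomm R A \<iota>
    using assms by (simp add: split_extension_def ring_hom_noncomm_def)
  obtain q where q: "q \<in> bimodule_homs R R (ring_bimodule A \<iota> \<iota>) (regular_module R)"
    and qi: "\<And>r. r \<in> carrier R \<Longrightarrow> q (\<iota> r) = r" using assms by (auto simp: split_extension_def)
  have qm: "q \<in> module_homs R (ring_bimodule A \<iota> \<iota>) (regular_module R)" using q by (simp add: bimodule_homs_def)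
  have "bimodule_functional q"
    using module_homsD[OF qm] q by (auto simp: bimodule_functional_def bimodule_homs_def)
  moreover have "q \<one>\<^bsub>A\<^esub> = \<one>\<^bsub>R\<^esub>" using qi[OF R.one_closed] by simp
  ultimately show thesis by (rule that)
qed

lemma dual_bimodule_simps:
  "carrier (dual_bimodule R A \<iota>) =
    module_homs R (ring_bimodule A \<iota> \<iota>) (regular_module R) \<inter> extensional (carrier A)"
  "ring.zero (dual_bimodule R A \<iota>) = (\<lambda>x\<in>carrier A. \<zero>\<^bsub>R\<^esub>)"
  "smult (dual_bimodule R A \<iota>) = (\<lambda>a f. \<lambda>x\<in>carrier A. f (x \<otimes>\<^bsub>A\<^esub> a))"
  "rsmult (dual_bimodule R A \<iota>) = (\<lambda>f r. \<lambda>x\<in>carrier A. f x \<otimes>\<^bsub>R\<^esub> r)"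
  "add (dual_bimodule R A \<iota>) = (\<lambda>f g. \<lambda>x\<in>carrier A. f x \<oplus>\<^bsub>R\<^esub> g x)"
  by (simp_all add: dual_bimodule_def Let_def)

text \<open>The functional is the image of 1 under the isomorphism \<Phi>, and left
  \<open>A\<close>-linearity makes \<Phi> y the map x to E (x y). Surjectivity of \<Phi> is then
  representability and injectivity is nondegeneracy. Right linearity of \<open>E\<close> comes from
  evaluating \<Phi> at elements of \<open>R\<close> in two ways.\<close>

lemma frobenius_functional:
  assumes fe: "frobenius_extension R A \<iota>"
  obtains E where "ring_hom_noncomm.bimodule_functional R A \<iota> E"
    "\<And>f. f \<in> module_homs R (ring_bimodule A \<iota> \<iota>) (regular_module R) \<Longrightarrow>
      \<exists>y\<in>carrier A. \<forall>x\<in>carrier A. f x = E (x \<otimes>\<^bsub>A\<^esub> y)"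
    "\<And>y z. y \<in> carrier A \<Longrightarrow> z \<in> carrier A \<Longrightarrow>
      (\<And>x. x \<in> carrier A \<Longrightarrow> E (x \<otimes>\<^bsub>A\<^esub> y) = E (x \<otimes>\<^bsub>A\<^esub> z)) \<Longrightarrow> y = z"
proof -
  have hom: "ring_hom_ring R A \<iota>" using fe by (simp add: frobenius_extension_def)
  interpret ring_hom_noncomm R A \<iota> by (simp add: ring_hom_noncomm_def hom)
  obtain \<Phi> where "\<Phi> \<in> bimodule_isos A R (ring_bimodule A id \<iota>) (dual_bimodule R A \<iota>)"
    using fe by (auto simp: frobenius_extension_def)
  then have \<Phi>: "\<Phi> \<in> module_homs A (ring_bimodule A id \<iota>) (dual_bimodule R A \<iota>)"
    and \<Phi>r: "\<And>x r. x \<in> carrier A \<Longrightarrow> r \<in> carrier R \<Longrightarrow> \<Phi> (x \<otimes>\<^bsub>A\<^esub> \<iota> r) = rsmult (dual_bimodule R A \<iota>) (\<Phi> x) r"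
    and bij: "bij_betw \<Phi> (carrier A) (carrier (dual_bimodule R A \<iota>))"
    by (auto simp: bimodule_isos_def bimodule_homs_def)
  define E where "E = \<Phi> \<one>\<^bsub>A\<^esub>"
  have \<Phi>c: "\<Phi> y \<in> carrier (dual_bimodule R A \<iota>)" if "y \<in> carrier A" for y
    using module_homsD(1)[OF \<Phi>] that by simp
  have \<Phi>E: "\<Phi> y = (\<lambda>x\<in>carrier A. E (x \<otimes>\<^bsub>A\<^esub> y))" if "y \<in> carrier A" for y
    using module_homsD(3)[OF \<Phi> that, of "\<one>\<^bsub>A\<^esub>"] that by (simp add: dual_bimodule_simps E_def)
  have Em: "E \<in> module_homs R (ring_bimodule A \<iota> \<iota>) (regular_module R)"
    using \<Phi>c[OF S.one_closed] by (simp add: E_def dual_bimodule_simps)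
  have Er: "E (x \<otimes>\<^bsub>A\<^esub> \<iota> r) = E x \<otimes>\<^bsub>R\<^esub> r" if x: "x \<in> carrier A" and r: "r \<in> carrier R" for x r
  proof -
    have "\<Phi> (\<iota> r) = (\<lambda>x\<in>carrier A. E x \<otimes>\<^bsub>R\<^esub> r)"
      using \<Phi>r[OF S.one_closed r] r by (simp add: dual_bimodule_simps E_def)
    then have "(\<lambda>x\<in>carrier A. E (x \<otimes>\<^bsub>A\<^esub> \<iota> r)) = (\<lambda>x\<in>carrier A. E x \<otimes>\<^bsub>R\<^esub> r)" using \<Phi>E r by simp
    from fun_cong[OF this, of x] show ?thesis using x by simp
  qed
  show thesis
  proof (rule that[of E])
    show "bimodule_functional E"
      using module_homsD[OF Em] Er by (simp add: bimodule_functional_def)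
    show "\<exists>y\<in>carrier A. \<forall>x\<in>carrier A. f x = E (x \<otimes>\<^bsub>A\<^esub> y)"
      if f: "f \<in> module_homs R (ring_bimodule A \<iota> \<iota>) (regular_module R)" for f
    proof -
      have "(\<lambda>x\<in>carrier A. f x) \<in> carrier (dual_bimodule R A \<iota>)"
        using restrict_module_homs[OF left_module_ring_bimodule[OF hom] f] by (simp add: dual_bimodule_simps)
      then obtain y where y: "y \<in> carrier A" "(\<lambda>x\<in>carrier A. f x) = \<Phi> y"
        using bij by (auto simp: bij_betw_def)
      have "f x = E (x \<otimes>\<^bsub>A\<^esub> y)" if "x \<in> carrier A" for x
        using fun_cong[OF y(2), of x] \<Phi>E[OF y(1)] that by simp
      then show ?thesis using y(1) by blast
    qed
    show "y = z" if yz: "y \<in> carrier A" "z \<in> carrier A"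
      and eq: "\<And>x. x \<in> carrier A \<Longrightarrow> E (x \<otimes>\<^bsub>A\<^esub> y) = E (x \<otimes>\<^bsub>A\<^esub> z)" for y z
    proof -
      have "\<Phi> y = \<Phi> z" unfolding \<Phi>E[OF yz(1)] \<Phi>E[OF yz(2)] using eq by (rule restrict_ext)
      then show ?thesis using bij yz inj_onD[of \<Phi> "carrier A" y z] by (simp add: bij_betw_def)
    qed
  qed
qed

context centrally_projective_hom
begin

text \<open>The coordinate \<open>\<pi> i\<close> comes from the balanced map (x, m) to (p i x) m:
  it is balanced by right linearity of \<open>p i\<close>, and \<open>R\<close>-linear by left
  linearity.\<close>

lemma extend_scalars_induced:
  fixes M :: "('r, 'm, 'z) module_scheme"
  assumes M: "left_module R M"
  obtains \<eta> \<pi> where "induced M (extend_scalars R A \<iota> M) \<eta> \<pi>"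
proof -
  let ?U = "extend_scalars R A \<iota> M"
  interpret M: left_module R M by fact
  show thesis
  proof (rule extend_scalars_presentation[OF M])
    fix \<tau> :: "'a \<Rightarrow> 'm \<Rightarrow> (('a \<times> 'm) \<Rightarrow>\<^sub>0 int) set"
    assume U: "left_module A ?U"
      and \<tau>c: "\<And>x m. x \<in> carrier A \<Longrightarrow> m \<in> carrier M \<Longrightarrow> \<tau> x m \<in> carrier ?U"
      and \<tau>l: "\<And>x y m. x \<in> carrier A \<Longrightarrow> y \<in> carrier A \<Longrightarrow> m \<in> carrier M \<Longrightarrow>
        \<tau> (x \<oplus>\<^bsub>A\<^esub> y) m = \<tau> x m \<oplus>\<^bsub>?U\<^esub> \<tau> y m"
      and \<tau>r: "\<And>x m m'. x \<in> carrier A \<Longrightarrow> m \<in> carrier M \<Longrightarrow> m' \<in> carrier M \<Longrightarrow>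
        \<tau> x (m \<oplus>\<^bsub>M\<^esub> m') = \<tau> x m \<oplus>\<^bsub>?U\<^esub> \<tau> x m'"
      and \<tau>b: "\<And>x r m. x \<in> carrier A \<Longrightarrow> r \<in> carrier R \<Longrightarrow> m \<in> carrier M \<Longrightarrow>
        \<tau> (x \<otimes>\<^bsub>A\<^esub> \<iota> r) m = \<tau> x (r \<odot>\<^bsub>M\<^esub> m)"
      and \<tau>s: "\<And>a x m. a \<in> carrier A \<Longrightarrow> x \<in> carrier A \<Longrightarrow> m \<in> carrier M \<Longrightarrow>
        a \<odot>\<^bsub>?U\<^esub> \<tau> x m = \<tau> (a \<otimes>\<^bsub>A\<^esub> x) m"
      and ind: "\<And>P u. u \<in> carrier ?U \<Longrightarrow> P \<zero>\<^bsub>?U\<^esub> \<Longrightarrow>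
        (\<And>u v. u \<in> carrier ?U \<Longrightarrow> v \<in> carrier ?U \<Longrightarrow> P u \<Longrightarrow> P v \<Longrightarrow> P (u \<ominus>\<^bsub>?U\<^esub> v)) \<Longrightarrow>
        (\<And>x m. x \<in> carrier A \<Longrightarrow> m \<in> carrier M \<Longrightarrow> P (\<tau> x m)) \<Longrightarrow> P u"
      and univ: "\<And>b. (\<And>x m. x \<in> carrier A \<Longrightarrow> m \<in> carrier M \<Longrightarrow> b x m \<in> carrier M) \<Longrightarrow>
        (\<And>x y m. x \<in> carrier A \<Longrightarrow> y \<in> carrier A \<Longrightarrow> m \<in> carrier M \<Longrightarrow>
          b (x \<oplus>\<^bsub>A\<^esub> y) m = b x m \<oplus>\<^bsub>M\<^esub> b y m) \<Longrightarrow>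
        (\<And>x m m'. x \<in> carrier A \<Longrightarrow> m \<in> carrier M \<Longrightarrow> m' \<in> carrier M \<Longrightarrow>
          b x (m \<oplus>\<^bsub>M\<^esub> m') = b x m \<oplus>\<^bsub>M\<^esub> b x m') \<Longrightarrow>
        (\<And>x r m. x \<in> carrier A \<Longrightarrow> r \<in> carrier R \<Longrightarrow> m \<in> carrier M \<Longrightarrow>
          b (x \<otimes>\<^bsub>A\<^esub> \<iota> r) m = b x (r \<odot>\<^bsub>M\<^esub> m)) \<Longrightarrow>
        \<exists>\<phi>. (\<forall>u\<in>carrier ?U. \<phi> u \<in> carrier M) \<and>
          (\<forall>u\<in>carrier ?U. \<forall>v\<in>carrier ?U. \<phi> (u \<oplus>\<^bsub>?U\<^esub> v) = \<phi> u \<oplus>\<^bsub>M\<^esub> \<phi> v) \<and>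
          (\<forall>x\<in>carrier A. \<forall>m\<in>carrier M. \<phi> (\<tau> x m) = b x m)"
    interpret U: left_module A ?U by (rule U)
    \<comment> \<open>Additive maps out of the tensor product are compared on generators; the target
      is any abelian group, because both \<open>M\<close> and the tensor product occur.\<close>
    have additive_eq: "f u = g u"
      if H: "abelian_group H" and u: "u \<in> carrier ?U"
        and f: "\<And>u. u \<in> carrier ?U \<Longrightarrow> f u \<in> carrier H"
          "\<And>u v. u \<in> carrier ?U \<Longrightarrow> v \<in> carrier ?U \<Longrightarrow> f (u \<oplus>\<^bsub>?U\<^esub> v) = f u \<oplus>\<^bsub>H\<^esub> f v"
        and g: "\<And>u. u \<in> carrier ?U \<Longrightarrow> g u \<in> carrier H"
          "\<And>u v. u \<in> carrier ?U \<Longrightarrow> v \<in> carrier ?U \<Longrightarrow> g (u \<oplus>\<^bsub>?U\<^esub> v) = g u \<oplus>\<^bsub>H\<^esub> g v"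
        and eq: "\<And>x m. x \<in> carrier A \<Longrightarrow> m \<in> carrier M \<Longrightarrow> f (\<tau> x m) = g (\<tau> x m)"
      for H :: "('h, 'i) ring_scheme" and f g u
    proof (rule ind[of u "\<lambda>u. f u = g u", OF u])
      note z = additive_zero[where f=f, OF U.M.abelian_group_axioms H f] additive_zero[where f=g, OF U.M.abelian_group_axioms H g]
        additive_uminus[where f=f, OF U.M.abelian_group_axioms H f] additive_uminus[where f=g, OF U.M.abelian_group_axioms H g]
      show "f \<zero>\<^bsub>?U\<^esub> = g \<zero>\<^bsub>?U\<^esub>" using z by simp
      show "f (u \<ominus>\<^bsub>?U\<^esub> v) = g (u \<ominus>\<^bsub>?U\<^esub> v)"
        if "u \<in> carrier ?U" "v \<in> carrier ?U" "f u = g u" "f v = g v" for u v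
        using that by (simp add: a_minus_def f(2) g(2) z)
    qed (rule eq)
    let ?P = "\<lambda>i \<phi>. (\<forall>u\<in>carrier ?U. \<phi> u \<in> carrier M) \<and>
      (\<forall>u\<in>carrier ?U. \<forall>v\<in>carrier ?U. \<phi> (u \<oplus>\<^bsub>?U\<^esub> v) = \<phi> u \<oplus>\<^bsub>M\<^esub> \<phi> v) \<and>
      (\<forall>x\<in>carrier A. \<forall>m\<in>carrier M. \<phi> (\<tau> x m) = p i x \<odot>\<^bsub>M\<^esub> m)"
    have ex: "\<exists>\<phi>. ?P i \<phi>" if "i < n" for i
      using that by (intro univ)
        (simp_all add: p_simps M.smult_closed M.smult_l_distr M.smult_r_distr M.smult_assoc)
    define \<pi> where "\<pi> i = (SOME \<phi>. ?P i \<phi>)" for i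
    have P: "?P i (\<pi> i)" if "i < n" for i
      unfolding \<pi>_def by (rule someI_ex[OF ex[OF that]])
    have \<pi>c: "\<pi> i u \<in> carrier M" if "i < n" "u \<in> carrier ?U" for i u
      using P[OF that(1)] that(2) by simp
    have \<pi>a: "\<pi> i (u \<oplus>\<^bsub>?U\<^esub> v) = \<pi> i u \<oplus>\<^bsub>M\<^esub> \<pi> i v"
      if "i < n" "u \<in> carrier ?U" "v \<in> carrier ?U" for i u v
      using P[OF that(1)] that(2,3) by simp
    have \<pi>\<tau>: "\<pi> i (\<tau> x m) = p i x \<odot>\<^bsub>M\<^esub> m" if "i < n" "x \<in> carrier A" "m \<in> carrier M" for i x m
      using P[OF that(1)] that(2,3) by simp
    have \<eta>: "\<tau> \<one>\<^bsub>A\<^esub> \<in> module_homs R M (rs ?U)"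
      using \<tau>b[OF S.one_closed] by (intro module_homsI) (simp_all add: \<tau>c \<tau>r \<tau>s)
    have \<pi>: "\<pi> i \<in> module_homs R (rs ?U) M" if i: "i < n" for i
    proof (rule module_homsI)
      fix r u assume r: "r \<in> carrier R" and u: "u \<in> carrier (rs ?U)"
      have "\<pi> i (\<iota> r \<odot>\<^bsub>?U\<^esub> u) = r \<odot>\<^bsub>M\<^esub> \<pi> i u"
        by (rule additive_eq[OF M.M.abelian_group_axioms, of u "\<lambda>u. \<pi> i (\<iota> r \<odot>\<^bsub>?U\<^esub> u)" "\<lambda>u. r \<odot>\<^bsub>M\<^esub> \<pi> i u"])
           (use r u i in \<open>simp_all add: \<pi>c \<pi>a U.smult_closed U.smult_r_distr M.smult_closed M.smult_r_distr
              \<tau>s \<pi>\<tau> p_simps M.smult_assoc\<close>)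
      then show "\<pi> i (r \<odot>\<^bsub>rs ?U\<^esub> u) = r \<odot>\<^bsub>M\<^esub> \<pi> i u" by simp
    qed (simp_all add: i \<pi>c \<pi>a)
    have sum: "finsum ?U (\<lambda>i. c i \<odot>\<^bsub>?U\<^esub> \<tau> \<one>\<^bsub>A\<^esub> (\<pi> i u)) {..<n} = u" if u: "u \<in> carrier ?U" for u
    proof (rule additive_eq[OF U.M.abelian_group_axioms u])
      have cl: "c i \<odot>\<^bsub>?U\<^esub> \<tau> \<one>\<^bsub>A\<^esub> (\<pi> i u) \<in> carrier ?U" if "i < n" "u \<in> carrier ?U" for i u
        using that by (simp add: U.smult_closed c_closed \<tau>c \<pi>c)
      then show "finsum ?U (\<lambda>i. c i \<odot>\<^bsub>?U\<^esub> \<tau> \<one>\<^bsub>A\<^esub> (\<pi> i u)) {..<n} \<in> carrier ?U" if "u \<in> carrier ?U" for u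
        using that by (intro U.M.finsum_closed) simp
      fix u v assume uv: "u \<in> carrier ?U" "v \<in> carrier ?U"
      have "finsum ?U (\<lambda>i. c i \<odot>\<^bsub>?U\<^esub> \<tau> \<one>\<^bsub>A\<^esub> (\<pi> i (u \<oplus>\<^bsub>?U\<^esub> v))) {..<n} =
          finsum ?U (\<lambda>i. c i \<odot>\<^bsub>?U\<^esub> \<tau> \<one>\<^bsub>A\<^esub> (\<pi> i u) \<oplus>\<^bsub>?U\<^esub> c i \<odot>\<^bsub>?U\<^esub> \<tau> \<one>\<^bsub>A\<^esub> (\<pi> i v)) {..<n}"
        using uv cl by (intro U.M.finsum_cong') (simp_all add: \<pi>a \<pi>c \<tau>c \<tau>r c_closed U.smult_r_distr Pi_def)
      then show "finsum ?U (\<lambda>i. c i \<odot>\<^bsub>?U\<^esub> \<tau> \<one>\<^bsub>A\<^esub> (\<pi> i (u \<oplus>\<^bsub>?U\<^esub> v))) {..<n} =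
          finsum ?U (\<lambda>i. c i \<odot>\<^bsub>?U\<^esub> \<tau> \<one>\<^bsub>A\<^esub> (\<pi> i u)) {..<n} \<oplus>\<^bsub>?U\<^esub>
          finsum ?U (\<lambda>i. c i \<odot>\<^bsub>?U\<^esub> \<tau> \<one>\<^bsub>A\<^esub> (\<pi> i v)) {..<n}"
        using uv cl by (simp add: U.M.finsum_addf Pi_def)
    next
      fix x m assume x: "x \<in> carrier A" and m: "m \<in> carrier M"
      \<comment> \<open>The scalar p i x crosses the tensor sign and then commutes with
        \<open>c i\<close>, so each summand becomes a generator and the dual basis identity applies
        inside the first factor.\<close>
      have "finsum ?U (\<lambda>i. c i \<odot>\<^bsub>?U\<^esub> \<tau> \<one>\<^bsub>A\<^esub> (\<pi> i (\<tau> x m))) {..<n} =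
          finsum ?U (\<lambda>i. \<tau> (\<iota> (p i x) \<otimes>\<^bsub>A\<^esub> c i) m) {..<n}"
        by (rule U.M.finsum_cong')
           (simp_all add: x m \<pi>\<tau> \<tau>s \<tau>c c_closed p_simps c_central M.smult_closed Pi_def flip: \<tau>b)
      also have "\<dots> = \<tau> (finsum A (\<lambda>i. \<iota> (p i x) \<otimes>\<^bsub>A\<^esub> c i) {..<n}) m"
        by (rule additive_finsum[symmetric, where f="\<lambda>x. \<tau> x m", OF S.abelian_group_axioms U.M.abelian_group_axioms])
           (simp_all add: \<tau>c \<tau>l m p_simps x c_closed)
      also have "\<dots> = \<tau> x m" by (simp add: basis x)
      finally show "finsum ?U (\<lambda>i. c i \<odot>\<^bsub>?U\<^esub> \<tau> \<one>\<^bsub>A\<^esub> (\<pi> i (\<tau> x m))) {..<n} = \<tau> x m" .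
    qed simp_all
    have "induced M ?U (\<tau> \<one>\<^bsub>A\<^esub>) \<pi>"
      unfolding induced_def using M U \<eta> \<pi> sum by (simp add: \<tau>s \<pi>\<tau>)
    then show thesis by (rule that)
  qed
qed

end

section \<open>The theorem\<close>

context centrally_projective_hom
begin

text \<open>The induced structure of the terms and differentials is returned along with the
  resolution, since Hom-exactness is transferred through it in both directions of the
  theorem.\<close>

lemma fg_resolution_extend_scalars:
  fixes T :: "('r, 't, 'z) module_scheme" and P :: "nat \<Rightarrow> ('r, 'p) module"
  assumes U: "induced T U \<eta> \<pi>" and fg: "fg_resolution R T P d e"
  obtains D \<epsilon> \<eta>P \<pi>P where "fg_resolution A U (\<lambda>i. extend_scalars R A \<iota> (P i)) D \<epsilon>"
    "\<And>i. induced (P i) (extend_scalars R A \<iota> (P i)) (\<eta>P i) (\<pi>P i)"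
    "\<And>i. induced_map (P (Suc i)) (extend_scalars R A \<iota> (P (Suc i))) (\<eta>P (Suc i))
      (extend_scalars R A \<iota> (P i)) (\<eta>P i) (d i) (D i)"
proof -
  note f = fg_resolutionD[OF fg]
  note r = projective_resolutionD[OF f(1)]
  let ?P = "\<lambda>i. extend_scalars R A \<iota> (P i)"
  have "\<forall>i. \<exists>\<eta> \<pi>. induced (P i) (?P i) \<eta> \<pi>"
    using extend_scalars_induced[OF f(3)] by metis
  then obtain \<eta>P \<pi>P where P: "\<And>i. induced (P i) (?P i) (\<eta>P i) (\<pi>P i)" by metis
  have "\<forall>i. \<exists>D. induced_map (P (Suc i)) (?P (Suc i)) (\<eta>P (Suc i)) (?P i) (\<eta>P i) (d i) D"
    using induced_map_exists[OF P P r(2)] by blast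
  then obtain D where D: "\<And>i. induced_map (P (Suc i)) (?P (Suc i)) (\<eta>P (Suc i)) (?P i) (\<eta>P i) (d i) (D i)"
    by metis
  obtain \<epsilon> where \<epsilon>: "induced_map (P 0) (?P 0) (\<eta>P 0) U \<eta> e \<epsilon>"
    using induced_map_exists[OF P U r(3)] by blast
  have "fg_resolution A U ?P D \<epsilon>"
  proof (rule fg_resolutionI[OF S.ring_axioms])
    show "in_add A (regular_module A) (?P i)" for i by (rule induced_in_add[OF induced_regular P f(2)])
    show "D i \<in> module_homs A (?P (Suc i)) (?P i)" for i by (rule induced_mapD(1)[OF D])
    show "\<epsilon> \<in> module_homs A (?P 0) U" by (rule induced_mapD(1)[OF \<epsilon>])
    show "\<epsilon> ` carrier (?P 0) = carrier U" by (rule induced_surj[OF P U r(3) \<epsilon> r(4)])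
    show "D 0 ` carrier (?P (Suc 0)) = a_kernel (?P 0) U \<epsilon>"
      by (rule induced_exact[OF P P U r(2) r(3) D \<epsilon>]) (use r(5) in simp)
    show "D (Suc i) ` carrier (?P (Suc (Suc i))) = a_kernel (?P (Suc i)) (?P i) (D i)" for i
      by (rule induced_exact[OF P P P r(2) r(2) D D r(6)])
  qed
  then show thesis by (rule that[OF _ P D])
qed

lemma wakamatsu_tilting_extend_scalars:
  fixes T :: "('r, 't, 'z) module_scheme"
  assumes W: "wakamatsu_tilting R T"
  shows "wakamatsu_tilting A (extend_scalars R A \<iota> T)"
proof -
  have Tm: "left_module R T" using W by (simp add: wakamatsu_tilting_def)
  obtain P :: "nat \<Rightarrow> ('r, nat \<Rightarrow> 'r) module" and d e and C :: "nat \<Rightarrow> ('r, nat \<Rightarrow> 't) module" and e' d'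
    where fg: "fg_resolution R T P d e"
      and ext: "\<And>j. hom_exact R (P (Suc (Suc j))) (d (Suc j)) (P (Suc j)) (d j) (P j) T"
      and co: "add_coresolution R T C e' d'"
    using W[unfolded wakamatsu_tilting_iff[OF Tm]] by blast
  note f = fg_resolutionD[OF fg]
  note r = projective_resolutionD[OF f(1)]
  have add: "\<And>j. in_add R T (C j)" and ex: "exact_coresolution R C e' d'"
    and h0: "hom_exact R (regular_module R) (\<lambda>_. \<zero>\<^bsub>R\<^esub>) (regular_module R) e' (C 0) T"
    and h1: "hom_exact R (regular_module R) e' (C 0) (d' 0) (C (Suc 0)) T"
    and h2: "\<And>j. hom_exact R (C j) (d' j) (C (Suc j)) (d' (Suc j)) (C (Suc (Suc j))) T"
    using co by (auto simp: add_coresolution_def)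
  note x = exact_coresolutionD[OF ex]
  note reg = induced_regular
  let ?U = "extend_scalars R A \<iota> T"
  let ?P = "\<lambda>i. extend_scalars R A \<iota> (P i)" and ?C = "\<lambda>i. extend_scalars R A \<iota> (C i)"
  obtain \<eta> \<pi> where U: "induced T ?U \<eta> \<pi>" by (rule extend_scalars_induced[OF Tm])
  obtain D \<epsilon> \<eta>P \<pi>P where FP: "fg_resolution A ?U ?P D \<epsilon>"
    and P: "\<And>i. induced (P i) (?P i) (\<eta>P i) (\<pi>P i)"
    and D: "\<And>i. induced_map (P (Suc i)) (?P (Suc i)) (\<eta>P (Suc i)) (?P i) (\<eta>P i) (d i) (D i)"
    by (rule fg_resolution_extend_scalars[OF U fg], rule that)
  have "\<forall>i. \<exists>\<eta> \<pi>. induced (C i) (?C i) \<eta> \<pi>"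
    using extend_scalars_induced[OF in_add_left_module[OF add]] by metis
  then obtain \<eta>C \<pi>C where C: "\<And>i. induced (C i) (?C i) (\<eta>C i) (\<pi>C i)" by metis
  have "\<forall>i. \<exists>D. induced_map (C i) (?C i) (\<eta>C i) (?C (Suc i)) (\<eta>C (Suc i)) (d' i) D"
    using induced_map_exists[OF C C x(2)] by blast
  then obtain D' where D': "\<And>i. induced_map (C i) (?C i) (\<eta>C i) (?C (Suc i)) (\<eta>C (Suc i)) (d' i) (D' i)"
    by metis
  obtain \<epsilon>' where \<epsilon>': "induced_map (regular_module R) (regular_module A) \<iota> (?C 0) (\<eta>C 0) e' \<epsilon>'"
    using induced_map_exists[OF reg C x(1)] by blast
  have "hom_exact A (?P (Suc (Suc j))) (D (Suc j)) (?P (Suc j)) (D j) (?P j) ?U" for j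
    by (rule induced_hom_exact[OF P P P U r(2) r(2) D D ext])
  moreover have "add_coresolution A ?U ?C \<epsilon>' D'"
    unfolding add_coresolution_def exact_coresolution_def
  proof (intro conjI allI)
    show "in_add A ?U (?C j)" for j by (rule induced_in_add[OF U C add])
    show "\<epsilon>' \<in> module_homs A (regular_module A) (?C 0)" by (rule induced_mapD(1)[OF \<epsilon>'])
    show "D' j \<in> module_homs A (?C j) (?C (Suc j))" for j by (rule induced_mapD(1)[OF D'])
    show "inj_on \<epsilon>' (carrier A)"
      using induced_inj[OF reg C x(1) \<epsilon>'] x(3) by simp
    show "\<epsilon>' ` carrier A = a_kernel (?C 0) (?C 1) (D' 0)"
      using induced_exact[OF reg C C x(1) x(2) \<epsilon>' D'] x(4) by simp
    show "D' j ` carrier (?C j) = a_kernel (?C (Suc j)) (?C (Suc (Suc j))) (D' (Suc j))" for j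
      by (rule induced_exact[OF C C C x(2) x(2) D' D' x(5)])
    have zR: "(\<lambda>_. \<zero>\<^bsub>R\<^esub>) \<in> module_homs R (regular_module R) (regular_module R)"
      using module_homs_const_zero[OF left_module_regular[OF R.ring_axioms], of "regular_module R"] by simp
    \<comment> \<open>Surjectivity onto the maps out of the ring is phrased as exactness after a
      zero map, so the zero map has to be recognized as induced too.\<close>
    have zA: "induced_map (regular_module R) (regular_module A) \<iota> (regular_module A) \<iota> (\<lambda>_. \<zero>\<^bsub>R\<^esub>) (\<lambda>_. \<zero>\<^bsub>A\<^esub>)"
      using module_homs_const_zero[OF left_module_regular[OF S.ring_axioms], of "regular_module A"]
      by (simp add: induced_map_def)
    show "hom_exact A (regular_module A) (\<lambda>_. \<zero>\<^bsub>A\<^esub>) (regular_module A) \<epsilon>' (?C 0) ?U"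
      by (rule induced_hom_exact[OF reg reg C U zR x(1) zA \<epsilon>' h0])
    show "hom_exact A (regular_module A) \<epsilon>' (?C 0) (D' 0) (?C (Suc 0)) ?U"
      by (rule induced_hom_exact[OF reg C C U x(1) x(2) \<epsilon>' D' h1])
    show "hom_exact A (?C j) (D' j) (?C (Suc j)) (D' (Suc j)) (?C (Suc (Suc j))) ?U" for j
      by (rule induced_hom_exact[OF C C C U x(2) x(2) D' D' h2])
  qed
  ultimately show ?thesis by (rule wakamatsu_tiltingI[OF inducedD(2)[OF U] FP])
qed

end

text \<open>The elements \<open>y i\<close> represent the coordinates \<open>p i\<close> under the
  Frobenius isomorphism; with the expansion in the \<open>c i\<close> this makes \<open>c\<close>
  and \<open>y\<close> dual bases for \<open>E\<close>.\<close>

locale central_frobenius_hom = centrally_projective_hom R A \<iota> n c p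
  for R :: "('r, 'x) ring_scheme" and A :: "('a, 'y) ring_scheme" and \<iota> :: "'r \<Rightarrow> 'a"
    and n :: nat and c :: "nat \<Rightarrow> 'a" and p :: "nat \<Rightarrow> 'a \<Rightarrow> 'r" +
  fixes E :: "'a \<Rightarrow> 'r" and y :: "nat \<Rightarrow> 'a"
  assumes E_functional: "bimodule_functional E"
    and y_closed: "\<And>i. i < n \<Longrightarrow> y i \<in> carrier A"
    and p_eq_E: "\<And>i x. i < n \<Longrightarrow> x \<in> carrier A \<Longrightarrow> p i x = E (x \<otimes>\<^bsub>A\<^esub> y i)"
    and E_nondegenerate: "\<And>b b'. b \<in> carrier A \<Longrightarrow> b' \<in> carrier A \<Longrightarrow>
      (\<And>x. x \<in> carrier A \<Longrightarrow> E (x \<otimes>\<^bsub>A\<^esub> b) = E (x \<otimes>\<^bsub>A\<^esub> b')) \<Longrightarrow> b = b'"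
begin

text \<open>
  The inverse of \<open>\<Phi> \<mapsto> (E \<otimes> T) \<Phi>\<close>, from \<open>Hom\<^sub>A(N, A \<otimes> T)\<close> to \<open>Hom\<^sub>R(N, T)\<close>, is
  \<open>\<phi> \<mapsto> (x \<mapsto> \<Sum>i. y i \<otimes> \<phi>(c i \<cdot> x))\<close>, because \<open>c\<close> and \<open>y\<close> are dual bases for \<open>E\<close>.
\<close>

lemma hom_exact_restrict_scalars:
  assumes T: "induced T U \<eta> \<pi>"
    and Mm: "left_module A M" and Nm: "left_module A N" and f: "f \<in> module_homs A M N"
    and ex: "hom_exact A M f N g K U"
  shows "hom_exact R (rs M) f (rs N) g (rs K) T"
proof (rule hom_exactI)
  note y = y_closed p_eq_E
  note t = inducedD[OF T] and e = bimodule_functionalD[OF E_functional]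
  interpret U: left_module A U by (rule t(2))
  interpret T: left_module R T by (rule t(1))
  interpret N: left_module A N by (rule Nm)
  interpret M: left_module A M by (rule Mm)
  have rsU: "left_module R (rs U)" by (rule left_module_restrict_scalars[OF t(2)])
  \<comment> \<open>Tested against E (x -) for all x: the left side becomes the sum of p i x times E
    (c i b), which is E (x b) by the expansion of x. Nondegeneracy then gives equality.\<close>
  have dual: "finsum A (\<lambda>i. y i \<otimes>\<^bsub>A\<^esub> \<iota> (E (c i \<otimes>\<^bsub>A\<^esub> b))) {..<n} = b" if b: "b \<in> carrier A" for b
  proof (rule E_nondegenerate)
    have cl: "y i \<otimes>\<^bsub>A\<^esub> \<iota> (E (c i \<otimes>\<^bsub>A\<^esub> b)) \<in> carrier A" if "i \<in> {..<n}" for i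
      using that b by (simp add: y(1) e c_closed)
    show "finsum A (\<lambda>i. y i \<otimes>\<^bsub>A\<^esub> \<iota> (E (c i \<otimes>\<^bsub>A\<^esub> b))) {..<n} \<in> carrier A"
      using cl by (intro S.finsum_closed) simp
    fix x assume x: "x \<in> carrier A"
    have "E (x \<otimes>\<^bsub>A\<^esub> finsum A (\<lambda>i. y i \<otimes>\<^bsub>A\<^esub> \<iota> (E (c i \<otimes>\<^bsub>A\<^esub> b))) {..<n}) =
        E (finsum A (\<lambda>i. x \<otimes>\<^bsub>A\<^esub> (y i \<otimes>\<^bsub>A\<^esub> \<iota> (E (c i \<otimes>\<^bsub>A\<^esub> b)))) {..<n})"
      using cl x by (subst S.finsum_rdistr) (auto simp: Pi_def)
    also have "\<dots> = finsum R (\<lambda>i. E (x \<otimes>\<^bsub>A\<^esub> (y i \<otimes>\<^bsub>A\<^esub> \<iota> (E (c i \<otimes>\<^bsub>A\<^esub> b))))) {..<n}"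
      by (rule bimodule_functional_finsum[OF E_functional]) (use x cl in simp)
    also have "\<dots> = finsum R (\<lambda>i. E (\<iota> (p i x) \<otimes>\<^bsub>A\<^esub> c i \<otimes>\<^bsub>A\<^esub> b)) {..<n}"
    proof (rule R.finsum_cong')
      fix i assume "i \<in> {..<n}"
      then have i: "i < n" by simp
      have "E (x \<otimes>\<^bsub>A\<^esub> (y i \<otimes>\<^bsub>A\<^esub> \<iota> (E (c i \<otimes>\<^bsub>A\<^esub> b)))) = E (x \<otimes>\<^bsub>A\<^esub> y i) \<otimes>\<^bsub>R\<^esub> E (c i \<otimes>\<^bsub>A\<^esub> b)"
        using i x b by (simp add: y(1) e c_closed flip: S.m_assoc)
      also have "\<dots> = E (\<iota> (p i x) \<otimes>\<^bsub>A\<^esub> c i \<otimes>\<^bsub>A\<^esub> b)"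
        using i x b by (simp add: p_simps e c_closed S.m_assoc flip: y(2))
      finally show "E (x \<otimes>\<^bsub>A\<^esub> (y i \<otimes>\<^bsub>A\<^esub> \<iota> (E (c i \<otimes>\<^bsub>A\<^esub> b)))) = E (\<iota> (p i x) \<otimes>\<^bsub>A\<^esub> c i \<otimes>\<^bsub>A\<^esub> b)" .
    qed (simp_all add: x b e p_simps c_closed Pi_def)
    also have "\<dots> = E (finsum A (\<lambda>i. \<iota> (p i x) \<otimes>\<^bsub>A\<^esub> c i \<otimes>\<^bsub>A\<^esub> b) {..<n})"
      by (rule bimodule_functional_finsum[OF E_functional, symmetric]) (simp add: x b p_simps c_closed)
    also have "finsum A (\<lambda>i. \<iota> (p i x) \<otimes>\<^bsub>A\<^esub> c i \<otimes>\<^bsub>A\<^esub> b) {..<n} =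
        finsum A (\<lambda>i. \<iota> (p i x) \<otimes>\<^bsub>A\<^esub> c i) {..<n} \<otimes>\<^bsub>A\<^esub> b"
      by (rule S.finsum_ldistr[symmetric]) (simp_all add: x b p_simps c_closed Pi_def)
    also have "\<dots> = x \<otimes>\<^bsub>A\<^esub> b" by (simp add: basis x)
    finally show "E (x \<otimes>\<^bsub>A\<^esub> finsum A (\<lambda>i. y i \<otimes>\<^bsub>A\<^esub> \<iota> (E (c i \<otimes>\<^bsub>A\<^esub> b))) {..<n}) = E (x \<otimes>\<^bsub>A\<^esub> b)" .
  qed (rule b)
  obtain \<epsilon> where \<epsilon>: "\<epsilon> \<in> module_homs R (rs U) T"
    "\<And>b t. b \<in> carrier A \<Longrightarrow> t \<in> carrier T \<Longrightarrow> \<epsilon> (b \<odot>\<^bsub>U\<^esub> \<eta> t) = E b \<odot>\<^bsub>T\<^esub> t"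
    by (rule induced_contraction[OF T E_functional], rule that)
  have \<epsilon>c: "\<epsilon> u \<in> carrier T" "v \<in> carrier U \<Longrightarrow> \<epsilon> (u \<oplus>\<^bsub>U\<^esub> v) = \<epsilon> u \<oplus>\<^bsub>T\<^esub> \<epsilon> v" if "u \<in> carrier U" for u v
    using module_homsD[OF \<epsilon>(1)] that by simp_all
  have \<eta>D: "\<eta> (s \<oplus>\<^bsub>T\<^esub> t) = \<eta> s \<oplus>\<^bsub>U\<^esub> \<eta> t" "r \<in> carrier R \<Longrightarrow> \<eta> (r \<odot>\<^bsub>T\<^esub> t) = \<iota> r \<odot>\<^bsub>U\<^esub> \<eta> t"
    if "s \<in> carrier T" "t \<in> carrier T" for s t r
    using module_homsD[OF t(3)] that by simp_all
  \<comment> \<open>The map that rebuilds u from the values \<epsilon> (c i u). It is the identity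
    on the elements b times \<eta> s by the dual basis formula, hence everywhere by
    additivity.\<close>
  define G where "G u = finsum U (\<lambda>i. y i \<odot>\<^bsub>U\<^esub> \<eta> (\<epsilon> (c i \<odot>\<^bsub>U\<^esub> u))) {..<n}" for u
  have Gcl: "y i \<odot>\<^bsub>U\<^esub> \<eta> (\<epsilon> (c i \<odot>\<^bsub>U\<^esub> u)) \<in> carrier U" if "i < n" "u \<in> carrier U" for i u
    using that by (simp add: U.smult_closed y(1) c_closed t(7) \<epsilon>c)
  have Gc: "G u \<in> carrier U" if "u \<in> carrier U" for u
    unfolding G_def using that by (intro U.M.finsum_closed) (simp add: Gcl)
  have Ga: "G (u \<oplus>\<^bsub>U\<^esub> v) = G u \<oplus>\<^bsub>U\<^esub> G v" if uv: "u \<in> carrier U" "v \<in> carrier U" for u v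
  proof -
    have "G (u \<oplus>\<^bsub>U\<^esub> v) = finsum U (\<lambda>i. y i \<odot>\<^bsub>U\<^esub> \<eta> (\<epsilon> (c i \<odot>\<^bsub>U\<^esub> u)) \<oplus>\<^bsub>U\<^esub> y i \<odot>\<^bsub>U\<^esub> \<eta> (\<epsilon> (c i \<odot>\<^bsub>U\<^esub> v))) {..<n}"
      unfolding G_def
      by (rule U.M.finsum_cong')
         (use uv in \<open>simp_all add: U.smult_closed U.smult_r_distr y(1) c_closed t(7) \<epsilon>c \<eta>D Pi_def\<close>)
    then show ?thesis unfolding G_def using uv by (simp add: U.M.finsum_addf Gcl Pi_def)
  qed
  have G\<eta>: "G (b \<odot>\<^bsub>U\<^esub> \<eta> s) = b \<odot>\<^bsub>U\<^esub> \<eta> s" if b: "b \<in> carrier A" and s: "s \<in> carrier T" for b s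
  proof -
    have "G (b \<odot>\<^bsub>U\<^esub> \<eta> s) = finsum U (\<lambda>i. (y i \<otimes>\<^bsub>A\<^esub> \<iota> (E (c i \<otimes>\<^bsub>A\<^esub> b))) \<odot>\<^bsub>U\<^esub> \<eta> s) {..<n}"
      unfolding G_def
    proof (rule U.M.finsum_cong')
      fix i assume "i \<in> {..<n}"
      then have i: "i < n" by simp
      have cb: "c i \<odot>\<^bsub>U\<^esub> (b \<odot>\<^bsub>U\<^esub> \<eta> s) = (c i \<otimes>\<^bsub>A\<^esub> b) \<odot>\<^bsub>U\<^esub> \<eta> s"
        using i b s by (simp add: U.smult_assoc c_closed t(7))
      show "y i \<odot>\<^bsub>U\<^esub> \<eta> (\<epsilon> (c i \<odot>\<^bsub>U\<^esub> (b \<odot>\<^bsub>U\<^esub> \<eta> s))) = (y i \<otimes>\<^bsub>A\<^esub> \<iota> (E (c i \<otimes>\<^bsub>A\<^esub> b))) \<odot>\<^bsub>U\<^esub> \<eta> s"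
        using i b s unfolding cb \<epsilon>(2)[OF S.m_closed[OF c_closed[OF i] b] s]
        by (simp add: c_closed e \<eta>D y(1) t(7) U.smult_assoc)
    qed (use b s in \<open>simp_all add: U.smult_closed y(1) c_closed t(7) e Pi_def\<close>)
    also have "\<dots> = finsum A (\<lambda>i. y i \<otimes>\<^bsub>A\<^esub> \<iota> (E (c i \<otimes>\<^bsub>A\<^esub> b))) {..<n} \<odot>\<^bsub>U\<^esub> \<eta> s"
      by (rule finsum_smult[OF t(2), symmetric]) (use b s in \<open>simp_all add: y(1) c_closed t(7) e\<close>)
    finally show ?thesis by (simp add: dual[OF b])
  qed
  have G_id: "G u = u" if u: "u \<in> carrier U" for u
  proof -
    have "G u = G (finsum U (\<lambda>i. c i \<odot>\<^bsub>U\<^esub> \<eta> (\<pi> i u)) {..<n})" using t(5)[OF u] by simp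
    also have "\<dots> = finsum U (\<lambda>i. G (c i \<odot>\<^bsub>U\<^esub> \<eta> (\<pi> i u))) {..<n}"
      by (rule additive_finsum[where f=G, OF U.M.abelian_group_axioms U.M.abelian_group_axioms Gc Ga])
         (use u in \<open>simp_all add: U.smult_closed c_closed t(7,8)\<close>)
    also have "\<dots> = finsum U (\<lambda>i. c i \<odot>\<^bsub>U\<^esub> \<eta> (\<pi> i u)) {..<n}"
      by (rule U.M.finsum_cong') (use u in \<open>simp_all add: G\<eta> U.smult_closed c_closed t(7,8) Pi_def\<close>)
    also have "\<dots> = u" by (rule t(5)[OF u])
    finally show ?thesis .
  qed
  \<comment> \<open>Since \<open>G\<close> is the identity, u is determined by the values \<epsilon>
    (b u): nondegeneracy of \<open>E\<close>, transported to \<open>U\<close>.\<close>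
  have \<epsilon>_eq: "u = v" if "u \<in> carrier U" "v \<in> carrier U"
    "\<And>b. b \<in> carrier A \<Longrightarrow> \<epsilon> (b \<odot>\<^bsub>U\<^esub> u) = \<epsilon> (b \<odot>\<^bsub>U\<^esub> v)" for u v
  proof -
    have "G u = G v" unfolding G_def
      by (rule U.M.finsum_cong') (use that Gcl in \<open>simp_all add: c_closed Pi_def\<close>)
    then show ?thesis using G_id that by simp
  qed
  fix \<phi> assume \<phi>: "\<phi> \<in> module_homs R (rs N) T" and z: "\<And>x. x \<in> carrier (rs M) \<Longrightarrow> \<phi> (f x) = \<zero>\<^bsub>T\<^esub>"
  have \<phi>D: "\<phi> x \<in> carrier T" "x' \<in> carrier N \<Longrightarrow> \<phi> (x \<oplus>\<^bsub>N\<^esub> x') = \<phi> x \<oplus>\<^bsub>T\<^esub> \<phi> x'"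
    "r \<in> carrier R \<Longrightarrow> \<phi> (\<iota> r \<odot>\<^bsub>N\<^esub> x) = r \<odot>\<^bsub>T\<^esub> \<phi> x" if "x \<in> carrier N" for x x' r
    using module_homsD[OF \<phi>] that by simp_all
  \<comment> \<open>The formula for \<open>G\<close> with \<epsilon> (c i u) replaced by \<phi> (c i
    x). It is constructed so that \<epsilon> (b \<Phi> x) = \<phi> (b x), from which
    \<open>A\<close>-linearity follows by \<open>\<epsilon>_eq\<close>.\<close>
  define \<Phi> where "\<Phi> x = finsum U (\<lambda>i. y i \<odot>\<^bsub>U\<^esub> \<eta> (\<phi> (c i \<odot>\<^bsub>N\<^esub> x))) {..<n}" for x
  have cl: "y i \<odot>\<^bsub>U\<^esub> \<eta> (\<phi> (c i \<odot>\<^bsub>N\<^esub> x)) \<in> carrier U" if "i < n" "x \<in> carrier N" for i x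
    using that by (simp add: U.smult_closed N.smult_closed y(1) c_closed t(7) \<phi>D)
  have \<Phi>c: "\<Phi> x \<in> carrier U" if "x \<in> carrier N" for x
    unfolding \<Phi>_def using that by (intro U.M.finsum_closed) (simp add: cl)
  have \<epsilon>\<Phi>: "\<epsilon> (b \<odot>\<^bsub>U\<^esub> \<Phi> x) = \<phi> (b \<odot>\<^bsub>N\<^esub> x)" if b: "b \<in> carrier A" and x: "x \<in> carrier N" for b x
  proof -
    have "\<epsilon> (b \<odot>\<^bsub>U\<^esub> \<Phi> x) = \<epsilon> (finsum U (\<lambda>i. b \<odot>\<^bsub>U\<^esub> (y i \<odot>\<^bsub>U\<^esub> \<eta> (\<phi> (c i \<odot>\<^bsub>N\<^esub> x)))) {..<n})"
      unfolding \<Phi>_def using smult_finsum[OF t(2) b, of "{..<n}"] cl x by simp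
    also have "\<dots> = finsum T (\<lambda>i. \<epsilon> (b \<odot>\<^bsub>U\<^esub> (y i \<odot>\<^bsub>U\<^esub> \<eta> (\<phi> (c i \<odot>\<^bsub>N\<^esub> x))))) {..<n}"
      by (rule additive_finsum[where f=\<epsilon>, OF U.M.abelian_group_axioms T.M.abelian_group_axioms \<epsilon>c])
         (use b x cl in \<open>simp_all add: U.smult_closed\<close>)
    also have "\<dots> = finsum T (\<lambda>i. \<phi> ((\<iota> (p i b) \<otimes>\<^bsub>A\<^esub> c i) \<odot>\<^bsub>N\<^esub> x)) {..<n}"
    proof (rule T.M.finsum_cong')
      fix i assume "i \<in> {..<n}"
      then have i: "i < n" by simp
      have "\<epsilon> (b \<odot>\<^bsub>U\<^esub> (y i \<odot>\<^bsub>U\<^esub> \<eta> (\<phi> (c i \<odot>\<^bsub>N\<^esub> x)))) = p i b \<odot>\<^bsub>T\<^esub> \<phi> (c i \<odot>\<^bsub>N\<^esub> x)"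
        using i b x by (simp add: \<epsilon>(2) y \<phi>D N.smult_closed c_closed t(7) flip: U.smult_assoc)
      also have "\<dots> = \<phi> ((\<iota> (p i b) \<otimes>\<^bsub>A\<^esub> c i) \<odot>\<^bsub>N\<^esub> x)"
        using i b x by (simp add: N.smult_assoc c_closed p_simps \<phi>D N.smult_closed)
      finally show "\<epsilon> (b \<odot>\<^bsub>U\<^esub> (y i \<odot>\<^bsub>U\<^esub> \<eta> (\<phi> (c i \<odot>\<^bsub>N\<^esub> x)))) = \<phi> ((\<iota> (p i b) \<otimes>\<^bsub>A\<^esub> c i) \<odot>\<^bsub>N\<^esub> x)" .
    qed (use b x in \<open>simp_all add: \<phi>D N.smult_closed c_closed p_simps Pi_def\<close>)
    also have "\<dots> = \<phi> (finsum N (\<lambda>i. (\<iota> (p i b) \<otimes>\<^bsub>A\<^esub> c i) \<odot>\<^bsub>N\<^esub> x) {..<n})"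
      by (rule additive_finsum[symmetric, where f=\<phi>, OF N.M.abelian_group_axioms T.M.abelian_group_axioms \<phi>D(1,2)])
         (use b x in \<open>simp_all add: N.smult_closed c_closed p_simps\<close>)
    also have "finsum N (\<lambda>i. (\<iota> (p i b) \<otimes>\<^bsub>A\<^esub> c i) \<odot>\<^bsub>N\<^esub> x) {..<n} =
        finsum A (\<lambda>i. \<iota> (p i b) \<otimes>\<^bsub>A\<^esub> c i) {..<n} \<odot>\<^bsub>N\<^esub> x"
      by (rule finsum_smult[OF Nm x, symmetric]) (simp add: b c_closed p_simps)
    finally show ?thesis by (simp add: basis b)
  qed
  have \<Phi>: "\<Phi> \<in> module_homs A N U"
  proof (rule module_homsI)
    fix x x' assume x: "x \<in> carrier N" "x' \<in> carrier N"
    show "\<Phi> (x \<oplus>\<^bsub>N\<^esub> x') = \<Phi> x \<oplus>\<^bsub>U\<^esub> \<Phi> x'"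
      by (rule \<epsilon>_eq)
         (use x in \<open>simp_all add: \<Phi>c \<epsilon>\<Phi> U.smult_r_distr N.smult_r_distr \<epsilon>c \<phi>D U.smult_closed N.smult_closed\<close>)
  next
    fix a x assume a: "a \<in> carrier A" and x: "x \<in> carrier N"
    show "\<Phi> (a \<odot>\<^bsub>N\<^esub> x) = a \<odot>\<^bsub>U\<^esub> \<Phi> x"
      by (rule \<epsilon>_eq)
         (use a x in \<open>simp_all add: \<Phi>c \<epsilon>\<Phi> U.smult_closed N.smult_closed flip: U.smult_assoc N.smult_assoc\<close>)
  qed (rule \<Phi>c)
  have "\<Phi> (f x) = \<zero>\<^bsub>U\<^esub>" if x: "x \<in> carrier M" for x
  proof (rule \<epsilon>_eq)
    fix b assume b: "b \<in> carrier A"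
    have "\<epsilon> (b \<odot>\<^bsub>U\<^esub> \<Phi> (f x)) = \<phi> (f (b \<odot>\<^bsub>M\<^esub> x))"
      using b x by (simp add: \<epsilon>\<Phi> module_homsD[OF f])
    also have "\<dots> = \<zero>\<^bsub>T\<^esub>" using z b x by (simp add: M.smult_closed)
    also have "\<dots> = \<epsilon> (b \<odot>\<^bsub>U\<^esub> \<zero>\<^bsub>U\<^esub>)"
      using module_homs_zero[OF \<epsilon>(1) rsU t(1)] by (simp add: left_module_smult_zero(1)[OF t(2) b])
    finally show "\<epsilon> (b \<odot>\<^bsub>U\<^esub> \<Phi> (f x)) = \<epsilon> (b \<odot>\<^bsub>U\<^esub> \<zero>\<^bsub>U\<^esub>)" .
  qed (use x in \<open>simp_all add: \<Phi>c module_homsD[OF f]\<close>)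
  from hom_exactD[OF ex \<Phi> this] obtain \<Psi> where \<Psi>: "\<Psi> \<in> module_homs A K U"
    "\<And>x. x \<in> carrier N \<Longrightarrow> \<Phi> x = \<Psi> (g x)" by blast
  have "\<phi> x = \<epsilon> (\<Psi> (g x))" if x: "x \<in> carrier N" for x
    using \<epsilon>\<Phi>[OF S.one_closed x] \<Psi>(2)[OF x] \<Phi>c[OF x] x by (simp add: U.smult_one N.smult_one)
  then show "\<exists>\<psi>\<in>module_homs R (rs K) T. \<forall>x\<in>carrier (rs N). \<phi> x = \<psi> (g x)"
    using module_homs_comp[OF module_homs_restrict_scalars[OF \<Psi>(1)] \<epsilon>(1)]
    by (intro bexI[of _ "\<lambda>x. \<epsilon> (\<Psi> x)"]) auto
qed

lemma wakamatsu_tilting_of_extend_scalars: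
  fixes T :: "('r, 't, 'z) module_scheme"
  assumes Tm: "left_module R T" and W: "wakamatsu_tilting A (extend_scalars R A \<iota> T)"
    and q: "bimodule_functional q" "q \<one>\<^bsub>A\<^esub> = \<one>\<^bsub>R\<^esub>"
  shows "wakamatsu_tilting R T"
proof -
  let ?U = "extend_scalars R A \<iota> T"
  obtain \<eta> \<pi> where U: "induced T ?U \<eta> \<pi>" by (rule extend_scalars_induced[OF Tm])
  note u = inducedD[OF U]
  interpret U: left_module A ?U by (rule u(2))
  interpret T: left_module R T by (rule Tm)
  obtain P :: "nat \<Rightarrow> ('a, nat \<Rightarrow> 'a) module" and d e
    and C :: "nat \<Rightarrow> ('a, nat \<Rightarrow> (('a \<times> 't) \<Rightarrow>\<^sub>0 int) set) module" and e' d'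
    where fg: "fg_resolution A ?U P d e"
      and ext: "\<And>j. hom_exact A (P (Suc (Suc j))) (d (Suc j)) (P (Suc j)) (d j) (P j) ?U"
      and co: "add_coresolution A ?U C e' d'"
    using W[unfolded wakamatsu_tilting_iff[OF u(2)]] by blast
  note f = fg_resolutionD[OF fg]
  note r = projective_resolutionD[OF f(1)]
  have add: "\<And>j. in_add A ?U (C j)" and ex: "exact_coresolution A C e' d'"
    and h0: "hom_exact A (regular_module A) (\<lambda>_. \<zero>\<^bsub>A\<^esub>) (regular_module A) e' (C 0) ?U"
    and h1: "hom_exact A (regular_module A) e' (C 0) (d' 0) (C (Suc 0)) ?U"
    and h2: "\<And>j. hom_exact A (C j) (d' j) (C (Suc j)) (d' (Suc j)) (C (Suc (Suc j))) ?U"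
    using co by (auto simp: add_coresolution_def)
  note x = exact_coresolutionD[OF ex]
  have Cm: "left_module A (C j)" for j by (rule in_add_left_module[OF add])
  have Am: "left_module A (regular_module A)" by (rule left_module_regular[OF S.ring_axioms])
  have rP: "fg_resolution R (rs ?U) (\<lambda>i. rs (P i)) d e"
  proof (rule fg_resolutionI[OF R.ring_axioms])
    show "in_add R (regular_module R) (rs (P i))" for i by (rule in_add_restrict[OF induced_regular f(2)])
    show "d i \<in> module_homs R (rs (P (Suc i))) (rs (P i))" for i by (rule module_homs_restrict_scalars[OF r(2)])
    show "e \<in> module_homs R (rs (P 0)) (rs ?U)" by (rule module_homs_restrict_scalars[OF r(3)])
    show "e ` carrier (rs (P 0)) = carrier (rs ?U)" using r(4) by simp
    show "d 0 ` carrier (rs (P (Suc 0))) = a_kernel (rs (P 0)) (rs ?U) e"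
      using r(5) by (simp add: a_kernel_def')
    show "d (Suc i) ` carrier (rs (P (Suc (Suc i)))) = a_kernel (rs (P (Suc i))) (rs (P i)) (d i)" for i
      using r(6)[of i] by (simp add: a_kernel_def')
  qed
  obtain \<rho> where \<rho>: "\<rho> \<in> module_homs R (rs ?U) T"
    "\<And>b t. b \<in> carrier A \<Longrightarrow> t \<in> carrier T \<Longrightarrow> \<rho> (b \<odot>\<^bsub>?U\<^esub> \<eta> t) = q b \<odot>\<^bsub>T\<^esub> t"
    by (rule induced_contraction[OF U q(1)], rule that)
  have \<rho>\<eta>: "\<rho> (\<eta> t) = t" if "t \<in> carrier T" for t
    using \<rho>(2)[OF S.one_closed that] that by (simp add: q(2) U.smult_one T.smult_one u(7))
  obtain Q :: "nat \<Rightarrow> ('r, nat \<Rightarrow> 'r) module" and \<delta> \<epsilon> where Q: "fg_resolution R T Q \<delta> \<epsilon>"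
    by (rule fg_resolution_retract[OF Tm left_module_restrict_scalars[OF u(2)] u(3) \<rho>(1) \<rho>\<eta> rP])
  note Qf = fg_resolutionD[OF Q]
  note Qr = projective_resolutionD[OF Qf(1)]
  let ?Q = "\<lambda>i. extend_scalars R A \<iota> (Q i)"
  \<comment> \<open>Extended back to \<open>A\<close>, the resolution of \<open>T\<close> and the
    given \<open>P\<close> resolve the same module; Hom-exactness moves from \<open>P\<close> to the
    extended resolution and then descends along \<open>q\<close>.\<close>
  obtain D \<epsilon>Q \<eta>Q \<pi>Q where FQ: "fg_resolution A ?U ?Q D \<epsilon>Q"
    and QI: "\<And>i. induced (Q i) (?Q i) (\<eta>Q i) (\<pi>Q i)"
    and D: "\<And>i. induced_map (Q (Suc i)) (?Q (Suc i)) (\<eta>Q (Suc i)) (?Q i) (\<eta>Q i) (\<delta> i) (D i)"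
    by (rule fg_resolution_extend_scalars[OF U Q], rule that)
  have extQ: "hom_exact R (Q (Suc (Suc j))) (\<delta> (Suc j)) (Q (Suc j)) (\<delta> j) (Q j) T" for j
    by (rule hom_exact_of_induced[OF QI QI QI U Qr(2) Qr(2) D D q
          hom_exact_resolution_transfer[OF u(2) u(2) f(1) fg_resolutionD(1)[OF FQ] ext]])
  note hr = hom_exact_restrict_scalars[OF U]
  have zA: "(\<lambda>_. \<zero>\<^bsub>A\<^esub>) \<in> module_homs A (regular_module A) (regular_module A)"
    using module_homs_const_zero[OF Am, of "regular_module A"] by simp
  have \<iota>: "\<iota> \<in> module_homs R (regular_module R) (rs (regular_module A))"
    by (rule module_homsI) simp_all
  have qm: "q \<in> module_homs R (rs (regular_module A)) (regular_module R)"
    by (rule module_homsI) (simp_all add: bimodule_functionalD[OF q(1)])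
  have q\<iota>: "q (\<iota> r) = r" if "r \<in> carrier R" for r
    using bimodule_functionalD(3)[OF q(1) that S.one_closed] that by (simp add: q(2))
  obtain C' :: "nat \<Rightarrow> ('r, nat \<Rightarrow> 't) module" and \<epsilon>C dC where "add_coresolution R T C' \<epsilon>C dC"
  proof (rule add_coresolution_retract[OF Tm left_module_restrict_scalars[OF Am] \<iota> qm q\<iota>, where C="\<lambda>j. rs (C j)" and e=e' and d=d'])
    show "in_add R T (rs (C j))" for j by (rule in_add_restrict[OF U add])
    show "e' \<in> module_homs R (rs (regular_module A)) (rs (C 0))" by (rule module_homs_restrict_scalars[OF x(1)])
    show "d' j \<in> module_homs R (rs (C j)) (rs (C (Suc j)))" for j by (rule module_homs_restrict_scalars[OF x(2)])
    show "inj_on e' (carrier (rs (regular_module A)))" using x(3) by simp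
    show "e' ` carrier (rs (regular_module A)) = a_kernel (rs (C 0)) (rs (C (Suc 0))) (d' 0)"
      using x(4) by (simp add: a_kernel_def')
    show "d' j ` carrier (rs (C j)) = a_kernel (rs (C (Suc j))) (rs (C (Suc (Suc j)))) (d' (Suc j))" for j
      using x(5)[of j] by (simp add: a_kernel_def')
    show "hom_exact R (rs (regular_module A)) (\<lambda>_. \<zero>\<^bsub>rs (regular_module A)\<^esub>) (rs (regular_module A)) e' (rs (C 0)) T"
      using hr[OF Am Am zA h0] by simp
    show "hom_exact R (rs (regular_module A)) e' (rs (C 0)) (d' 0) (rs (C (Suc 0))) T"
      by (rule hr[OF Am Cm x(1) h1])
    show "hom_exact R (rs (C j)) (d' j) (rs (C (Suc j))) (d' (Suc j)) (rs (C (Suc (Suc j)))) T" for j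
      by (rule hr[OF Cm Cm x(2) h2])
  qed
  then show ?thesis by (rule wakamatsu_tiltingI[OF Tm Q extQ])
qed

end

theorem corollary2p9:
  fixes R :: "('r, 'x) ring_scheme" and A :: "('a, 'y) ring_scheme"
    and \<iota> :: "'r \<Rightarrow> 'a" and T :: "('r, 't, 'z) module_scheme"
  assumes "frobenius_extension R A \<iota>"
    and "split_extension R A \<iota>"
    and "centrally_projective_extension R A \<iota>"
    and "left_module R T"
  shows "wakamatsu_tilting R T \<longleftrightarrow> wakamatsu_tilting A (extend_scalars R A \<iota> T)"
proof -
  obtain n c p where "centrally_projective_hom R A \<iota> n c p"
    by (rule centrally_projective_basis[OF assms(3)])
  then interpret centrally_projective_hom R A \<iota> n c p .
  obtain q where q: "bimodule_functional q" "q \<one>\<^bsub>A\<^esub> = \<one>\<^bsub>R\<^esub>"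
    by (rule split_extension_functional[OF assms(2)])
  obtain E where E: "bimodule_functional E"
    and rep: "\<And>f. f \<in> module_homs R (ring_bimodule A \<iota> \<iota>) (regular_module R) \<Longrightarrow>
      \<exists>y\<in>carrier A. \<forall>x\<in>carrier A. f x = E (x \<otimes>\<^bsub>A\<^esub> y)"
    and nondeg: "\<And>y z. y \<in> carrier A \<Longrightarrow> z \<in> carrier A \<Longrightarrow>
      (\<And>x. x \<in> carrier A \<Longrightarrow> E (x \<otimes>\<^bsub>A\<^esub> y) = E (x \<otimes>\<^bsub>A\<^esub> z)) \<Longrightarrow> y = z"
    using frobenius_functional[OF assms(1)] by metis
  have "p i \<in> module_homs R (ring_bimodule A \<iota> \<iota>) (regular_module R)" if "i < n" for i
    by (rule module_homsI) (simp_all add: p_simps that)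
  \<comment> \<open>Each coordinate is a left \<open>R\<close>-linear functional, so the Frobenius
    isomorphism represents it by an element of \<open>A\<close>.\<close>
  then have "\<forall>i. \<exists>y. i < n \<longrightarrow> y \<in> carrier A \<and> (\<forall>x\<in>carrier A. p i x = E (x \<otimes>\<^bsub>A\<^esub> y))"
    using rep by blast
  then obtain y where y: "\<And>i. i < n \<Longrightarrow> y i \<in> carrier A"
    "\<And>i x. i < n \<Longrightarrow> x \<in> carrier A \<Longrightarrow> p i x = E (x \<otimes>\<^bsub>A\<^esub> y i)" by metis
  interpret central_frobenius_hom R A \<iota> n c p E y
    by unfold_locales (fact E y nondeg)+
  show ?thesis
    using wakamatsu_tilting_extend_scalars wakamatsu_tilting_of_extend_scalars[OF assms(4) _ q] by blast
qed

end
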